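(* Let $D\subset\mathbb{R}^n$ be a bounded convex domain, let $1\le k\le n$, and let $T$ be the Iwaniec–Lutoborski homotopy operator on $k$-forms on $D$ (defined in the context). If $\frac1p-\frac1q<\frac1n$, then the operator $$T:\Omega^k_p(D)\to\Omega^{k-1}_q(D)$$ is compact.
   Context: For $p\in[1,\infty)$, $\Omega^k_p(D)$ is the Banach space of (equivalence classes of) measurable differential $k$-forms $\omega$ on $D$ with finite norm $\|\omega\|_{\Omega^k_p(D)}=\big(\int_D|\omega|_x^p\,dx\big)^{1/p}$, where $|\omega|_x$ is the modulus of $\omega$ at $x$: if $\omega=\sum_\alpha \omega_\alpha dx^{\alpha}$ over strictly increasing multi-indices $\alpha$, then $|\omega|_x=\big(\sum_\alpha \omega_\alpha(x)^2\big)^{1/2}$. Here $p,q\in[1,\infty)$. The operator $T$ sends a $k$-form $\omega$ on $D$ to the $(k-1)$-form $T\omega$ whose value at $x\in D$ on vectors $\xi_1,\dots,\xi_{k-1}\in\mathbb{R}^n$ is $$T\omega(x)\langle\xi_1,\dots,\xi_{k-1}\rangle=\int_D\omega(z)\langle\zeta(z,x-z),\xi_1,\dots,\xi_{k-1}\rangle\,dz,$$ where $\zeta:D\times\mathbb{R}^n\to\mathbb{R}^n$ is given (for $h\neq0$) by $$\zeta(z,h)=\sum_{\nu=k}^n\binom{n-k}{\nu-k}\frac{h}{|h|^\nu}\int_0^\infty s^{\nu-1}\varphi\Big(z-s\frac{h}{|h|}\Big)\,ds,$$ and $\varphi\in C_0^\infty(D)$ (extended by $0$ to $\mathbb{R}^n$)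 is a fixed function with $\int_{\mathbb{R}^n}\varphi(y)\,dy=1$ and $|\nabla\varphi|\le 2\mu(D)(\mathrm{diam}\,D)^{-n-1}$, where $\mu(D)$ is a positive constant depending only on $D$. *)

theory Defs
  imports "HOL-Analysis.Analysis"
begin

subsection \<open>Alternating forms\<close>

text \<open>
  The value of a \<open>k\<close>-form at a point is a real function of the list of its \<open>k\<close> vector arguments;
  what it does on lists of any other length is irrelevant everywhere below.
\<close>

type_synonym 'n form = "real ^ 'n \<Rightarrow> (real ^ 'n) list \<Rightarrow> real"

definition alternating_form :: "nat \<Rightarrow> ((real ^ 'n) list \<Rightarrow> real) \<Rightarrow> bool" where
  "alternating_form k f \<longleftrightarrow>
     (\<forall>\<xi>. length \<xi> = k \<longrightarrow>
        (\<forall>i<k. linear (\<lambda>v. f (\<xi>[i := v]))) \<and> (\<not> distinct \<xi> \<longrightarrow> f \<xi> = 0))"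

definition multi_indices :: "nat \<Rightarrow> 'n::{finite,linorder} list set" where
  "multi_indices k = {\<alpha>. length \<alpha> = k \<and> sorted_wrt (<) \<alpha>}"

text \<open>The coefficient of \<open>dx\<^sup>\<alpha>\<close> is the value on the corresponding standard basis vectors.\<close>

definition coefficient :: "((real ^ 'n) list \<Rightarrow> real) \<Rightarrow> 'n list \<Rightarrow> real" where
  "coefficient f \<alpha> = f (map (\<lambda>i. axis i 1) \<alpha>)"

definition modulus :: "nat \<Rightarrow> ((real ^ 'n::{finite,linorder}) list \<Rightarrow> real) \<Rightarrow> real" where
  "modulus k f = sqrt (\<Sum>\<alpha>\<in>multi_indices k. (coefficient f \<alpha>)\<^sup>2)"


subsection \<open>The spaces \<open>\<Omega>\<^sup>k\<^sub>p(D)\<close>\<close>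

text \<open>
  Representatives are required to be alternating multilinear only at almost every point of \<open>D\<close>.
  This does not change the equivalence classes (up to values on a null set), and it is needed
  because the integral defining the homotopy operator converges only almost everywhere.
\<close>

definition forms :: "nat \<Rightarrow> real \<Rightarrow> (real ^ 'n::{finite,linorder}) set \<Rightarrow> 'n form set" where
  "forms k p D = {\<omega>.
     (AE x in lebesgue_on D. alternating_form k (\<omega> x)) \<and>
     (\<forall>\<alpha>\<in>multi_indices k. (\<lambda>x. coefficient (\<omega> x) \<alpha>) \<in> borel_measurable (lebesgue_on D)) \<and>
     integrable (lebesgue_on D) (\<lambda>x. modulus k (\<omega> x) powr p)}"

definition form_norm ::
  "nat \<Rightarrow> real \<Rightarrow> (real ^ 'n::{finite,linorder}) set \<Rightarrow> 'n form \<Rightarrow> real" where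
  "form_norm k p D \<omega> = (LINT x|lebesgue_on D. modulus k (\<omega> x) powr p) powr (1 / p)"

definition form_eq :: "nat \<Rightarrow> (real ^ 'n) set \<Rightarrow> 'n form \<Rightarrow> 'n form \<Rightarrow> bool" where
  "form_eq k D \<omega> \<eta> \<longleftrightarrow> (AE x in lebesgue_on D. \<forall>\<xi>. length \<xi> = k \<longrightarrow> \<omega> x \<xi> = \<eta> x \<xi>)"

definition form_class ::
  "nat \<Rightarrow> real \<Rightarrow> (real ^ 'n::{finite,linorder}) set \<Rightarrow> 'n form \<Rightarrow> 'n form set" where
  "form_class k p D \<omega> = {\<eta> \<in> forms k p D. form_eq k D \<omega> \<eta>}"

definition Omega :: "nat \<Rightarrow> real \<Rightarrow> (real ^ 'n::{finite,linorder}) set \<Rightarrow> 'n form set set" where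
  "Omega k p D = form_class k p D ` forms k p D"

definition Omega_dist ::
  "nat \<Rightarrow> real \<Rightarrow> (real ^ 'n::{finite,linorder}) set \<Rightarrow> 'n form set \<Rightarrow> 'n form set \<Rightarrow> real" where
  "Omega_dist k p D X Y =
     form_norm k p D (\<lambda>x \<xi>. (SOME \<omega>. \<omega> \<in> X) x \<xi> - (SOME \<eta>. \<eta> \<in> Y) x \<xi>)"


subsection \<open>Compact operators \<open>\<Omega>\<^sup>k\<^sub>p(D) \<rightarrow> \<Omega>\<^sup>l\<^sub>q(D)\<close>\<close>

definition induced_map ::
  "nat \<Rightarrow> real \<Rightarrow> (real ^ 'n::{finite,linorder}) set \<Rightarrow> ('n form \<Rightarrow> 'n form) \<Rightarrow>
   'n form set \<Rightarrow> 'n form set" where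
  "induced_map l q D S X = (\<Union>\<omega>\<in>X. form_class l q D (S \<omega>))"

text \<open>
  The first three conditions say that \<open>S\<close> descends to a well-defined linear map of the quotient
  spaces, the last one that this map sends bounded sets to relatively compact sets.
\<close>

definition compact_operator_on_forms ::
  "nat \<Rightarrow> real \<Rightarrow> nat \<Rightarrow> real \<Rightarrow> (real ^ 'n::{finite,linorder}) set \<Rightarrow>
   ('n form \<Rightarrow> 'n form) \<Rightarrow> bool" where
  "compact_operator_on_forms k p l q D S \<longleftrightarrow>
     (\<forall>\<omega>\<in>forms k p D. S \<omega> \<in> forms l q D) \<and>
     (\<forall>\<omega>\<in>forms k p D. \<forall>\<eta>\<in>forms k p D. form_eq k D \<omega> \<eta> \<longrightarrow> form_eq l D (S \<omega>) (S \<eta>)) \<and>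
     (\<forall>\<omega>\<in>forms k p D. \<forall>\<eta>\<in>forms k p D. \<forall>a b.
        form_eq l D (S (\<lambda>x \<xi>. a * \<omega> x \<xi> + b * \<eta> x \<xi>)) (\<lambda>x \<xi>. a * S \<omega> x \<xi> + b * S \<eta> x \<xi>)) \<and>
     (\<forall>B. B \<subseteq> Omega k p D \<and> Metric_space.mbounded (Omega k p D) (Omega_dist k p D) B \<longrightarrow>
        compactin (Metric_space.mtopology (Omega l q D) (Omega_dist l q D))
          (Metric_space.mtopology (Omega l q D) (Omega_dist l q D)
             closure_of (induced_map l q D S ` B)))"


subsection \<open>The Iwaniec--Lutoborski homotopy operator\<close>

primrec continuously_differentiable :: "nat \<Rightarrow> (real ^ 'n \<Rightarrow> real) \<Rightarrow> bool" where
  "continuously_differentiable 0 f \<longleftrightarrow> continuous_on UNIV f"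
| "continuously_differentiable (Suc m) f \<longleftrightarrow>
     (\<forall>x. f differentiable (at x)) \<and>
     (\<forall>i. continuously_differentiable m (\<lambda>x. frechet_derivative f (at x) (axis i 1)))"

text \<open>Members of \<open>C\<^sub>0\<^sup>\<infinity>(D)\<close> are functions on the whole space, i.e. already extended by zero.\<close>

definition test_function :: "(real ^ 'n) set \<Rightarrow> (real ^ 'n \<Rightarrow> real) \<Rightarrow> bool" where
  "test_function D \<phi> \<longleftrightarrow>
     (\<forall>m. continuously_differentiable m \<phi>) \<and>
     compact (closure {y. \<phi> y \<noteq> 0}) \<and> closure {y. \<phi> y \<noteq> 0} \<subseteq> D"

definition gradient :: "(real ^ 'n \<Rightarrow> real) \<Rightarrow> real ^ 'n \<Rightarrow> real ^ 'n" where
  "gradient f y = (\<chi> i. frechet_derivative f (at y) (axis i 1))"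

definition zeta_kernel ::
  "nat \<Rightarrow> (real ^ 'n \<Rightarrow> real) \<Rightarrow> real ^ 'n \<Rightarrow> real ^ 'n \<Rightarrow> real ^ 'n" where
  "zeta_kernel k \<phi> z h =
     (\<Sum>\<nu>=k..CARD('n).
        (real ((CARD('n) - k) choose (\<nu> - k)) *
         (LINT s:{0<..}|lebesgue. s ^ (\<nu> - 1) * \<phi> (z - (s / norm h) *\<^sub>R h))) *\<^sub>R
        ((1 / norm h ^ \<nu>) *\<^sub>R h))"

definition homotopy_operator ::
  "nat \<Rightarrow> (real ^ 'n) set \<Rightarrow> (real ^ 'n \<Rightarrow> real) \<Rightarrow> 'n form \<Rightarrow> 'n form" where
  "homotopy_operator k D \<phi> \<omega> =
     (\<lambda>x \<xi>. LINT z|lebesgue_on D. \<omega> z (zeta_kernel k \<phi> z (x - z) # \<xi>))"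

end

theory Submission
  imports Defs
begin

text \<open>
  Since \<open>\<phi>\<close> is bounded with compact support, \<open>|\<zeta>(z, x - z)| \<le> C |x - z|^(1 - n)\<close> on \<open>D \<times> D\<close>, and \<open>\<zeta>\<close>
  is continuous off the diagonal. In coefficients the operator is therefore a finite combination
  of weakly singular integral operators on functions.

  A kernel \<open>|h|^(1 - n)\<close> cut off to \<open>|h| < \<delta>\<close> lies in \<open>L^r\<close> for \<open>1/r = 1 - (1/p - 1/q) > 1 - 1/n\<close>,
  with norm tending to \<open>0\<close> as \<open>\<delta> \<rightarrow> 0\<close>, so that by Young's inequality the part of the operator near the
  diagonal has small norm from \<open>L^p\<close> to \<open>L^q\<close>. The rest has a uniformly continuous kernel, and the size
  of its values on all of \<open>D\<close> is controlled by its values on a finite net. Hence finitely many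
  bounded functionals determine the image of a bounded set up to any given error, i.e. the image is
  totally bounded; the target space is complete.
\<close>

subsection \<open>Convolution with a truncated power\<close>

text \<open>The scalar heart is \<open>T_compact\<close>: a function bounded in the p-norm on which
  finitely many functionals are small has a small image. Applied to differences, this needs only
  linearity: rounding the functional values cuts a bounded set into finitely many cells, and two
  members of one cell have close images. Young's inequality needs p \<le> q, while the exponent
  condition also admits p > q. As \<open>D\<close> has finite measure, p may then be lowered to min
  p q, at the price of adding the measure of \<open>D\<close> to the bound. A second obstacle is
  that everything holds only almost everywhere: forms are alternating off a null set, and the
  integrals of the operator converge off a null set. Expansions in finitely many coefficients, with
  scalars independent of the form, let one null set serve all vector arguments at once. Coefficients
  are replaced by Borel functions vanishing off \<open>D\<close>, so that Tonelli's theorem and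
  translation invariance apply on the whole space.\<close>

lemma weighted_arith_geom_mean3:
  fixes a b c :: real
  assumes "a \<ge> 0" "b \<ge> 0" "c \<ge> 0" and w: "\<alpha> \<ge> 0" "\<beta> \<ge> 0" "\<gamma> \<ge> 0" "\<alpha> + \<beta> + \<gamma> = 1"
  shows "a powr \<alpha> * b powr \<beta> * c powr \<gamma> \<le> \<alpha> * a + \<beta> * b + \<gamma> * c"
proof (cases "a = 0 \<or> b = 0 \<or> c = 0")
  case True
  then show ?thesis using assms by auto
next
  case False
  define m where "m = \<alpha> * ln a + \<beta> * ln b + \<gamma> * ln c"
  \<comment> \<open>\<open>exp\<close> lies above its tangent at \<open>m\<close>, the weighted mean
    of the logarithms. Averaging the three inequalities with weights of sum 1 cancels the linear
    terms and leaves \<open>exp m\<close>, the geometric mean.\<close>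
  have tangent: "exp m * (1 + (ln t - m)) \<le> t" if "t > 0" for t :: real
  proof -
    have "exp m * (1 + (ln t - m)) \<le> exp m * exp (ln t - m)"
      by (intro mult_left_mono exp_ge_add_one_self) auto
    also have "\<dots> = t" using that by (simp flip: exp_add)
    finally show ?thesis .
  qed
  have "a powr \<alpha> * b powr \<beta> * c powr \<gamma> = exp m"
    using False assms by (simp add: powr_def m_def exp_add)
  also have "\<dots> = exp m * ((\<alpha> + \<beta> + \<gamma>) * (1 - m) + m)"
    using w by simp
  also have "\<dots> = \<alpha> * (exp m * (1 + (ln a - m))) + \<beta> * (exp m * (1 + (ln b - m)))
      + \<gamma> * (exp m * (1 + (ln c - m)))"
    by (simp add: m_def algebra_simps)
  also have "\<dots> \<le> \<alpha> * a + \<beta> * b + \<gamma> * c"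
    using False assms by (intro add_mono mult_left_mono tangent) auto
  finally show ?thesis .
qed

text \<open>Dividing each function by its integral reduces the claim to the integrated
  arithmetic-geometric mean inequality. Zero weights are allowed: since \<open>0 powr 0 = 0\<close>,
  both sides vanish as soon as one of the integrals is 0.\<close>

lemma Holder_inequality3:
  fixes a b c :: "'a \<Rightarrow> real"
  assumes int: "integrable M a" "integrable M b" "integrable M c"
    and nn: "\<And>x. a x \<ge> 0" "\<And>x. b x \<ge> 0" "\<And>x. c x \<ge> 0"
    and w: "\<alpha> \<ge> 0" "\<beta> \<ge> 0" "\<gamma> \<ge> 0" "\<alpha> + \<beta> + \<gamma> = 1"
  shows "integrable M (\<lambda>x. a x powr \<alpha> * b x powr \<beta> * c x powr \<gamma>)" (is "integrable M ?g")
    and "(\<integral>x. a x powr \<alpha> * b x powr \<beta> * c x powr \<gamma> \<partial>M)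
      \<le> (\<integral>x. a x \<partial>M) powr \<alpha> * (\<integral>x. b x \<partial>M) powr \<beta> * (\<integral>x. c x \<partial>M) powr \<gamma>"
proof -
  have [measurable]: "a \<in> borel_measurable M" "b \<in> borel_measurable M" "c \<in> borel_measurable M"
    using int by auto
  show g: "integrable M ?g"
  proof (rule Bochner_Integration.integrable_bound)
    show "integrable M (\<lambda>x. \<alpha> * a x + \<beta> * b x + \<gamma> * c x)" using int by auto
    show "AE x in M. norm (?g x) \<le> norm (\<alpha> * a x + \<beta> * b x + \<gamma> * c x)"
      using nn w by (intro AE_I2) (auto intro!: order_trans[OF weighted_arith_geom_mean3] mult_nonneg_nonneg)
  qed measurable
  define A where "A = (\<integral>x. a x \<partial>M)"
  define B where "B = (\<integral>x. b x \<partial>M)"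
  define C where "C = (\<integral>x. c x \<partial>M)"
  have ABC: "A \<ge> 0" "B \<ge> 0" "C \<ge> 0" using nn by (auto simp: A_def B_def C_def)
  show "(\<integral>x. ?g x \<partial>M) \<le> A powr \<alpha> * B powr \<beta> * C powr \<gamma>"
  proof (cases "A = 0 \<or> B = 0 \<or> C = 0")
    case True
    then have "(AE x in M. a x = 0) \<or> (AE x in M. b x = 0) \<or> (AE x in M. c x = 0)"
      unfolding A_def B_def C_def using int nn by (simp add: integral_nonneg_eq_0_iff_AE)
    then have "AE x in M. ?g x = 0"
      by (elim disjE) (auto elim: eventually_mono)
    then have "(\<integral>x. ?g x \<partial>M) = 0" by (simp add: integral_eq_zero_AE)
    then show ?thesis using ABC by simp
  next
    case False
    then have pos: "A > 0" "B > 0" "C > 0" using ABC by auto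
    have "?g x \<le> A powr \<alpha> * B powr \<beta> * C powr \<gamma> * (\<alpha> / A * a x + \<beta> / B * b x + \<gamma> / C * c x)" for x
    proof -
      have "?g x = A powr \<alpha> * B powr \<beta> * C powr \<gamma> *
          ((a x / A) powr \<alpha> * (b x / B) powr \<beta> * (c x / C) powr \<gamma>)"
        using pos nn by (simp add: powr_divide)
      also have "\<dots> \<le> A powr \<alpha> * B powr \<beta> * C powr \<gamma> *
          (\<alpha> * (a x / A) + \<beta> * (b x / B) + \<gamma> * (c x / C))"
        using pos nn w by (intro mult_left_mono weighted_arith_geom_mean3) auto
      finally show ?thesis by simp
    qed
    then have "(\<integral>x. ?g x \<partial>M) \<le>
        (\<integral>x. A powr \<alpha> * B powr \<beta> * C powr \<gamma> * (\<alpha> / A * a x + \<beta> / B * b x + \<gamma> / C * c x) \<partial>M)"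
      using int g by (intro integral_mono) auto
    also have "\<dots> = A powr \<alpha> * B powr \<beta> * C powr \<gamma> * (\<alpha> / A * A + \<beta> / B * B + \<gamma> / C * C)"
      using int by (simp add: A_def B_def C_def)
    also have "\<dots> = A powr \<alpha> * B powr \<beta> * C powr \<gamma>" using pos w by simp
    finally show ?thesis .
  qed
qed

section \<open>Reflection and translation invariance of Lebesgue measure\<close>

lemma distr_lborel_reflect:
  fixes c :: "'a::euclidean_space"
  shows "distr lborel borel (\<lambda>z. c - z) = lborel"
  using lborel_affine[of "-1" c] by (simp add: density_1)

lemma nn_integral_lborel_reflect:
  fixes c :: "'a::euclidean_space"
  assumes "f \<in> borel_measurable borel"
  shows "(\<integral>\<^sup>+z. f (c - z) \<partial>lborel) = (\<integral>\<^sup>+z. f z \<partial>lborel)"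
proof -
  have "(\<integral>\<^sup>+z. f z \<partial>lborel) = (\<integral>\<^sup>+z. f z \<partial>distr lborel borel (\<lambda>z. c - z))"
    by (simp add: distr_lborel_reflect)
  also have "\<dots> = (\<integral>\<^sup>+z. f (c - z) \<partial>lborel)"
    using assms by (subst nn_integral_distr) auto
  finally show ?thesis by simp
qed

lemma nn_integral_lborel_translate:
  fixes c :: "'a::euclidean_space"
  assumes "f \<in> borel_measurable borel"
  shows "(\<integral>\<^sup>+x. f (x - c) \<partial>lborel) = (\<integral>\<^sup>+x. f x \<partial>lborel)"
proof -
  have "(\<integral>\<^sup>+x. f x \<partial>lborel) = (\<integral>\<^sup>+x. f x \<partial>distr lborel borel ((+) (-c)))"
    by (simp add: lborel_distr_plus)
  also have "\<dots> = (\<integral>\<^sup>+x. f (x - c) \<partial>lborel)"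
    using assms by (subst nn_integral_distr) auto
  finally show ?thesis by simp
qed

text \<open>
  Pointwise, \<open>k f = (k^r f^p)^(1/q) (k^r)^(1 - 1/p) (f^p)^(1/p - 1/q)\<close>, and only the first factor
  couples the two variables. The degenerate exponents are harmless because \<open>0 powr 0 = 0\<close>.
\<close>

lemma Young_convolution_inequality:
  fixes k f :: "'a::euclidean_space \<Rightarrow> real"
  assumes [measurable]: "k \<in> borel_measurable borel" "f \<in> borel_measurable borel"
    and k: "\<And>h. k h \<ge> 0" and f: "\<And>z. f z \<ge> 0"
    and pq: "1 \<le> p" "p \<le> q" and r: "r > 0" "1 / r = 1 - (1 / p - 1 / q)"
    and kr: "integrable lborel (\<lambda>h. k h powr r)" and fp: "integrable lborel (\<lambda>z. f z powr p)"
  defines "B \<equiv> LINT h|lborel. k h powr r" and "P \<equiv> LINT z|lborel. f z powr p"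
  shows "AE x in lborel. integrable lborel (\<lambda>z. k (x - z) * f z)"
    and "(\<integral>\<^sup>+x. ennreal ((LINT z|lborel. k (x - z) * f z) powr q) \<partial>lborel)
      \<le> ennreal (B * P * (B powr (1 - 1 / p) * P powr (1 / p - 1 / q)) powr q)"
proof -
  \<comment> \<open>\<open>J x\<close> is the integral of the only factor coupling \<open>x\<close>
    and \<open>z\<close>. By Tonelli its integral over \<open>x\<close> is \<open>B * P\<close>, so
    it is finite for almost every \<open>x\<close>; at each such \<open>x\<close> the three-factor
    Hoelder inequality gives both integrability and the pointwise bound.\<close>
  define J where "J x = (\<integral>\<^sup>+z. ennreal (k (x - z) powr r * f z powr p) \<partial>lborel)" for x
  have [measurable]: "J \<in> borel_measurable lborel" unfolding J_def by measurable
  have B: "(\<integral>\<^sup>+h. ennreal (k h powr r) \<partial>lborel) = ennreal B"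
    unfolding B_def by (rule nn_integral_eq_integral[OF kr]) auto
  have P: "(\<integral>\<^sup>+h. ennreal (f h powr p) \<partial>lborel) = ennreal P"
    unfolding P_def by (rule nn_integral_eq_integral[OF fp]) auto
  have B0: "B \<ge> 0" "P \<ge> 0" by (auto simp: B_def P_def)
  have "(\<integral>\<^sup>+x. J x \<partial>lborel)
      = (\<integral>\<^sup>+z. \<integral>\<^sup>+x. ennreal (k (x - z) powr r * f z powr p) \<partial>lborel \<partial>lborel)"
    unfolding J_def by (rule lborel_pair.Fubini') measurable
  also have "\<dots> = (\<integral>\<^sup>+z. ennreal B * ennreal (f z powr p) \<partial>lborel)"
  proof (rule nn_integral_cong)
    fix z :: 'a
    have "(\<integral>\<^sup>+x. ennreal (k (x - z) powr r * f z powr p) \<partial>lborel)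
        = (\<integral>\<^sup>+x. ennreal (k (x - z) powr r) \<partial>lborel) * ennreal (f z powr p)"
      by (simp add: ennreal_mult nn_integral_multc)
    also have "(\<integral>\<^sup>+x. ennreal (k (x - z) powr r) \<partial>lborel) = ennreal B"
      using nn_integral_lborel_translate[of "\<lambda>h. ennreal (k h powr r)" z] B by simp
    finally show "(\<integral>\<^sup>+x. ennreal (k (x - z) powr r * f z powr p) \<partial>lborel)
        = ennreal B * ennreal (f z powr p)" .
  qed
  also have "\<dots> = ennreal B * ennreal P" by (simp add: nn_integral_cmult P)
  finally have J: "(\<integral>\<^sup>+x. J x \<partial>lborel) = ennreal B * ennreal P" .
  then have "AE x in lborel. J x \<noteq> \<infinity>"
    by (intro nn_integral_PInf_AE) (auto simp: ennreal_mult_eq_top_iff)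
  moreover have pt: "integrable lborel (\<lambda>z. k (x - z) * f z) \<and>
      ennreal ((LINT z|lborel. k (x - z) * f z) powr q)
        \<le> J x * ennreal ((B powr (1 - 1 / p) * P powr (1 / p - 1 / q)) powr q)"
    if "J x \<noteq> \<infinity>" for x
  proof -
    have a: "integrable lborel (\<lambda>z. k (x - z) powr r * f z powr p)"
      using that by (intro integrableI_bounded) (auto simp: J_def less_top)
    have "(\<integral>\<^sup>+z. ennreal (k (x - z) powr r) \<partial>lborel) = ennreal B"
      using nn_integral_lborel_reflect[of "\<lambda>h. ennreal (k h powr r)" x] B by simp
    then have b: "integrable lborel (\<lambda>z. k (x - z) powr r)"
        and bB: "(LINT z|lborel. k (x - z) powr r) = B"
      using B0 by (auto intro!: integrableI_nonneg integral_eq_nn_integral simp: integral_eq_nn_integral)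
    have w: "1 / q \<ge> 0" "1 - 1 / p \<ge> 0" "1 / p - 1 / q \<ge> 0" "1 / q + (1 - 1 / p) + (1 / p - 1 / q) = 1"
      using pq by (auto simp: field_simps)
    have eq: "(k (x - z) powr r * f z powr p) powr (1 / q) * (k (x - z) powr r) powr (1 - 1 / p)
        * (f z powr p) powr (1 / p - 1 / q) = k (x - z) * f z" for z
    proof (cases "k (x - z) = 0 \<or> f z = 0")
      case False
      then have pos: "k (x - z) > 0" "f z > 0" using k[of "x - z"] f[of z] by auto
      have e: "r * (1 / q) + r * (1 - 1 / p) = 1" "p * (1 / q) + p * (1 / p - 1 / q) = 1"
        using r pq by (auto simp: field_simps)
      have "(k (x - z) powr r * f z powr p) powr (1 / q) * (k (x - z) powr r) powr (1 - 1 / p)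
        * (f z powr p) powr (1 / p - 1 / q) =
        (k (x - z) powr (r * (1 / q)) * k (x - z) powr (r * (1 - 1 / p))) *
        (f z powr (p * (1 / q)) * f z powr (p * (1 / p - 1 / q)))"
        using pos by (simp add: powr_mult powr_powr)
      also have "\<dots> = k (x - z) * f z"
        unfolding powr_add[symmetric] e using pos by simp
      finally show ?thesis .
    qed auto
    have int: "integrable lborel (\<lambda>z. k (x - z) * f z)"
      using Holder_inequality3(1)[OF a b fp _ _ _ w] by (simp add: eq)
    define I where "I = (LINT z|lborel. k (x - z) * f z)"
    have I: "I \<le> (LINT z|lborel. k (x - z) powr r * f z powr p) powr (1 / q)
         * B powr (1 - 1 / p) * P powr (1 / p - 1 / q)"
      using Holder_inequality3(2)[OF a b fp _ _ _ w] by (simp add: eq I_def bB P_def)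
    have I0: "I \<ge> 0" using k f by (simp add: I_def)
    have "I powr q \<le> ((LINT z|lborel. k (x - z) powr r * f z powr p) powr (1 / q)
         * B powr (1 - 1 / p) * P powr (1 / p - 1 / q)) powr q"
      using I I0 pq by (intro powr_mono2) auto
    also have "\<dots> = (LINT z|lborel. k (x - z) powr r * f z powr p) *
         (B powr (1 - 1 / p) * P powr (1 / p - 1 / q)) powr q"
      using pq by (simp add: powr_mult powr_powr)
    finally have "ennreal (I powr q) \<le> ennreal (LINT z|lborel. k (x - z) powr r * f z powr p) *
         ennreal ((B powr (1 - 1 / p) * P powr (1 / p - 1 / q)) powr q)"
      by (simp flip: ennreal_mult)
    also have "ennreal (LINT z|lborel. k (x - z) powr r * f z powr p) = J x"
      unfolding J_def by (rule nn_integral_eq_integral[OF a, symmetric]) auto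
    finally show ?thesis using int unfolding I_def by blast
  qed
  ultimately show "AE x in lborel. integrable lborel (\<lambda>z. k (x - z) * f z)" by auto
  have "(\<integral>\<^sup>+x. ennreal ((LINT z|lborel. k (x - z) * f z) powr q) \<partial>lborel)
      \<le> (\<integral>\<^sup>+x. J x * ennreal ((B powr (1 - 1 / p) * P powr (1 / p - 1 / q)) powr q) \<partial>lborel)"
    using \<open>AE x in lborel. J x \<noteq> \<infinity>\<close> pt by (intro nn_integral_mono_AE) auto
  also have "\<dots> = ennreal B * ennreal P * ennreal ((B powr (1 - 1 / p) * P powr (1 / p - 1 / q)) powr q)"
    by (simp add: nn_integral_multc J)
  finally show "(\<integral>\<^sup>+x. ennreal ((LINT z|lborel. k (x - z) * f z) powr q) \<partial>lborel)
      \<le> ennreal (B * P * (B powr (1 - 1 / p) * P powr (1 / p - 1 / q)) powr q)"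
    using B0 by (simp add: ennreal_mult)
qed

text \<open>Dyadic shells take the place of polar coordinates. On \<delta>/2^(j+1) \<le> |h| <
  \<delta>/2^j the power is at most its value at the inner radius, and the shell lies in the ball of
  the outer radius. The resulting series is geometric with ratio 2^(a - n), which is below 1 because
  a < n. The origin contributes nothing, as \<open>0 powr (- a) = 0\<close>.\<close>

lemma nn_integral_norm_powr_ball:
  fixes a \<delta> :: real
  assumes a: "0 \<le> a" "a < DIM('a::euclidean_space)" and "\<delta> > 0"
  defines "n \<equiv> real DIM('a)"
  shows "(\<integral>\<^sup>+h. ennreal (norm h powr (- a)) * indicator (ball 0 \<delta>) h \<partial>(lborel :: 'a measure))
    \<le> ennreal (unit_ball_vol n * 2 powr a / (1 - 2 powr (a - n)) * \<delta> powr (n - a))"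
proof -
  define c where "c = 2 powr (a - n)"
  have c: "0 < c" "c < 1" using a by (auto simp: c_def n_def powr_less_one)
  define g :: "nat \<Rightarrow> 'a \<Rightarrow> ennreal"
    where "g = (\<lambda>j h. ennreal ((\<delta> / 2 ^ Suc j) powr (- a)) * indicator (ball 0 (\<delta> / 2 ^ j)) h)"
  have [measurable]: "g j \<in> borel_measurable lborel" for j
    unfolding g_def
    by (intro borel_measurable_times_ennreal borel_measurable_const borel_measurable_indicator) simp
  have le: "ennreal (norm h powr (- a)) * indicator (ball 0 \<delta>) h \<le> (\<Sum>j. g j h)" for h :: 'a
  proof (cases "h \<noteq> 0 \<and> norm h < \<delta>")
    case True
    have "(\<lambda>j. \<delta> / 2 ^ j) \<longlonglongrightarrow> 0" by (rule LIMSEQ_divide_realpow_zero) simp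
    then have "eventually (\<lambda>j. \<delta> / 2 ^ j < norm h) sequentially"
      using True by (intro order_tendstoD) auto
    then have ex: "\<exists>j. \<delta> / 2 ^ j \<le> norm h" unfolding eventually_sequentially by (meson less_imp_le order_refl)
    \<comment> \<open>The least index whose radius is at most |h|. It is positive because |h| <
      \<delta>, and its predecessor is the index of the shell containing \<open>h\<close>.\<close>
    define m where "m = (LEAST j. \<delta> / 2 ^ j \<le> norm h)"
    have m: "\<delta> / 2 ^ m \<le> norm h" unfolding m_def by (rule LeastI_ex[OF ex])
    then have "m \<noteq> 0" using True by (intro notI) auto
    then obtain j where j: "m = Suc j" by (cases m) auto
    have "\<not> \<delta> / 2 ^ j \<le> norm h" using j not_less_Least[of j "\<lambda>j. \<delta> / 2 ^ j \<le> norm h"] unfolding m_def by auto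
    then have "h \<in> ball 0 (\<delta> / 2 ^ j)" by auto
    moreover have "norm h powr (- a) \<le> (\<delta> / 2 ^ Suc j) powr (- a)"
      using m j a \<open>\<delta> > 0\<close> by (intro powr_mono2') auto
    ultimately have "ennreal (norm h powr (- a)) * indicator (ball 0 \<delta>) h \<le> g j h"
      using True by (auto simp: g_def intro!: ennreal_leI)
    also have "\<dots> \<le> (\<Sum>j. g j h)"
      using sum_le_suminf[of "\<lambda>j. g j h" "{j}"] by (simp add: summableI)
    finally show ?thesis .
  qed (use a in auto)
  have g: "(\<integral>\<^sup>+h. g j h \<partial>lborel) = ennreal (unit_ball_vol n * 2 powr a * \<delta> powr (n - a) * c ^ j)" for j
  proof -
    have "(\<integral>\<^sup>+h. g j h \<partial>lborel) = ennreal ((\<delta> / 2 ^ Suc j) powr (- a)) *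
         ennreal (unit_ball_vol n * (\<delta> / 2 ^ j) ^ DIM('a))"
      using \<open>\<delta> > 0\<close> unfolding g_def n_def
      by (simp add: nn_integral_cmult_indicator emeasure_ball)
    also have "\<dots> = ennreal ((\<delta> / 2 ^ Suc j) powr (- a) * (unit_ball_vol n * (\<delta> / 2 ^ j) ^ DIM('a)))"
      using \<open>\<delta> > 0\<close> by (intro ennreal_mult[symmetric]) (auto simp: n_def)
    also have "(\<delta> / 2 ^ Suc j) powr (- a) * (unit_ball_vol n * (\<delta> / 2 ^ j) ^ DIM('a))
        = unit_ball_vol n * 2 powr a * \<delta> powr (n - a) * c ^ j"
    proof -
      have 1: "(\<delta> / 2 ^ j) ^ DIM('a) = \<delta> powr n * 2 powr (- n * j)"
      proof -
        have "(\<delta> / 2 ^ j) ^ DIM('a) = (\<delta> / 2 ^ j) powr n"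
          using \<open>\<delta> > 0\<close> by (simp add: n_def powr_realpow)
        also have "\<dots> = (\<delta> * 2 powr (- real j)) powr n"
          by (simp add: powr_minus powr_realpow divide_simps)
        also have "\<dots> = \<delta> powr n * 2 powr (- n * j)"
          using \<open>\<delta> > 0\<close> by (simp add: powr_mult powr_powr mult.commute)
        finally show ?thesis .
      qed
      have 2: "(\<delta> / 2 ^ Suc j) powr (- a) = \<delta> powr (- a) * 2 powr (a * (j + 1))"
      proof -
        have "\<delta> / 2 ^ Suc j = \<delta> * 2 powr (- real (Suc j))"
          by (simp only: powr_minus powr_realpow divide_inverse)
        then have "(\<delta> / 2 ^ Suc j) powr (- a) = (\<delta> * 2 powr (- (real j + 1))) powr (- a)"
          by (simp add: add.commute)
        also have "\<dots> = \<delta> powr (- a) * 2 powr (a * (j + 1))"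
          using \<open>\<delta> > 0\<close> by (simp add: powr_mult powr_powr algebra_simps)
        finally show ?thesis .
      qed
      have 3: "c ^ j = 2 powr ((a - n) * j)" by (simp add: c_def powr_power mult.commute)
      show ?thesis
      proof -
        have e: "2 powr (a * (j + 1)) * 2 powr (- n * j) = 2 powr a * 2 powr ((a - n) * j)"
          unfolding powr_add[symmetric] by (simp add: algebra_simps)
        have "\<delta> powr (- a) * 2 powr (a * (j + 1)) * (unit_ball_vol n * (\<delta> powr n * 2 powr (- n * j)))
            = unit_ball_vol n * (\<delta> powr n * \<delta> powr (- a)) * (2 powr (a * (j + 1)) * 2 powr (- n * j))"
          by (simp only: ac_simps)
        also have "\<delta> powr n * \<delta> powr (- a) = \<delta> powr (n - a)"
          by (simp flip: powr_add)
        finally show ?thesis unfolding 1 2 3 e by (simp only: mult.assoc mult.commute mult.left_commute)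
      qed
    qed
    finally show ?thesis .
  qed
  have "(\<integral>\<^sup>+h. ennreal (norm h powr (- a)) * indicator (ball 0 \<delta>) h \<partial>(lborel :: 'a measure))
      \<le> (\<integral>\<^sup>+h. (\<Sum>j. g j h) \<partial>lborel)"
    by (intro nn_integral_mono le)
  also have "\<dots> = (\<Sum>j. \<integral>\<^sup>+h. g j h \<partial>lborel)"
    by (rule nn_integral_suminf) measurable
  also have "\<dots> = (\<Sum>j. ennreal (unit_ball_vol n * 2 powr a * \<delta> powr (n - a) * c ^ j))"
    by (simp only: g)
  also have "\<dots> = ennreal (\<Sum>j. unit_ball_vol n * 2 powr a * \<delta> powr (n - a) * c ^ j)"
    using c by (intro suminf_ennreal2 summable_mult summable_geometric) (auto simp: n_def)
  also have "(\<Sum>j. unit_ball_vol n * 2 powr a * \<delta> powr (n - a) * c ^ j)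
      = unit_ball_vol n * 2 powr a / (1 - c) * \<delta> powr (n - a)"
    using c by (subst suminf_mult) (auto simp: suminf_geometric summable_geometric)
  finally show ?thesis unfolding c_def .
qed

subsection \<open>Weakly singular integral operators\<close>

text \<open>Coefficients of forms are merely Lebesgue measurable on \<open>D\<close>, whereas
  convolution estimates over \<open>lborel\<close> work with Borel functions. Vanishing off
  \<open>D\<close> lets integrals over \<open>D\<close> be read as integrals over the whole
  space.\<close>

lemma lebesgue_on_borel_representative:
  fixes f :: "'a::euclidean_space \<Rightarrow> real"
  assumes f: "f \<in> borel_measurable (lebesgue_on D)" and D: "D \<in> sets borel"
  obtains g where "g \<in> borel_measurable borel" "\<And>x. x \<notin> D \<Longrightarrow> g x = 0"
    "AE x in lebesgue_on D. f x = g x"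
proof -
  have "(\<lambda>x. indicator D x *\<^sub>R f x) \<in> borel_measurable lebesgue"
    using f D by (subst (asm) borel_measurable_restrict_space_iff) auto
  then obtain g where g: "g \<in> borel_measurable lborel" "AE x in lborel. indicator D x *\<^sub>R f x = g x"
    using completion_ex_borel_measurable_real by blast
  have [measurable]: "D \<in> sets borel" "g \<in> borel_measurable borel" using D g(1) by auto
  show thesis
  proof
    show "(\<lambda>x. indicator D x * g x) \<in> borel_measurable borel" by measurable
    have "AE x in lebesgue. indicator D x *\<^sub>R f x = g x" using g(2) by (rule AE_completion)
    then show "AE x in lebesgue_on D. f x = indicator D x * g x"
      using D by (subst AE_restrict_space_iff) (auto elim!: eventually_mono)
  qed auto
qed

lemma AE_lborel_imp_AE_lebesgue_on:
  assumes "AE x in lborel. P x" "D \<in> sets borel"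
  shows "AE x in lebesgue_on D. P x"
  using AE_completion[OF assms(1)] assms(2)
  by (subst AE_restrict_space_iff) (auto elim!: eventually_mono)

lemma lebesgue_on_eq_lborel:
  fixes h :: "'a::euclidean_space \<Rightarrow> real"
  assumes "h \<in> borel_measurable borel" "D \<in> sets borel" "\<And>x. x \<notin> D \<Longrightarrow> h x = 0"
  shows "integrable (lebesgue_on D) h \<longleftrightarrow> integrable lborel h"
    and "(LINT x|lebesgue_on D. h x) = (LINT x|lborel. h x)"
proof -
  have h: "(\<lambda>x. indicator D x * h x) = h" using assms(3) by (auto simp: fun_eq_iff indicator_def)
  show "integrable (lebesgue_on D) h \<longleftrightarrow> integrable lborel h"
    using assms by (subst integrable_restrict_space) (auto simp: h integrable_completion)
  show "(LINT x|lebesgue_on D. h x) = (LINT x|lborel. h x)"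
    using assms by (subst integral_restrict_space) (auto simp: h integral_completion)
qed

text \<open>On a set of finite measure this yields the inclusion of L^b in L^a for a \<le> b; the 1
  integrates to the measure of the set.\<close>

lemma powr_le_one_plus_powr:
  fixes t :: real
  assumes "t \<ge> 0" "0 \<le> a" "a \<le> b"
  shows "t powr a \<le> 1 + t powr b"
proof (cases "t \<le> 1")
  case True
  then have "t powr a \<le> 1" using assms by (simp add: powr_le1)
  then show ?thesis by (smt (verit) powr_ge_zero)
next
  case False
  then have "t powr a \<le> t powr b" using assms by (intro powr_mono) auto
  then show ?thesis by simp
qed

lemma powr_add_le:
  fixes s t q :: real
  assumes "s \<ge> 0" "t \<ge> 0" "q \<ge> 0"
  shows "(s + t) powr q \<le> 2 powr q * (s powr q + t powr q)"
proof -
  have "(s + t) powr q \<le> (2 * max s t) powr q" using assms by (intro powr_mono2) auto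
  also have "\<dots> = 2 powr q * max s t powr q" using assms by (simp add: powr_mult)
  also have "\<dots> \<le> 2 powr q * (s powr q + t powr q)" by (intro mult_left_mono) (auto simp: max_def)
  finally show ?thesis .
qed

text \<open>Continuity is demanded up to the boundary, because compactness of the closure has to
  give uniform continuity away from the diagonal. For the size of the kernel the open set is
  enough.\<close>

locale weakly_singular_kernel =
  fixes K :: "'a::euclidean_space \<Rightarrow> 'a \<Rightarrow> real" and D :: "'a set" and C :: real
  assumes open_D: "open D" and bounded_D: "bounded D" and C_nonneg: "C \<ge> 0"
    and continuous_K: "continuous_on {(z, x). z \<in> closure D \<and> x \<in> closure D \<and> z \<noteq> x} (\<lambda>(z, x). K z x)"
    and K_bound: "\<And>z x. z \<in> D \<Longrightarrow> x \<in> D \<Longrightarrow> z \<noteq> x \<Longrightarrow>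
      \<bar>K z x\<bar> \<le> C * norm (x - z) powr (1 - real DIM('a))"
begin

definition T :: "('a \<Rightarrow> real) \<Rightarrow> 'a \<Rightarrow> real" where
  "T f x = (LINT z|lebesgue_on D. K z x * f z)"

text \<open>Extension by 0 to all pairs, the diagonal included, makes the kernel jointly Borel; for
  fixed \<open>x\<close> the diagonal is a single point, hence null.\<close>

definition KD :: "'a \<Rightarrow> 'a \<Rightarrow> real" where
  "KD z x = (if z \<in> D \<and> x \<in> D \<and> z \<noteq> x then K z x else 0)"

text \<open>A majorant depending on the difference of the variables only, so that Young's inequality
  applies to it.\<close>

definition sing :: "real \<Rightarrow> 'a \<Rightarrow> real" where
  "sing \<delta> h = (if norm h < \<delta> then C * norm h powr (1 - real DIM('a)) else 0)"

text \<open>Vanishes for |x - z| \<le> \<delta>/2, equals 1 for |x - z| \<ge> \<delta>, and is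
  linear in |x - z| in between. A continuous cutoff, unlike an indicator, keeps the remaining kernel
  continuous.\<close>

definition cutoff :: "real \<Rightarrow> 'a \<Rightarrow> 'a \<Rightarrow> real" where
  "cutoff \<delta> z x = max 0 (min 1 (2 * norm (x - z) / \<delta> - 1))"

section \<open>Measurability and the convolution majorant\<close>

lemma D_borel [measurable]: "D \<in> sets borel"
  using open_D by simp

lemma finite_measure_D: "finite_measure (lebesgue_on D)"
proof
  have "emeasure lebesgue D < \<infinity>"
    using bounded_D emeasure_bounded_finite[OF bounded_D] by simp
  then show "emeasure (lebesgue_on D) (space (lebesgue_on D)) \<noteq> \<infinity>"
    by (simp add: emeasure_restrict_space)
qed

lemma KD_measurable [measurable (raw)]:
  assumes [measurable]: "f \<in> borel_measurable M" "g \<in> borel_measurable M"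
  shows "(\<lambda>w. KD (f w) (g w)) \<in> borel_measurable M"
proof -
  let ?U = "{(z, x). z \<in> D \<and> x \<in> D \<and> z \<noteq> x}"
  have "?U = (D \<times> D) \<inter> {p. fst p \<noteq> snd p}" by auto
  moreover have "open ((D \<times> D) \<inter> {p. fst p \<noteq> snd p})"
    using open_D by (intro open_Int open_Times open_Collect_neq continuous_intros)
  ultimately have "open ?U" by simp
  moreover have "continuous_on ?U (\<lambda>(z, x). K z x)"
    using closure_subset by (intro continuous_on_subset[OF continuous_K]) auto
  ultimately have "(\<lambda>p. indicator ?U p *\<^sub>R (case p of (z, x) \<Rightarrow> K z x)) \<in> borel_measurable borel"
    by (intro borel_measurable_continuous_on_indicator) auto
  from measurable_compose[OF borel_measurable_Pair[OF assms] this]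
  have "(\<lambda>w. indicator ?U (f w, g w) *\<^sub>R K (f w) (g w)) \<in> borel_measurable M"
    by (simp only: prod.case)
  also have "(\<lambda>w. indicator ?U (f w, g w) *\<^sub>R K (f w) (g w)) = (\<lambda>w. KD (f w) (g w))"
    by (auto simp: KD_def indicator_def fun_eq_iff)
  finally show ?thesis .
qed

lemma sing_measurable [measurable]: "sing \<delta> \<in> borel_measurable borel"
  unfolding sing_def by measurable

lemma cutoff_measurable [measurable (raw)]:
  assumes [measurable]: "f \<in> borel_measurable M" "g \<in> borel_measurable M"
  shows "(\<lambda>w. cutoff \<delta> (f w) (g w)) \<in> borel_measurable M"
  unfolding cutoff_def by measurable

lemma sing_nonneg: "sing \<delta> h \<ge> 0"
  using C_nonneg by (simp add: sing_def)

text \<open>The strict inequality in \<open>sing\<close> forces a radius larger than the diameter.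
  With it the truncation never takes effect on D x D, and the whole operator is covered by the
  estimate made for its part near the diagonal.\<close>

lemma KD_le_sing: "\<bar>KD z x\<bar> \<le> sing (diameter D + 1) (x - z)"
proof -
  have "norm (x - z) < diameter D + 1" if "x \<in> D" "z \<in> D"
    using diameter_bounded_bound[OF bounded_D that] by (simp add: dist_norm)
  then show ?thesis using K_bound[of z x] C_nonneg by (auto simp: KD_def sing_def)
qed

lemma KD_diff_cutoff_le_sing:
  assumes "\<delta> > 0"
  shows "\<bar>KD z x - KD z x * cutoff \<delta> z x\<bar> \<le> sing \<delta> (x - z)"
proof (cases "norm (x - z) < \<delta>")
  case True
  have "\<bar>KD z x - KD z x * cutoff \<delta> z x\<bar> = \<bar>KD z x\<bar> * \<bar>1 - cutoff \<delta> z x\<bar>"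
    by (simp add: abs_mult[symmetric] algebra_simps)
  also have "\<dots> \<le> \<bar>KD z x\<bar> * 1"
    by (intro mult_left_mono) (auto simp: cutoff_def)
  also have "\<dots> \<le> sing \<delta> (x - z)"
    using True K_bound[of z x] C_nonneg by (auto simp: KD_def sing_def)
  finally show ?thesis .
next
  case False
  then have "cutoff \<delta> z x = 1" using assms by (auto simp: cutoff_def field_simps)
  then show ?thesis by (simp add: sing_nonneg)
qed

text \<open>The r-th power has a singularity of order a = (n - 1) r < n, and scaling gives the
  positive exponent s = n - a. The decay as \<delta> tends to 0 is what later makes the part near
  the diagonal small.\<close>

lemma sing_powr_integral:
  assumes r: "r > 0" "(real DIM('a) - 1) * r < DIM('a)"
  shows "\<exists>c s. c \<ge> 0 \<and> s > 0 \<and> (\<forall>\<delta>>0. integrable lborel (\<lambda>h. sing \<delta> h powr r) \<and>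
    (LINT h|lborel. sing \<delta> h powr r) \<le> c * \<delta> powr s)"
proof -
  define n where "n = real DIM('a)"
  define a where "a = (n - 1) * r"
  have "n \<ge> 1" by (simp add: n_def Suc_leI)
  then have a: "0 \<le> a" "a < n" using r by (auto simp: a_def n_def)
  define c where "c = C powr r * (unit_ball_vol n * 2 powr a / (1 - 2 powr (a - n)))"
  have "2 powr (a - n) < 1" using a by (simp add: powr_less_one)
  then have c0: "c \<ge> 0" by (auto simp: c_def n_def)
  have "integrable lborel (\<lambda>h. sing \<delta> h powr r) \<and>
    (LINT h|lborel. sing \<delta> h powr r) \<le> c * \<delta> powr (n - a)" if "\<delta> > 0" for \<delta>
  proof -
    have eq: "ennreal (sing \<delta> h powr r)
        = ennreal (C powr r) * (ennreal (norm h powr (- a)) * indicator (ball 0 \<delta>) h)" for h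
      using C_nonneg
      by (auto simp: sing_def a_def n_def powr_mult powr_powr algebra_simps ennreal_mult indicator_def)
    have "(\<integral>\<^sup>+h. ennreal (sing \<delta> h powr r) \<partial>lborel)
        = ennreal (C powr r) * (\<integral>\<^sup>+h. ennreal (norm h powr (- a)) * indicator (ball 0 \<delta>) h \<partial>(lborel :: 'a measure))"
      unfolding eq
      by (intro nn_integral_cmult borel_measurable_times_ennreal borel_measurable_indicator) auto
    also have "\<dots> \<le> ennreal (C powr r) * ennreal (unit_ball_vol n * 2 powr a / (1 - 2 powr (a - n)) * \<delta> powr (n - a))"
      using nn_integral_norm_powr_ball[of a \<delta>, where 'a = 'a] a that by (intro mult_left_mono) (auto simp: n_def)
    also have "\<dots> = ennreal (c * \<delta> powr (n - a))"
      by (simp add: c_def mult.assoc flip: ennreal_mult')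
    finally have le: "(\<integral>\<^sup>+h. ennreal (sing \<delta> h powr r) \<partial>lborel) \<le> ennreal (c * \<delta> powr (n - a))" .
    then have int: "integrable lborel (\<lambda>h. sing \<delta> h powr r)"
      by (intro integrableI_bounded) (auto intro: le_less_trans)
    have "ennreal (LINT h|lborel. sing \<delta> h powr r) \<le> ennreal (c * \<delta> powr (n - a))"
      using le by (subst (asm) nn_integral_eq_integral[OF int]) auto
    then show ?thesis using int c0 by (simp add: ennreal_le_iff)
  qed
  then show ?thesis using a c0 by (intro exI[of _ c] exI[of _ "n - a"]) auto
qed

definition sing_conv :: "real \<Rightarrow> ('a \<Rightarrow> real) \<Rightarrow> 'a \<Rightarrow> real" where
  "sing_conv \<delta> g x = (LINT z|lborel. sing \<delta> (x - z) * \<bar>g z\<bar>)"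

text \<open>The bound \<open>b\<close> depends on \<open>R\<close> and \<delta> alone: one
  truncation radius must serve every function of a bounded set. It is chosen explicitly, as the
  constant of Young's inequality with both integrals replaced by upper bounds.\<close>

lemma sing_conv_bound:
  assumes pq: "1 \<le> p" "1 \<le> q" "1 / p - 1 / q < 1 / DIM('a)"
  shows "\<exists>b. (\<forall>R\<ge>0. \<forall>\<epsilon>>0. \<exists>\<delta>>0. b R \<delta> \<le> \<epsilon>) \<and>
    (\<forall>\<delta>>0. \<forall>R. \<forall>g\<in>borel_measurable borel.
      (\<forall>x. x \<notin> D \<longrightarrow> g x = 0) \<longrightarrow> integrable lborel (\<lambda>z. \<bar>g z\<bar> powr p) \<longrightarrow>
      (LINT z|lborel. \<bar>g z\<bar> powr p) \<le> R \<longrightarrow>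
        (AE x in lborel. integrable lborel (\<lambda>z. sing \<delta> (x - z) * \<bar>g z\<bar>)) \<and>
        (\<integral>\<^sup>+x. ennreal (sing_conv \<delta> g x powr q) \<partial>lborel) \<le> ennreal (b R \<delta>))"
proof -
  \<comment> \<open>Young's inequality requires p0 \<le> q. For p > q the exponent becomes q, and
    then 1/p0 - 1/q = 0 still satisfies the strict condition.\<close>
  define p0 where "p0 = min p q"
  have p0: "1 \<le> p0" "p0 \<le> q" "p0 \<le> p" "1 / p0 - 1 / q < 1 / DIM('a)"
    using pq by (auto simp: p0_def min_def)
  define r where "r = 1 / (1 - (1 / p0 - 1 / q))"
  have n1: "real DIM('a) \<ge> 1" by (simp add: Suc_leI)
  have "1 / p0 - 1 / q < 1 / real DIM('a)" using p0 by simp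
  also have "\<dots> \<le> 1" using n1 by simp
  finally have pos: "1 - (1 / p0 - 1 / q) > 0" by simp
  then have r: "r > 0" "1 / r = 1 - (1 / p0 - 1 / q)" by (auto simp: r_def)
  \<comment> \<open>This is 1 - 1/n < 1/r, the condition under which the r-th power of the
    singularity is integrable.\<close>
  have "(real DIM('a) - 1) / DIM('a) < 1 - (1 / p0 - 1 / q)"
    using p0 n1 by (simp add: diff_divide_distrib)
  then have "(real DIM('a) - 1) * r < DIM('a)"
    using pos n1 unfolding r_def by (simp add: divide_simps mult.commute)
  from sing_powr_integral[OF r(1) this] obtain c s where cs: "c \<ge> 0" "s > 0"
    and int: "\<And>\<delta>. \<delta> > 0 \<Longrightarrow> integrable lborel (\<lambda>h. sing \<delta> h powr r)"
    and le: "\<And>\<delta>. \<delta> > 0 \<Longrightarrow> (LINT h|lborel. sing \<delta> h powr r) \<le> c * \<delta> powr s"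
    by blast
  define \<beta> \<gamma> where "\<beta> = 1 - 1 / p0" and "\<gamma> = 1 / p0 - 1 / q"
  have \<beta>\<gamma>: "\<beta> \<ge> 0" "\<gamma> \<ge> 0" using p0 by (auto simp: \<beta>_def \<gamma>_def field_simps)
  define b where "b = (\<lambda>R \<delta>. c * \<delta> powr s * (measure lborel D + R) *
              ((c * \<delta> powr s) powr \<beta> * (measure lborel D + R) powr \<gamma>) powr q)"
  have b: "\<exists>\<delta>>0. b R \<delta> \<le> \<epsilon>" if R: "R \<ge> 0" and \<epsilon>: "\<epsilon> > 0" for R \<epsilon>
  proof -
    define m where "m = (measure lborel D + R) * ((measure lborel D + R) powr \<gamma>) powr q"
    have m: "m \<ge> 0" using R by (simp add: m_def)
    \<comment> \<open>t \<le> 1 makes the factor with exponent \<beta> harmless, also when \<beta> =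
      0, so that all smallness comes from the first factor. The denominators \<open>m + 1\<close>
      and \<open>c + 1\<close> spare the cases m = 0 and c = 0.\<close>
    define t where "t = min 1 (\<epsilon> / (m + 1))"
    have t: "t > 0" "t \<le> 1" "t \<le> \<epsilon> / (m + 1)" using m \<epsilon> by (auto simp: t_def)
    define \<delta> where "\<delta> = (t / (c + 1)) powr (1 / s)"
    have \<delta>: "\<delta> > 0" using t cs by (auto simp: \<delta>_def)
    have "\<delta> powr s = t / (c + 1)" using t cs by (simp add: \<delta>_def powr_powr)
    moreover have "c * (t / (c + 1)) \<le> t" using t(1) cs by (simp add: field_simps)
    ultimately have c\<delta>: "c * \<delta> powr s \<le> t" "c * \<delta> powr s \<ge> 0"
      using cs t(1) by auto
    have "(c * \<delta> powr s) powr \<beta> \<le> 1"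
      using c\<delta> t \<beta>\<gamma> by (intro powr_le1) auto
    then have "((c * \<delta> powr s) powr \<beta> * (measure lborel D + R) powr \<gamma>) powr q
        \<le> ((measure lborel D + R) powr \<gamma>) powr q"
      using pq by (intro powr_mono2) (auto simp: mult_left_le_one_le)
    then have "b R \<delta> \<le> t * (measure lborel D + R) * ((measure lborel D + R) powr \<gamma>) powr q"
      unfolding b_def using c\<delta> t R by (intro mult_mono) auto
    also have "\<dots> = t * m" by (simp add: m_def)
    also have "\<dots> \<le> \<epsilon> / (m + 1) * m" using t m by (intro mult_right_mono) auto
    also have "\<dots> \<le> \<epsilon>" using m \<epsilon> by (simp add: divide_simps)
    finally show ?thesis using \<delta> by blast
  qed
  have "(AE x in lborel. integrable lborel (\<lambda>z. sing \<delta> (x - z) * \<bar>g z\<bar>)) \<and>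
        (\<integral>\<^sup>+x. ennreal (sing_conv \<delta> g x powr q) \<partial>lborel) \<le> ennreal (b R \<delta>)"
    if \<delta>: "\<delta> > 0" and g[measurable]: "g \<in> borel_measurable borel" "\<And>x. x \<notin> D \<Longrightarrow> g x = 0"
      and gp: "integrable lborel (\<lambda>z. \<bar>g z\<bar> powr p)" "(LINT z|lborel. \<bar>g z\<bar> powr p) \<le> R"
    for \<delta> R g
  proof -
    have D: "integrable lborel (\<lambda>x. indicator D x :: real)"
      using emeasure_bounded_finite[OF bounded_D] by (simp add: less_top)
    have pt: "\<bar>g z\<bar> powr p0 \<le> indicator D z + \<bar>g z\<bar> powr p" for z
      using powr_le_one_plus_powr[of "\<bar>g z\<bar>" p0 p] p0 g(2)[of z] by (cases "z \<in> D") auto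
    have g0: "integrable lborel (\<lambda>z. \<bar>g z\<bar> powr p0)"
    proof (rule Bochner_Integration.integrable_bound)
      show "integrable lborel (\<lambda>z. indicator D z + \<bar>g z\<bar> powr p)"
        using D gp(1) by (rule Bochner_Integration.integrable_add)
      show "AE z in lborel. norm (\<bar>g z\<bar> powr p0) \<le> norm (indicator D z + \<bar>g z\<bar> powr p)"
        using pt by (intro AE_I2) (auto intro: order_trans)
    qed measurable
    define P where "P = (LINT z|lborel. \<bar>g z\<bar> powr p0)"
    have P0: "P \<ge> 0" by (simp add: P_def)
    have "P \<le> (LINT z|lborel. indicator D z + \<bar>g z\<bar> powr p)"
      unfolding P_def using D gp pt g0 by (intro integral_mono) auto
    also have "\<dots> \<le> measure lborel D + R" using D gp by simp
    finally have P: "P \<le> measure lborel D + R" .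
    define B where "B = (LINT h|lborel. sing \<delta> h powr r)"
    have B: "0 \<le> B" "B \<le> c * \<delta> powr s" using le \<delta> by (auto simp: B_def)
    note Y = Young_convolution_inequality[of "sing \<delta>" "\<lambda>z. \<bar>g z\<bar>" p0 q r,
        OF _ _ sing_nonneg _ p0(1,2) r int[OF \<delta>] g0]
    have "ennreal (B * P * (B powr \<beta> * P powr \<gamma>) powr q)
        \<le> ennreal (c * \<delta> powr s * (measure lborel D + R) *
              ((c * \<delta> powr s) powr \<beta> * (measure lborel D + R) powr \<gamma>) powr q)"
      using B P P0 \<beta>\<gamma> pq by (intro ennreal_leI mult_mono powr_mono2) auto
    then show ?thesis
      using Y by (auto simp: b_def B_def P_def \<beta>_def \<gamma>_def sing_conv_def intro: order_trans)
  qed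
  then show ?thesis using b by blast
qed

end

lemma lebesgue_on_representative_integral:
  fixes f g h :: "'a::euclidean_space \<Rightarrow> real"
  assumes f: "f \<in> borel_measurable (lebesgue_on D)" and D: "D \<in> sets borel"
    and [measurable]: "g \<in> borel_measurable borel" "h \<in> borel_measurable borel"
    and g0: "\<And>x. x \<notin> D \<Longrightarrow> g x = 0" and fg: "AE x in lebesgue_on D. f x = g x"
  shows "integrable (lebesgue_on D) (\<lambda>z. h z * f z) \<longleftrightarrow> integrable lborel (\<lambda>z. h z * g z)"
    and "(LINT z|lebesgue_on D. h z * f z) = (LINT z|lborel. h z * g z)"
proof -
  have [measurable]: "h \<in> borel_measurable (lebesgue_on D)" "g \<in> borel_measurable (lebesgue_on D)"
    by (auto intro!: measurable_restrict_space1 measurable_completion)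
  note f [measurable]
  have ae: "AE z in lebesgue_on D. h z * f z = h z * g z" using fg by eventually_elim simp
  have "integrable (lebesgue_on D) (\<lambda>z. h z * f z) \<longleftrightarrow> integrable (lebesgue_on D) (\<lambda>z. h z * g z)"
    using ae by (intro integrable_cong_AE) measurable
  also have "\<dots> \<longleftrightarrow> integrable lborel (\<lambda>z. h z * g z)"
    using D g0 by (intro lebesgue_on_eq_lborel) auto
  finally show "integrable (lebesgue_on D) (\<lambda>z. h z * f z) \<longleftrightarrow> integrable lborel (\<lambda>z. h z * g z)" .
  have "(LINT z|lebesgue_on D. h z * f z) = (LINT z|lebesgue_on D. h z * g z)"
    using ae by (intro integral_cong_AE) measurable
  also have "\<dots> = (LINT z|lborel. h z * g z)"
    using D g0 by (intro lebesgue_on_eq_lborel) auto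
  finally show "(LINT z|lebesgue_on D. h z * f z) = (LINT z|lborel. h z * g z)" .
qed

text \<open>The centres of a net of the compact closure may lie on the boundary. Each is moved by
  less than \<eta>/2 into \<open>D\<close>, where the kernel estimates hold, and the other half of
  \<eta> pays for the move.\<close>

lemma bounded_finite_subnet:
  fixes D :: "'a::euclidean_space set"
  assumes "bounded D" "\<eta> > 0"
  obtains X where "finite X" "X \<subseteq> D" "\<And>x. x \<in> D \<Longrightarrow> \<exists>y\<in>X. dist x y < \<eta>"
proof -
  have "seq_compact (closure D)" using assms(1) by (simp add: compact_imp_seq_compact)
  then obtain Y where Y: "finite Y" "Y \<subseteq> closure D" "closure D \<subseteq> (\<Union>y\<in>Y. ball y (\<eta> / 2))"
    using seq_compact_imp_totally_bounded[of "closure D"] assms(2) by (meson half_gt_zero)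
  have "\<exists>x\<in>D. dist x y < \<eta> / 2" if "y \<in> Y" for y
    using Y(2) that assms(2) closure_approachable[of y D] by (meson half_gt_zero subsetD)
  then obtain c where c: "\<And>y. y \<in> Y \<Longrightarrow> c y \<in> D" "\<And>y. y \<in> Y \<Longrightarrow> dist (c y) y < \<eta> / 2"
    by metis
  show thesis
  proof
    show "\<exists>y\<in>c ` Y. dist x y < \<eta>" if x: "x \<in> D" for x
    proof -
      obtain y where y: "y \<in> Y" "x \<in> ball y (\<eta> / 2)"
        using Y(3) x closure_subset[of D] by blast
      have "dist x (c y) < \<eta>" using y(2) c(2)[OF y(1)]
          dist_triangle_half_l[of x y \<eta> "c y"] by (simp add: dist_commute)
      then show ?thesis using y(1) by auto
    qed
  qed (use Y c in auto)
qed

section \<open>The integral operator on scalar functions\<close>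

context weakly_singular_kernel
begin

text \<open>One Borel function \<open>g\<close> replaces \<open>f\<close> everywhere at once: in the
  norm, in the operator, in the convergence of its integral, and in every functional given by a
  Borel kernel.\<close>

lemma T_borel_representative:
  assumes f: "f \<in> borel_measurable (lebesgue_on D)" and fp: "integrable (lebesgue_on D) (\<lambda>z. \<bar>f z\<bar> powr p)"
  obtains g where "g \<in> borel_measurable borel" "\<And>x. x \<notin> D \<Longrightarrow> g x = 0"
    "integrable lborel (\<lambda>z. \<bar>g z\<bar> powr p)"
    "(LINT z|lborel. \<bar>g z\<bar> powr p) = (LINT z|lebesgue_on D. \<bar>f z\<bar> powr p)"
    "\<And>x. x \<in> D \<Longrightarrow> integrable (lebesgue_on D) (\<lambda>z. K z x * f z) \<longleftrightarrow> integrable lborel (\<lambda>z. KD z x * g z)"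
    "\<And>x. x \<in> D \<Longrightarrow> T f x = (LINT z|lborel. KD z x * g z)"
    "\<And>h. h \<in> borel_measurable borel \<Longrightarrow> (LINT z|lebesgue_on D. h z * f z) = (LINT z|lborel. h z * g z)"
proof -
  obtain g where g [measurable]: "g \<in> borel_measurable borel" and g0: "\<And>x. x \<notin> D \<Longrightarrow> g x = 0"
    and fg: "AE x in lebesgue_on D. f x = g x"
    using lebesgue_on_borel_representative[OF f D_borel] by blast
  note [measurable] = f
  have fgp: "AE x in lebesgue_on D. \<bar>f x\<bar> powr p = \<bar>g x\<bar> powr p" using fg by eventually_elim simp
  note P = lebesgue_on_representative_integral[of "\<lambda>x. \<bar>f x\<bar> powr p" D "\<lambda>x. \<bar>g x\<bar> powr p" "\<lambda>_. 1", OF _ D_borel _ _ _ fgp]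
  note rep = lebesgue_on_representative_integral[OF f D_borel g _ g0 fg]
  have K: "integrable (lebesgue_on D) (\<lambda>z. K z x * f z) \<longleftrightarrow> integrable lborel (\<lambda>z. KD z x * g z)"
      "T f x = (LINT z|lborel. KD z x * g z)" if x: "x \<in> D" for x
  proof -
    have [measurable]: "(\<lambda>z. KD z x) \<in> borel_measurable borel" by measurable
    have KD [measurable]: "(\<lambda>z. KD z x) \<in> borel_measurable (lebesgue_on D)"
      by (intro measurable_restrict_space1 measurable_completion) simp
    \<comment> \<open>On \<open>D\<close> the section of \<open>K\<close> differs from that of
      \<open>KD\<close> at most at z = x, where \<open>K\<close> is unconstrained.\<close>
    have "(\<lambda>z. K z x) \<in> borel_measurable (lebesgue_on D) \<longleftrightarrow>
        (\<lambda>z. if z \<in> {x} then K x x else KD z x) \<in> borel_measurable (lebesgue_on D)"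
      using x by (intro measurable_cong) (auto simp: KD_def)
    moreover have "(\<lambda>z. if z \<in> {x} then K x x else KD z x) \<in> borel_measurable (lebesgue_on D)"
      by (intro measurable_If_set KD borel_measurable_const)
        (use x in \<open>auto simp: sets_restrict_space_iff\<close>)
    ultimately have [measurable]: "(\<lambda>z. K z x) \<in> borel_measurable (lebesgue_on D)" by simp
    have "AE z in lebesgue_on D. z \<noteq> x"
      by (intro AE_lborel_imp_AE_lebesgue_on AE_lborel_singleton D_borel)
    moreover have "AE z in lebesgue_on D. z \<in> D"
      using AE_space[of "lebesgue_on D"] by simp
    ultimately have ae: "AE z in lebesgue_on D. K z x * f z = KD z x * f z"
      by eventually_elim (use x in \<open>simp add: KD_def\<close>)
    have "integrable (lebesgue_on D) (\<lambda>z. K z x * f z) \<longleftrightarrow> integrable (lebesgue_on D) (\<lambda>z. KD z x * f z)"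
      using ae by (intro integrable_cong_AE) measurable
    then show "integrable (lebesgue_on D) (\<lambda>z. K z x * f z) \<longleftrightarrow> integrable lborel (\<lambda>z. KD z x * g z)"
      using rep(1)[of "\<lambda>z. KD z x"] by simp
    have "T f x = (LINT z|lebesgue_on D. KD z x * f z)"
      unfolding T_def using ae by (intro integral_cong_AE) measurable
    then show "T f x = (LINT z|lborel. KD z x * g z)"
      using rep(2)[of "\<lambda>z. KD z x"] by simp
  qed
  show thesis
  proof (rule that[OF g g0 _ _ K])
    show "integrable lborel (\<lambda>z. \<bar>g z\<bar> powr p)"
      using P(1) fp g0 by simp
    show "(LINT z|lborel. \<bar>g z\<bar> powr p) = (LINT z|lebesgue_on D. \<bar>f z\<bar> powr p)"
      using P(2) g0 by simp
  qed (use rep(2) in auto)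
qed

lemma KD_integral_bound:
  assumes [measurable]: "g \<in> borel_measurable borel"
    and int: "integrable lborel (\<lambda>z. sing (diameter D + 1) (x - z) * \<bar>g z\<bar>)"
  shows "integrable lborel (\<lambda>z. KD z x * g z)"
    and "\<bar>LINT z|lborel. KD z x * g z\<bar> \<le> sing_conv (diameter D + 1) g x"
proof -
  have le: "\<bar>KD z x * g z\<bar> \<le> sing (diameter D + 1) (x - z) * \<bar>g z\<bar>" for z
    by (simp add: abs_mult mult_right_mono KD_le_sing)
  show i: "integrable lborel (\<lambda>z. KD z x * g z)"
  proof (rule Bochner_Integration.integrable_bound[OF int])
    show "AE z in lborel. norm (KD z x * g z) \<le> norm (sing (diameter D + 1) (x - z) * \<bar>g z\<bar>)"
      unfolding real_norm_def by (intro AE_I2 order_trans[OF le abs_ge_self])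
  qed measurable
  have "\<bar>LINT z|lborel. KD z x * g z\<bar> \<le> (LINT z|lborel. \<bar>KD z x * g z\<bar>)"
    by (rule integral_abs_bound)
  also have "\<dots> \<le> sing_conv (diameter D + 1) g x"
    unfolding sing_conv_def using i int le by (intro integral_mono) auto
  finally show "\<bar>LINT z|lborel. KD z x * g z\<bar> \<le> sing_conv (diameter D + 1) g x" .
qed

lemma T_AE_integrable:
  assumes "1 \<le> p" and f: "f \<in> borel_measurable (lebesgue_on D)"
    and fp: "integrable (lebesgue_on D) (\<lambda>z. \<bar>f z\<bar> powr p)"
  shows "AE x in lebesgue_on D. integrable (lebesgue_on D) (\<lambda>z. K z x * f z)"
proof -
  obtain g where g: "g \<in> borel_measurable borel" "\<And>x. x \<notin> D \<Longrightarrow> g x = 0"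
    "integrable lborel (\<lambda>z. \<bar>g z\<bar> powr p)"
    "\<And>x. x \<in> D \<Longrightarrow> integrable (lebesgue_on D) (\<lambda>z. K z x * f z) \<longleftrightarrow> integrable lborel (\<lambda>z. KD z x * g z)"
    by (rule T_borel_representative[OF f fp]) (rule that)
  obtain c where c: "\<forall>\<delta>>0. \<forall>R. \<forall>g\<in>borel_measurable borel.
      (\<forall>x. x \<notin> D \<longrightarrow> g x = 0) \<longrightarrow> integrable lborel (\<lambda>z. \<bar>g z\<bar> powr p) \<longrightarrow>
      (LINT z|lborel. \<bar>g z\<bar> powr p) \<le> R \<longrightarrow>
        (AE x in lborel. integrable lborel (\<lambda>z. sing \<delta> (x - z) * \<bar>g z\<bar>)) \<and>
        (\<integral>\<^sup>+x. ennreal (sing_conv \<delta> g x powr p) \<partial>lborel) \<le> ennreal (c R \<delta>)"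
    \<comment> \<open>Convergence almost everywhere involves no target exponent; with q = p the
      condition reads 0 < 1/n.\<close>
    using sing_conv_bound[of p p] assms(1) by simp blast
  have "diameter D + 1 > 0" using diameter_ge_0[OF bounded_D] by simp
  then have "AE x in lborel. integrable lborel (\<lambda>z. sing (diameter D + 1) (x - z) * \<bar>g z\<bar>)"
    using c[rule_format, OF _ g(1-3) order_refl] by blast
  then have "AE x in lborel. integrable lborel (\<lambda>z. KD z x * g z)"
    by eventually_elim (rule KD_integral_bound[OF g(1)])
  then have "AE x in lebesgue_on D. integrable lborel (\<lambda>z. KD z x * g z)"
    by (rule AE_lborel_imp_AE_lebesgue_on) simp
  moreover have "AE z in lebesgue_on D. z \<in> D"
    using AE_space[of "lebesgue_on D"] by simp
  ultimately show ?thesis by eventually_elim (simp add: g(4))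
qed

lemma T_measurable:
  assumes f: "f \<in> borel_measurable (lebesgue_on D)"
    and fp: "integrable (lebesgue_on D) (\<lambda>z. \<bar>f z\<bar> powr p)"
  shows "T f \<in> borel_measurable (lebesgue_on D)"
proof -
  obtain g where [measurable]: "g \<in> borel_measurable borel"
    and T: "\<And>x. x \<in> D \<Longrightarrow> T f x = (LINT z|lborel. KD z x * g z)"
    by (rule T_borel_representative[OF f fp]) (rule that)
  have "(\<lambda>x. LINT z|lborel. KD z x * g z) \<in> borel_measurable (lebesgue_on D)"
    by (intro measurable_restrict_space1 measurable_completion) measurable
  then show ?thesis by (subst measurable_cong[OF T]) auto
qed

lemma T_powr_integrable:
  assumes pq: "1 \<le> p" "1 \<le> q" "1 / p - 1 / q < 1 / DIM('a)"
    and f: "f \<in> borel_measurable (lebesgue_on D)"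
    and fp: "integrable (lebesgue_on D) (\<lambda>z. \<bar>f z\<bar> powr p)"
  shows "integrable (lebesgue_on D) (\<lambda>x. \<bar>T f x\<bar> powr q)"
proof -
  obtain g where g [measurable]: "g \<in> borel_measurable borel"
    and g0: "\<And>x. x \<notin> D \<Longrightarrow> g x = 0" and gp: "integrable lborel (\<lambda>z. \<bar>g z\<bar> powr p)"
    and T: "\<And>x. x \<in> D \<Longrightarrow> T f x = (LINT z|lborel. KD z x * g z)"
    by (rule T_borel_representative[OF f fp]) (rule that)
  obtain c where c: "\<forall>\<delta>>0. \<forall>R. \<forall>g\<in>borel_measurable borel.
      (\<forall>x. x \<notin> D \<longrightarrow> g x = 0) \<longrightarrow> integrable lborel (\<lambda>z. \<bar>g z\<bar> powr p) \<longrightarrow>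
      (LINT z|lborel. \<bar>g z\<bar> powr p) \<le> R \<longrightarrow>
        (AE x in lborel. integrable lborel (\<lambda>z. sing \<delta> (x - z) * \<bar>g z\<bar>)) \<and>
        (\<integral>\<^sup>+x. ennreal (sing_conv \<delta> g x powr q) \<partial>lborel) \<le> ennreal (c R \<delta>)"
    using sing_conv_bound[OF pq] by blast
  have "diameter D + 1 > 0" using diameter_ge_0[OF bounded_D] by simp
  then have ae: "AE x in lborel. integrable lborel (\<lambda>z. sing (diameter D + 1) (x - z) * \<bar>g z\<bar>)"
    and fin: "(\<integral>\<^sup>+x. ennreal (sing_conv (diameter D + 1) g x powr q) \<partial>lborel) < \<infinity>"
    using c[rule_format, OF _ g g0 gp order_refl] by (force intro: le_less_trans[OF _ ennreal_less_top])+
  have [measurable]: "(\<lambda>x. LINT z|lborel. KD z x * g z) \<in> borel_measurable borel"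
    by measurable
  have 0: "(LINT z|lborel. KD z x * g z) = 0" if "x \<notin> D" for x
    using that by (simp add: KD_def)
  have "integrable lborel (\<lambda>x. \<bar>LINT z|lborel. KD z x * g z\<bar> powr q)"
  proof (rule integrableI_bounded)
    have "(\<integral>\<^sup>+x. ennreal (norm (\<bar>LINT z|lborel. KD z x * g z\<bar> powr q)) \<partial>lborel)
        \<le> (\<integral>\<^sup>+x. ennreal (sing_conv (diameter D + 1) g x powr q) \<partial>lborel)"
      using ae pq by (intro nn_integral_mono_AE)
        (auto elim!: eventually_mono intro!: ennreal_leI powr_mono2 KD_integral_bound(2)[OF g])
    then show "(\<integral>\<^sup>+x. ennreal (norm (\<bar>LINT z|lborel. KD z x * g z\<bar> powr q)) \<partial>lborel) < \<infinity>"
      using fin by (rule le_less_trans)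
  qed measurable
  then have "integrable (lebesgue_on D) (\<lambda>x. \<bar>LINT z|lborel. KD z x * g z\<bar> powr q)"
    using 0 by (subst lebesgue_on_eq_lborel) auto
  then show ?thesis
    by (subst Bochner_Integration.integrable_cong[OF refl, where g = "\<lambda>x. \<bar>LINT z|lborel. KD z x * g z\<bar> powr q"])
      (auto simp: T)
qed

text \<open>The product of kernel and cutoff extends continuously to the compact square of the
  closure: it is continuous on the closed set |x - z| \<ge> \<delta>/2 and vanishes on the closed
  set |x - z| \<le> \<delta>/2, whatever \<open>K\<close> is on the diagonal. Hence it is bounded
  and uniformly continuous. The variable \<open>z\<close> may range over the whole space since
  \<open>KD\<close> is 0 for \<open>z\<close> off \<open>D\<close>.\<close>

lemma KD_cutoff_equicontinuous:
  assumes "\<delta> > 0"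
  shows "\<exists>M. \<forall>z x. \<bar>KD z x * cutoff \<delta> z x\<bar> \<le> M"
    and "\<sigma> > 0 \<Longrightarrow> \<exists>\<eta>>0. \<forall>z. \<forall>x\<in>D. \<forall>y\<in>D. dist x y < \<eta> \<longrightarrow>
      \<bar>KD z x * cutoff \<delta> z x - KD z y * cutoff \<delta> z y\<bar> \<le> \<sigma>"
proof -
  define E where "E = closure D"
  define G where "G = (\<lambda>(z, x). K z x * cutoff \<delta> z x)"
  define A where "A = {p \<in> E \<times> E. norm (snd p - fst p) \<ge> \<delta> / 2}"
  define B where "B = {p \<in> E \<times> E. norm (snd p - fst p) \<le> \<delta> / 2}"
  have E: "compact E" "closed E" using bounded_D by (auto simp: E_def)
  have "A = (E \<times> E) \<inter> {p. norm (snd p - fst p) \<ge> \<delta> / 2}"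
    "B = (E \<times> E) \<inter> {p. norm (snd p - fst p) \<le> \<delta> / 2}" by (auto simp: A_def B_def)
  then have "closed A" "closed B"
    using E by (auto intro!: closed_Int closed_Times closed_Collect_le continuous_intros)
  moreover have "continuous_on A G"
  proof -
    have "continuous_on A (\<lambda>(z, x). K z x)"
      using assms by (intro continuous_on_subset[OF continuous_K]) (auto simp: A_def E_def)
    moreover have "continuous_on A (\<lambda>(z, x). cutoff \<delta> z x)"
      unfolding cutoff_def case_prod_unfold using assms by (intro continuous_intros) auto
    ultimately show ?thesis
      using continuous_on_mult[of A "\<lambda>(z, x). K z x" "\<lambda>(z, x). cutoff \<delta> z x"]
      by (simp add: G_def case_prod_unfold)
  qed
  moreover have "continuous_on B G"
  proof -
    have "G p = 0" if "p \<in> B" for p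
      using that assms by (auto simp: G_def B_def cutoff_def field_simps)
    then show ?thesis by (simp cong: continuous_on_cong)
  qed
  ultimately have "continuous_on (A \<union> B) G" by (rule continuous_on_closed_Un)
  moreover have "A \<union> B = E \<times> E" by (auto simp: A_def B_def)
  ultimately have cont: "continuous_on (E \<times> E) G" by simp
  have cpt: "compact (E \<times> E)" using E by (intro compact_Times)
  have KG: "KD z x * cutoff \<delta> z x = G (z, x)" "(z, x) \<in> E \<times> E" if "z \<in> D" "x \<in> D" for z x
    using that assms closure_subset[of D] by (auto simp: KD_def G_def E_def cutoff_def)
  have "bounded (G ` (E \<times> E))" using cont cpt by (intro compact_imp_bounded compact_continuous_image)
  then obtain M where M: "\<And>p. p \<in> E \<times> E \<Longrightarrow> norm (G p) \<le> M" unfolding bounded_iff by blast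
  have "\<bar>KD z x * cutoff \<delta> z x\<bar> \<le> max M 0" for z x
  proof (cases "z \<in> D \<and> x \<in> D")
    case True
    then show ?thesis using M[of "(z, x)"] KG[of z x] by auto
  qed (auto simp: KD_def)
  then show "\<exists>M. \<forall>z x. \<bar>KD z x * cutoff \<delta> z x\<bar> \<le> M" by blast
  assume "\<sigma> > 0"
  then obtain \<eta> where \<eta>: "\<eta> > 0"
    "\<And>p p'. p \<in> E \<times> E \<Longrightarrow> p' \<in> E \<times> E \<Longrightarrow> dist p' p < \<eta> \<Longrightarrow> dist (G p') (G p) < \<sigma>"
    using compact_uniformly_continuous[OF cont cpt] unfolding uniformly_continuous_on_def by metis
  have "\<bar>KD z x * cutoff \<delta> z x - KD z y * cutoff \<delta> z y\<bar> \<le> \<sigma>"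
    if "x \<in> D" "y \<in> D" "dist x y < \<eta>" for z x y
  proof (cases "z \<in> D")
    case True
    have "dist (G (z, x)) (G (z, y)) < \<sigma>"
      using True that KG by (intro \<eta>) (auto simp: dist_Pair_Pair)
    then show ?thesis using True that KG by (auto simp: dist_real_def)
  qed (use \<open>\<sigma> > 0\<close> in \<open>auto simp: KD_def\<close>)
  then show "\<exists>\<eta>>0. \<forall>z. \<forall>x\<in>D. \<forall>y\<in>D. dist x y < \<eta> \<longrightarrow>
      \<bar>KD z x * cutoff \<delta> z x - KD z y * cutoff \<delta> z y\<bar> \<le> \<sigma>" using \<eta>(1) by blast
qed


text \<open>Compactness stated without sequences or topology. The functionals are the truncated
  kernels at the points of a finite net: they give the values there of the part of
  \<open>T f\<close> away from the diagonal, and equicontinuity carries the smallness to all of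
  \<open>D\<close>.\<close>

lemma T_compact:
  assumes pq: "1 \<le> p" "1 \<le> q" "1 / p - 1 / q < 1 / DIM('a)" and R: "R \<ge> 0" and \<epsilon>: "\<epsilon> > 0"
  shows "\<exists>L \<rho>. finite L \<and> \<rho> > 0 \<and>
    (\<forall>\<kappa>\<in>L. \<kappa> \<in> borel_measurable borel \<and> (\<exists>M. \<forall>z. \<bar>\<kappa> z\<bar> \<le> M)) \<and>
    (\<forall>f\<in>borel_measurable (lebesgue_on D).
      integrable (lebesgue_on D) (\<lambda>z. \<bar>f z\<bar> powr p) \<longrightarrow>
      (LINT z|lebesgue_on D. \<bar>f z\<bar> powr p) \<le> R \<longrightarrow>
      (\<forall>\<kappa>\<in>L. \<bar>LINT z|lebesgue_on D. \<kappa> z * f z\<bar> \<le> \<rho>) \<longrightarrow>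
      (LINT x|lebesgue_on D. \<bar>T f x\<bar> powr q) \<le> \<epsilon>)"
proof -
  define m where "m = measure lborel D"
  have m0: "m \<ge> 0" by (simp add: m_def)
  \<comment> \<open>Half of \<epsilon> for each of the two parts of the operator, divided by the
    factor 2^q that \<open>powr_add_le\<close> costs.\<close>
  define \<epsilon>1 where "\<epsilon>1 = \<epsilon> / 2 / 2 powr q"
  have \<epsilon>1: "\<epsilon>1 > 0" using \<epsilon> by (simp add: \<epsilon>1_def)
  \<comment> \<open>The admissible sup bound for the part away from the diagonal: its q-th power
    times the measure of \<open>D\<close> is at most \<epsilon>1.\<close>
  define \<tau> where "\<tau> = (\<epsilon>1 / (m + 1)) powr (1 / q)"
  have \<tau>: "\<tau> > 0" "\<tau> powr q = \<epsilon>1 / (m + 1)" using \<epsilon>1 m0 pq by (auto simp: \<tau>_def powr_powr)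
  obtain b where b: "\<forall>R\<ge>0. \<forall>\<epsilon>>0. \<exists>\<delta>>0. b R \<delta> \<le> \<epsilon>"
    and bound: "\<forall>\<delta>>0. \<forall>R. \<forall>g\<in>borel_measurable borel.
      (\<forall>x. x \<notin> D \<longrightarrow> g x = 0) \<longrightarrow> integrable lborel (\<lambda>z. \<bar>g z\<bar> powr p) \<longrightarrow>
      (LINT z|lborel. \<bar>g z\<bar> powr p) \<le> R \<longrightarrow>
        (AE x in lborel. integrable lborel (\<lambda>z. sing \<delta> (x - z) * \<bar>g z\<bar>)) \<and>
        (\<integral>\<^sup>+x. ennreal (sing_conv \<delta> g x powr q) \<partial>lborel) \<le> ennreal (b R \<delta>)"
    using sing_conv_bound[OF pq] by blast
  obtain \<delta> where \<delta>: "\<delta> > 0" "b R \<delta> \<le> \<epsilon>1" using b R \<epsilon>1 by blast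
  \<comment> \<open>The admissible oscillation of the truncated kernel. The L^1 norm of the function
    is at most m + R, so moving to a net point changes the value by at most \<tau>/2; the other
    \<tau>/2 is allotted to the functional at that point.\<close>
  define \<sigma> where "\<sigma> = \<tau> / 2 / (m + R + 1)"
  have \<sigma>: "\<sigma> > 0" using \<tau> m0 R by (simp add: \<sigma>_def)
  obtain M where M: "\<And>z x. \<bar>KD z x * cutoff \<delta> z x\<bar> \<le> M"
    using KD_cutoff_equicontinuous(1)[OF \<delta>(1)] by blast
  obtain \<eta> where \<eta>: "\<eta> > 0" "\<And>z x y. x \<in> D \<Longrightarrow> y \<in> D \<Longrightarrow> dist x y < \<eta> \<Longrightarrow>
      \<bar>KD z x * cutoff \<delta> z x - KD z y * cutoff \<delta> z y\<bar> \<le> \<sigma>"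
    using KD_cutoff_equicontinuous(2)[OF \<delta>(1) \<sigma>] by blast
  obtain X where X: "finite X" "X \<subseteq> D" "\<And>x. x \<in> D \<Longrightarrow> \<exists>y\<in>X. dist x y < \<eta>"
    using bounded_finite_subnet[OF bounded_D \<eta>(1)] by blast
  define L where "L = (\<lambda>x z. KD z x * cutoff \<delta> z x) ` X"
  have "(LINT x|lebesgue_on D. \<bar>T f x\<bar> powr q) \<le> \<epsilon>"
    if f: "f \<in> borel_measurable (lebesgue_on D)"
      and fp: "integrable (lebesgue_on D) (\<lambda>z. \<bar>f z\<bar> powr p)" "(LINT z|lebesgue_on D. \<bar>f z\<bar> powr p) \<le> R"
      and L: "\<And>\<kappa>. \<kappa> \<in> L \<Longrightarrow> \<bar>LINT z|lebesgue_on D. \<kappa> z * f z\<bar> \<le> \<tau> / 2" for f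
  proof -
    obtain g where g [measurable]: "g \<in> borel_measurable borel"
      and g0: "\<And>x. x \<notin> D \<Longrightarrow> g x = 0" and gp: "integrable lborel (\<lambda>z. \<bar>g z\<bar> powr p)"
        "(LINT z|lborel. \<bar>g z\<bar> powr p) = (LINT z|lebesgue_on D. \<bar>f z\<bar> powr p)"
      and T: "\<And>x. x \<in> D \<Longrightarrow> T f x = (LINT z|lborel. KD z x * g z)"
      and func: "\<And>h. h \<in> borel_measurable borel \<Longrightarrow> (LINT z|lebesgue_on D. h z * f z) = (LINT z|lborel. h z * g z)"
      by (rule T_borel_representative[OF f fp(1)]) (rule that)
    have gR: "(LINT z|lborel. \<bar>g z\<bar> powr p) \<le> R" using gp fp by simp
    define S where "S x = (LINT z|lborel. (KD z x * cutoff \<delta> z x) * g z)" for x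
    have D: "integrable lborel (\<lambda>x. indicator D x :: real)"
      using emeasure_bounded_finite[OF bounded_D] by (simp add: less_top)
    have pt: "\<bar>g z\<bar> \<le> indicator D z + \<bar>g z\<bar> powr p" for z
      using powr_le_one_plus_powr[of "\<bar>g z\<bar>" 1 p] pq g0[of z] by (cases "z \<in> D") auto
    have g1: "integrable lborel g"
    proof (rule Bochner_Integration.integrable_bound)
      show "integrable lborel (\<lambda>z. indicator D z + \<bar>g z\<bar> powr p)"
        using D gp(1) by (rule Bochner_Integration.integrable_add)
      show "AE z in lborel. norm (g z) \<le> norm (indicator D z + \<bar>g z\<bar> powr p)"
        unfolding real_norm_def by (intro AE_I2 order_trans[OF pt abs_ge_self])
    qed measurable
    have "(LINT z|lborel. \<bar>g z\<bar>) \<le> (LINT z|lborel. indicator D z + \<bar>g z\<bar> powr p)"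
      using D gp(1) pt g1 by (intro integral_mono) auto
    also have "\<dots> \<le> m + R" using D gp(1) gR by (simp add: m_def)
    finally have g1R: "(LINT z|lborel. \<bar>g z\<bar>) \<le> m + R" .
    have Sint: "integrable lborel (\<lambda>z. (KD z x * cutoff \<delta> z x) * g z)" for x
    proof (rule Bochner_Integration.integrable_bound)
      show "integrable lborel (\<lambda>z. M * g z)" using g1 by simp
      have "\<bar>(KD z x * cutoff \<delta> z x) * g z\<bar> \<le> \<bar>M * g z\<bar>" for z
        using M[of z x] by (auto simp: abs_mult intro!: mult_right_mono)
      then show "AE z in lborel. norm ((KD z x * cutoff \<delta> z x) * g z) \<le> norm (M * g z)"
        by simp
    qed measurable
    have S: "\<bar>S x\<bar> \<le> \<tau>" if x: "x \<in> D" for x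
    proof -
      obtain y where y: "y \<in> X" "dist x y < \<eta>" using X(3)[OF x] by blast
      have "S y = (LINT z|lebesgue_on D. (KD z y * cutoff \<delta> z y) * f z)"
        unfolding S_def by (rule func[symmetric]) measurable
      then have Sy: "\<bar>S y\<bar> \<le> \<tau> / 2" using L[of "\<lambda>z. KD z y * cutoff \<delta> z y"] y by (simp add: L_def)
      have i1: "integrable lborel (\<lambda>z. \<bar>(KD z x * cutoff \<delta> z x - KD z y * cutoff \<delta> z y) * g z\<bar>)"
        using integrable_abs[OF Bochner_Integration.integrable_diff[OF Sint[of x] Sint[of y]]]
        by (simp only: left_diff_distrib)
      have i2: "integrable lborel (\<lambda>z. \<sigma> * \<bar>g z\<bar>)" using g1 by simp
      have le: "\<bar>(KD z x * cutoff \<delta> z x - KD z y * cutoff \<delta> z y) * g z\<bar> \<le> \<sigma> * \<bar>g z\<bar>" for z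
      proof -
        have "\<bar>KD z x * cutoff \<delta> z x - KD z y * cutoff \<delta> z y\<bar> \<le> \<sigma>"
          using \<eta>(2)[of x y z] x y X(2) by blast
        then show ?thesis unfolding abs_mult by (rule mult_right_mono) simp
      qed
      have diff: "S x - S y = (LINT z|lborel. (KD z x * cutoff \<delta> z x - KD z y * cutoff \<delta> z y) * g z)"
        unfolding S_def left_diff_distrib
        by (rule Bochner_Integration.integral_diff[OF Sint[of x] Sint[of y], symmetric])
      have "\<bar>S x - S y\<bar> \<le> (LINT z|lborel. \<bar>(KD z x * cutoff \<delta> z x - KD z y * cutoff \<delta> z y) * g z\<bar>)"
        unfolding diff by (rule integral_abs_bound)
      also have "\<dots> \<le> (LINT z|lborel. \<sigma> * \<bar>g z\<bar>)"
        by (rule integral_mono[OF i1 i2 le])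
      also have "\<dots> \<le> \<sigma> * (m + R)" using g1R \<sigma> by simp
      also have "\<dots> \<le> \<tau> / 2" using m0 R \<tau> by (simp add: \<sigma>_def field_simps)
      finally show ?thesis using Sy by linarith
    qed
    have ae: "AE x in lborel. integrable lborel (\<lambda>z. sing \<delta> (x - z) * \<bar>g z\<bar>)"
      and le: "(\<integral>\<^sup>+x. ennreal (sing_conv \<delta> g x powr q) \<partial>lborel) \<le> ennreal (b R \<delta>)"
      using bound[rule_format, OF \<delta>(1) g g0 gp(1) gR] by auto
    define h where "h x = (LINT z|lborel. KD z x * g z)" for x
    have [measurable]: "h \<in> borel_measurable borel" unfolding h_def by measurable
    have h0: "h x = 0" if "x \<notin> D" for x using that by (simp add: KD_def h_def)
    have [measurable]: "sing_conv \<delta> g \<in> borel_measurable borel" unfolding sing_conv_def by measurable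
    have sc0: "sing_conv \<delta> g x \<ge> 0" for x by (simp add: sing_conv_def sing_nonneg)
    \<comment> \<open>The singular convolution bounds the part near the diagonal, and the constant
      \<tau> the rest. The indicator confines \<tau> to \<open>D\<close>, without which its integral
      would be infinite.\<close>
    have pw: "\<bar>h x\<bar> powr q \<le> 2 powr q * (sing_conv \<delta> g x powr q + \<tau> powr q * indicator D x)"
      if i: "integrable lborel (\<lambda>z. sing \<delta> (x - z) * \<bar>g z\<bar>)" for x
    proof (cases "x \<in> D")
      case True
      have lek: "\<bar>(KD z x - KD z x * cutoff \<delta> z x) * g z\<bar> \<le> sing \<delta> (x - z) * \<bar>g z\<bar>" for z
        unfolding abs_mult using KD_diff_cutoff_le_sing[OF \<delta>(1)] by (intro mult_right_mono) auto
      have i1: "integrable lborel (\<lambda>z. (KD z x - KD z x * cutoff \<delta> z x) * g z)"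
      proof (rule Bochner_Integration.integrable_bound[OF i])
        show "AE z in lborel. norm ((KD z x - KD z x * cutoff \<delta> z x) * g z) \<le> norm (sing \<delta> (x - z) * \<bar>g z\<bar>)"
          unfolding real_norm_def by (intro AE_I2 order_trans[OF lek abs_ge_self])
      qed measurable
      have "h x = (LINT z|lborel. (KD z x - KD z x * cutoff \<delta> z x) * g z + (KD z x * cutoff \<delta> z x) * g z)"
        unfolding h_def by (simp add: algebra_simps)
      also have "\<dots> = (LINT z|lborel. (KD z x - KD z x * cutoff \<delta> z x) * g z) + S x"
        unfolding S_def by (rule Bochner_Integration.integral_add[OF i1 Sint])
      finally have hx: "h x = (LINT z|lborel. (KD z x - KD z x * cutoff \<delta> z x) * g z) + S x" .
      have "\<bar>LINT z|lborel. (KD z x - KD z x * cutoff \<delta> z x) * g z\<bar>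
          \<le> (LINT z|lborel. \<bar>(KD z x - KD z x * cutoff \<delta> z x) * g z\<bar>)"
        by (rule integral_abs_bound)
      also have "\<dots> \<le> sing_conv \<delta> g x"
        unfolding sing_conv_def using i lek by (intro integral_mono integrable_abs[OF i1]) auto
      finally have "\<bar>h x\<bar> \<le> sing_conv \<delta> g x + \<tau>" using hx S[OF True] by linarith
      then have "\<bar>h x\<bar> powr q \<le> (sing_conv \<delta> g x + \<tau>) powr q" using pq by (intro powr_mono2) auto
      also have "\<dots> \<le> 2 powr q * (sing_conv \<delta> g x powr q + \<tau> powr q)"
        using sc0 \<tau> pq by (intro powr_add_le) auto
      finally show ?thesis using True by simp
    qed (simp add: h0)
    have "(\<integral>\<^sup>+x. ennreal (\<bar>h x\<bar> powr q) \<partial>lborel)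
      \<le> (\<integral>\<^sup>+x. ennreal (2 powr q) * (ennreal (sing_conv \<delta> g x powr q) + ennreal (\<tau> powr q) * indicator D x) \<partial>lborel)"
    proof (rule nn_integral_mono_AE, use ae in eventually_elim)
      fix x assume "integrable lborel (\<lambda>z. sing \<delta> (x - z) * \<bar>g z\<bar>)"
      from pw[OF this] have "ennreal (\<bar>h x\<bar> powr q)
          \<le> ennreal (2 powr q * (sing_conv \<delta> g x powr q + \<tau> powr q * indicator D x))"
        by (rule ennreal_leI)
      also have "\<dots> = ennreal (2 powr q) * (ennreal (sing_conv \<delta> g x powr q) + ennreal (\<tau> powr q) * indicator D x)"
        by (simp add: ennreal_mult ennreal_plus ennreal_indicator)
      finally show "ennreal (\<bar>h x\<bar> powr q) \<le> \<dots>" .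
    qed
    also have "\<dots> = ennreal (2 powr q) * ((\<integral>\<^sup>+x. ennreal (sing_conv \<delta> g x powr q) \<partial>lborel) + ennreal (\<tau> powr q) * emeasure lborel D)"
      by (simp add: nn_integral_cmult nn_integral_add nn_integral_cmult_indicator)
    also have "\<dots> \<le> ennreal (2 powr q) * (ennreal \<epsilon>1 + ennreal (\<tau> powr q) * ennreal m)"
    proof -
      have "emeasure lborel D = ennreal m" unfolding m_def
        using emeasure_bounded_finite[OF bounded_D] by (intro emeasure_eq_ennreal_measure) auto
      then show ?thesis
        using le \<delta>(2) by (intro mult_left_mono add_mono order_trans[OF le] ennreal_leI) auto
    qed
    also have "\<dots> = ennreal (2 powr q * (\<epsilon>1 + \<tau> powr q * m))"
      using \<epsilon>1 m0 by (simp add: ennreal_mult ennreal_plus)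
    also have "\<dots> \<le> ennreal \<epsilon>"
    proof (rule ennreal_leI)
      have "\<epsilon>1 = \<tau> powr q + \<tau> powr q * m" using \<tau> m0 by (simp add: field_simps)
      then have "\<tau> powr q * m \<le> \<epsilon>1" using powr_ge_zero[of \<tau> q] by linarith
      then have "2 powr q * (\<epsilon>1 + \<tau> powr q * m) \<le> 2 powr q * (2 * \<epsilon>1)" by (intro mult_left_mono) auto
      also have "\<dots> = \<epsilon>" by (simp add: \<epsilon>1_def)
      finally show "2 powr q * (\<epsilon>1 + \<tau> powr q * m) \<le> \<epsilon>" .
    qed
    finally have nn: "(\<integral>\<^sup>+x. ennreal (\<bar>h x\<bar> powr q) \<partial>lborel) \<le> ennreal \<epsilon>" .
    have "(LINT x|lebesgue_on D. \<bar>T f x\<bar> powr q) = (LINT x|lebesgue_on D. \<bar>h x\<bar> powr q)"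
      by (intro Bochner_Integration.integral_cong) (auto simp: T h_def)
    also have "\<dots> = (LINT x|lborel. \<bar>h x\<bar> powr q)"
      using h0 by (subst lebesgue_on_eq_lborel(2)) auto
    also have "\<dots> \<le> \<epsilon>"
      using nn \<epsilon> by (subst integral_eq_nn_integral) (auto simp: enn2real_leI)
    finally show ?thesis .
  qed
  moreover have "\<forall>\<kappa>\<in>L. \<kappa> \<in> borel_measurable borel \<and> (\<exists>M. \<forall>z. \<bar>\<kappa> z\<bar> \<le> M)"
  proof
    fix \<kappa> assume "\<kappa> \<in> L"
    then obtain x where x: "\<kappa> = (\<lambda>z. KD z x * cutoff \<delta> z x)" by (auto simp: L_def)
    have "\<kappa> \<in> borel_measurable borel" unfolding x by measurable
    then show "\<kappa> \<in> borel_measurable borel \<and> (\<exists>M. \<forall>z. \<bar>\<kappa> z\<bar> \<le> M)" using M x by blast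
  qed
  ultimately show ?thesis
    using X(1) \<tau>(1) by (intro exI[of _ L] exI[of _ "\<tau> / 2"]) (auto simp: L_def)
qed

end

subsection \<open>The kernel of the homotopy operator\<close>

lemma test_function_continuous:
  assumes "test_function D \<phi>"
  shows "continuous_on S \<phi>"
proof -
  have "continuously_differentiable 0 \<phi>" using assms unfolding test_function_def by blast
  then show ?thesis using continuous_on_subset by auto
qed

lemma test_function_zero:
  assumes "test_function D \<phi>" "y \<notin> D"
  shows "\<phi> y = 0"
  using assms closure_subset[of "{y. \<phi> y \<noteq> 0}"] unfolding test_function_def by blast

lemma test_function_bounded:
  assumes "test_function D \<phi>"
  obtains M where "M \<ge> 0" "\<And>y. \<bar>\<phi> y\<bar> \<le> M"
proof -
  have "compact (\<phi> ` closure {y. \<phi> y \<noteq> 0})"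
    using assms test_function_continuous[OF assms]
    by (intro compact_continuous_image) (auto simp: test_function_def)
  then obtain M where "\<forall>y\<in>closure {y. \<phi> y \<noteq> 0}. \<bar>\<phi> y\<bar> \<le> M"
    by (auto dest!: compact_imp_bounded simp: bounded_iff)
  then have M: "\<And>y. y \<in> closure {y. \<phi> y \<noteq> 0} \<Longrightarrow> \<bar>\<phi> y\<bar> \<le> M" by blast
  have "\<bar>\<phi> y\<bar> \<le> max M 0" for y
    using M[of y] closure_subset[of "{y. \<phi> y \<noteq> 0}"] by (cases "\<phi> y = 0") auto
  then show thesis by (intro that[of "max M 0"]) auto
qed

text \<open>The half-line integral in the kernel, cut to a fixed compact interval beyond which
  \<phi> vanishes along the ray. Continuity in \<open>z\<close> and \<open>h\<close> is then
  continuity of an integral over a compact interval with a continuous integrand.\<close>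

definition radial_moment :: "real \<Rightarrow> (real ^ 'n \<Rightarrow> real) \<Rightarrow> nat \<Rightarrow> real ^ 'n \<Rightarrow> real ^ 'n \<Rightarrow> real" where
  "radial_moment R \<phi> \<nu> z h = integral {0..R} (\<lambda>s. s ^ (\<nu> - 1) * \<phi> (z - (s / norm h) *\<^sub>R h))"

lemma radial_integrand_continuous:
  assumes "test_function D \<phi>"
  shows "continuous_on S (\<lambda>s. s ^ (\<nu> - 1) * \<phi> (z - (s / norm h) *\<^sub>R h))"
  unfolding divide_inverse
  by (intro continuous_intros continuous_on_compose2[OF test_function_continuous[OF assms, of UNIV]]) auto

text \<open>The point z - s h/|h| has norm at least s - B. For s > 2B it has left the ball of radius
  \<open>B\<close>, hence the support of \<phi>.\<close>

lemma radial_integral_eq: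
  assumes \<phi>: "test_function D \<phi>" and D: "D \<subseteq> cball 0 B" and z: "norm z \<le> B" and h: "h \<noteq> 0" and B: "B \<ge> 0"
  shows "(LINT s:{0<..}|lebesgue. s ^ (\<nu> - 1) * \<phi> (z - (s / norm h) *\<^sub>R h)) = radial_moment (2 * B) \<phi> \<nu> z h"
proof -
  let ?f = "\<lambda>s. s ^ (\<nu> - 1) * \<phi> (z - (s / norm h) *\<^sub>R h)"
  have zero: "?f s = 0" if "s > 2 * B" for s
  proof -
    have "norm ((s / norm h) *\<^sub>R h) = s" using h that B by simp
    then have "norm (z - (s / norm h) *\<^sub>R h) \<ge> s - B"
      using norm_triangle_ineq2[of "(s / norm h) *\<^sub>R h" z] z by (simp add: norm_minus_commute)
    then have "z - (s / norm h) *\<^sub>R h \<notin> D" using D that by auto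
    then show ?thesis by (simp add: test_function_zero[OF \<phi>])
  qed
  have abs: "?f absolutely_integrable_on {0..2 * B}"
    using radial_integrand_continuous[OF \<phi>]
    by (intro absolutely_integrable_continuous_real)
  have abs': "?f absolutely_integrable_on {0<..2 * B}"
    by (rule set_integrable_subset[OF abs]) auto
  have "(LINT s:{0<..}|lebesgue. ?f s) = (LINT s:{0<..2 * B}|lebesgue. ?f s)"
    unfolding set_lebesgue_integral_def
    using zero by (intro Bochner_Integration.integral_cong) (auto simp: indicator_def not_le)
  also have "\<dots> = integral {0<..2 * B} ?f"
    by (rule set_lebesgue_integral_eq_integral(2)[OF abs'])
  also have "\<dots> = integral {0..2 * B} ?f"
  proof (rule integral_subset_negligible)
    have "{0..2 * B} - {0<..2 * B} \<subseteq> {0}" by auto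
    then show "negligible ({0..2 * B} - {0<..2 * B})" by (rule negligible_subset[OF negligible_sing])
  qed auto
  finally show ?thesis by (simp add: radial_moment_def)
qed

lemma radial_moment_bound:
  assumes \<phi>: "test_function D \<phi>" and M: "\<And>y. \<bar>\<phi> y\<bar> \<le> M" and R: "R \<ge> 0"
  shows "\<bar>radial_moment R \<phi> \<nu> z h\<bar> \<le> R ^ (\<nu> - 1) * M * R"
proof -
  have "norm (radial_moment R \<phi> \<nu> z h) \<le> R ^ (\<nu> - 1) * M * (R - 0)"
    unfolding radial_moment_def
  proof (rule integral_bound)
    show "norm (t ^ (\<nu> - 1) * \<phi> (z - (t / norm h) *\<^sub>R h)) \<le> R ^ (\<nu> - 1) * M" if "t \<in> {0..R}" for t
      using that M R by (auto simp: abs_mult power_abs intro!: mult_mono power_mono)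
  qed (use R radial_integrand_continuous[OF \<phi>] in auto)
  then show ?thesis by simp
qed

lemma radial_moment_continuous:
  assumes \<phi>: "test_function D \<phi>"
  shows "continuous_on {(z, h). h \<noteq> 0} (\<lambda>(z, h). radial_moment R \<phi> \<nu> z h)"
proof -
  have "continuous_on ({(z, h). h \<noteq> 0} \<times> cbox 0 R)
      (\<lambda>(p, s). s ^ (\<nu> - 1) * \<phi> (fst p - (s / norm (snd p)) *\<^sub>R snd p))"
    unfolding case_prod_unfold
    by (intro continuous_intros continuous_on_compose2[OF test_function_continuous[OF \<phi>, of UNIV]]) auto
  from integral_continuous_on_param[OF this] show ?thesis
    by (simp add: radial_moment_def case_prod_unfold)
qed

text \<open>The term with index \<nu> has order |h|^(1 - \<nu>) = |h|^(n - \<nu>) |h|^(1 - n), and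
  |h| \<le> 2B absorbs the first factor; the worst term is \<nu> = n. A bound on the vector norm
  yields one constant for all components.\<close>

lemma zeta_kernel_weakly_singular:
  fixes D :: "(real ^ 'n) set"
  assumes D: "open D" "bounded D" and \<phi>: "test_function D \<phi>" and k: "1 \<le> k"
  shows "\<exists>C. \<forall>i. weakly_singular_kernel (\<lambda>z x. zeta_kernel k \<phi> z (x - z) $ i) D C"
proof -
  define n where "n = CARD('n)"
  have n: "n \<ge> 1" by (simp add: n_def Suc_leI)
  obtain B0 where B0: "D \<subseteq> cball 0 B0" using D(2) unfolding bounded_iff by (auto simp: subset_iff)
  define B where "B = max B0 1"
  have B: "D \<subseteq> cball 0 B" "B \<ge> 1" using B0 by (auto simp: B_def)
  have cl: "closure D \<subseteq> cball 0 B" using B(1) by (simp add: closure_minimal)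
  obtain M where M: "M \<ge> 0" "\<And>y. \<bar>\<phi> y\<bar> \<le> M" using test_function_bounded[OF \<phi>] by blast
  define c :: "nat \<Rightarrow> real" where "c \<nu> = real ((n - k) choose (\<nu> - k))" for \<nu>
  define C where "C = (\<Sum>\<nu>=k..n. c \<nu> * ((2 * B) ^ (\<nu> - 1) * M * (2 * B)) * (2 * B) ^ (n - \<nu>))"
  have zeta: "zeta_kernel k \<phi> z h = (\<Sum>\<nu>=k..n. (c \<nu> * radial_moment (2 * B) \<phi> \<nu> z h) *\<^sub>R ((1 / norm h ^ \<nu>) *\<^sub>R h))"
    if "norm z \<le> B" "h \<noteq> 0" for z h
    using radial_integral_eq[OF \<phi> B(1) that] B(2) by (simp add: zeta_kernel_def c_def n_def)
  have bound: "norm (zeta_kernel k \<phi> z h) \<le> C * norm h powr (1 - real n)"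
    if z: "norm z \<le> B" and h: "h \<noteq> 0" "norm h \<le> 2 * B" for z h
  proof -
    have "norm (zeta_kernel k \<phi> z h)
        \<le> (\<Sum>\<nu>=k..n. norm ((c \<nu> * radial_moment (2 * B) \<phi> \<nu> z h) *\<^sub>R ((1 / norm h ^ \<nu>) *\<^sub>R h)))"
      unfolding zeta[OF z h(1)] by (rule norm_sum)
    also have "\<dots> \<le> (\<Sum>\<nu>=k..n. c \<nu> * ((2 * B) ^ (\<nu> - 1) * M * (2 * B)) * (2 * B) ^ (n - \<nu>) * norm h powr (1 - real n))"
    proof (rule sum_mono)
      fix \<nu> assume \<nu>: "\<nu> \<in> {k..n}"
      have "norm ((1 / norm h ^ \<nu>) *\<^sub>R h) = norm h ^ (n - \<nu>) * norm h powr (1 - real n)"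
      proof -
        have "norm h powr (1 - real n) = norm h / norm h ^ n"
          using h by (simp add: powr_diff powr_realpow)
        moreover have "norm h ^ n = norm h ^ \<nu> * norm h ^ (n - \<nu>)"
          using \<nu> by (simp flip: power_add)
        ultimately show ?thesis using h by (simp add: field_simps)
      qed
      also have "\<dots> \<le> (2 * B) ^ (n - \<nu>) * norm h powr (1 - real n)"
        using h by (intro mult_right_mono power_mono) auto
      finally have 1: "norm ((1 / norm h ^ \<nu>) *\<^sub>R h) \<le> (2 * B) ^ (n - \<nu>) * norm h powr (1 - real n)" .
      have 2: "c \<nu> * \<bar>radial_moment (2 * B) \<phi> \<nu> z h\<bar> \<le> c \<nu> * ((2 * B) ^ (\<nu> - 1) * M * (2 * B))"
        using B(2) by (intro mult_left_mono radial_moment_bound[OF \<phi> M(2)]) (auto simp: c_def)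
      have "(c \<nu> * \<bar>radial_moment (2 * B) \<phi> \<nu> z h\<bar>) * norm ((1 / norm h ^ \<nu>) *\<^sub>R h)
          \<le> (c \<nu> * ((2 * B) ^ (\<nu> - 1) * M * (2 * B))) * ((2 * B) ^ (n - \<nu>) * norm h powr (1 - real n))"
        by (rule mult_mono[OF 2 1]) (use M(1) B(2) in \<open>auto simp: c_def\<close>)
      moreover have "norm ((c \<nu> * radial_moment (2 * B) \<phi> \<nu> z h) *\<^sub>R ((1 / norm h ^ \<nu>) *\<^sub>R h))
          = (c \<nu> * \<bar>radial_moment (2 * B) \<phi> \<nu> z h\<bar>) * norm ((1 / norm h ^ \<nu>) *\<^sub>R h)"
        by (simp only: norm_scaleR abs_mult) (simp add: c_def)
      ultimately show "norm ((c \<nu> * radial_moment (2 * B) \<phi> \<nu> z h) *\<^sub>R ((1 / norm h ^ \<nu>) *\<^sub>R h))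
          \<le> c \<nu> * ((2 * B) ^ (\<nu> - 1) * M * (2 * B)) * (2 * B) ^ (n - \<nu>) * norm h powr (1 - real n)"
        by (simp only: mult.assoc)
    qed
    also have "\<dots> = C * norm h powr (1 - real n)" by (simp add: C_def sum_distrib_right)
    finally show ?thesis .
  qed
  have "weakly_singular_kernel (\<lambda>z x. zeta_kernel k \<phi> z (x - z) $ i) D C" for i
  proof
    show "C \<ge> 0" using B(2) M(1) by (auto simp: C_def c_def intro!: sum_nonneg mult_nonneg_nonneg)
    let ?S = "{(z, x). z \<in> closure D \<and> x \<in> closure D \<and> z \<noteq> x}"
    have mom: "continuous_on ?S (\<lambda>p. radial_moment (2 * B) \<phi> \<nu> (fst p) (snd p - fst p))" for \<nu>
    proof -
      have "continuous_on ?S (\<lambda>p. (fst p, snd p - fst p))" by (intro continuous_intros)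
      moreover have "(\<lambda>p. (fst p, snd p - fst p)) ` ?S \<subseteq> {(z, h). h \<noteq> 0}" by auto
      ultimately show ?thesis
        using continuous_on_compose2[OF radial_moment_continuous[OF \<phi>, of "2 * B" \<nu>]] by fastforce
    qed
    have "continuous_on ?S (\<lambda>p. (\<Sum>\<nu>=k..n. (c \<nu> * radial_moment (2 * B) \<phi> \<nu> (fst p) (snd p - fst p)) *\<^sub>R
        ((1 / norm (snd p - fst p) ^ \<nu>) *\<^sub>R (snd p - fst p))) $ i)"
      by (intro continuous_intros mom) auto
    \<comment> \<open>The formula through \<open>radial_moment\<close> persists on the closure of
      \<open>D\<close>, which stays in the ball of radius \<open>B\<close>.\<close>
    also have "?this \<longleftrightarrow> continuous_on ?S (\<lambda>(z, x). zeta_kernel k \<phi> z (x - z) $ i)"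
      using cl by (intro continuous_on_cong) (auto simp: zeta subset_iff)
    finally show "continuous_on ?S (\<lambda>(z, x). zeta_kernel k \<phi> z (x - z) $ i)" .
    show "\<bar>zeta_kernel k \<phi> z (x - z) $ i\<bar> \<le> C * norm (x - z) powr (1 - real DIM(real ^ 'n))"
      if "z \<in> D" "x \<in> D" "z \<noteq> x" for z x
    proof -
      have nz: "norm z \<le> B" "norm x \<le> B" using that B(1) by auto
      then have "norm (x - z) \<le> 2 * B" using norm_triangle_ineq4[of x z] by linarith
      then have "norm (zeta_kernel k \<phi> z (x - z)) \<le> C * norm (x - z) powr (1 - real n)"
        using that nz by (intro bound) auto
      then show ?thesis using component_le_norm_cart[of "zeta_kernel k \<phi> z (x - z)" i]
        by (simp add: n_def)
    qed
  qed (use D in auto)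
  then show ?thesis by blast
qed

subsection \<open>Alternating forms in coordinates\<close>

lemma alternating_form_linear:
  assumes "alternating_form k f" "length as + Suc (length bs) = k"
  shows "linear (\<lambda>v. f (as @ v # bs))"
proof -
  have "\<forall>i<k. linear (\<lambda>v. f ((as @ 0 # bs)[i := v]))"
    using assms(1)[unfolded alternating_form_def, THEN spec[of _ "as @ 0 # bs"]] assms(2) by simp
  from this[THEN spec[of _ "length as"]] assms(2) show ?thesis by simp
qed

text \<open>Polarization: alternation is given as vanishing on repeated arguments, and expanding the
  value 0 at the repeated argument x + y leaves the two mixed terms.\<close>

lemma alternating_form_swap:
  assumes f: "alternating_form k f" and k: "length as + Suc (Suc (length bs)) = k"
  shows "f (as @ x # y # bs) = - f (as @ y # x # bs)"
proof -
  have z: "f (as @ v # v # bs) = 0" for v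
    using assms unfolding alternating_form_def by auto
  have l1: "f (as @ (x + y) # v # bs) = f (as @ x # v # bs) + f (as @ y # v # bs)" for v
    using linear_add[OF alternating_form_linear[OF f, of as "v # bs"]] k by simp
  have l2: "f (as @ u # (x + y) # bs) = f (as @ u # x # bs) + f (as @ u # y # bs)" for u
    using linear_add[OF alternating_form_linear[OF f, of "as @ [u]" bs]] k by simp
  have "0 = f (as @ (x + y) # (x + y) # bs)" by (simp add: z)
  also have "\<dots> = f (as @ x # y # bs) + f (as @ y # x # bs)" unfolding l1 l2 by (simp add: z)
  finally show ?thesis by linarith
qed

text \<open>The factor \<open>s\<close>, in effect a sign, is chosen before \<open>f\<close>, so
  that it serves all alternating forms. The arbitrary prefix \<open>as\<close> makes the relation
  stable under \<open>Cons\<close>, as an induction along the list requires.\<close>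

definition basis_proportional :: "'n::{finite,linorder} list \<Rightarrow> 'n list \<Rightarrow> bool" where
  "basis_proportional xs ys \<longleftrightarrow> (\<forall>as. \<exists>s::real. \<forall>f :: (real, 'n) vec list \<Rightarrow> real.
     alternating_form (length as + length xs) f \<longrightarrow> coefficient f (as @ xs) = s * coefficient f (as @ ys))"

lemma basis_proportional_refl: "basis_proportional xs xs"
  unfolding basis_proportional_def by (metis mult_1)

lemma basis_proportional_trans:
  assumes "basis_proportional xs ys" "basis_proportional ys zs" "length xs = length ys"
  shows "basis_proportional xs zs"
  unfolding basis_proportional_def
proof
  fix as :: "'a list"
  obtain s t :: real where
    "\<And>f :: (real, 'a) vec list \<Rightarrow> real. alternating_form (length as + length xs) f \<Longrightarrow>
      coefficient f (as @ xs) = s * coefficient f (as @ ys)"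
    "\<And>f :: (real, 'a) vec list \<Rightarrow> real. alternating_form (length as + length ys) f \<Longrightarrow>
      coefficient f (as @ ys) = t * coefficient f (as @ zs)"
    using assms unfolding basis_proportional_def by metis
  then show "\<exists>s. \<forall>f :: (real, 'a) vec list \<Rightarrow> real. alternating_form (length as + length xs) f \<longrightarrow>
      coefficient f (as @ xs) = s * coefficient f (as @ zs)"
    using assms(3) by (intro exI[of _ "s * t"]) simp
qed

lemma basis_proportional_Cons:
  assumes "basis_proportional xs ys"
  shows "basis_proportional (x # xs) (x # ys)"
  unfolding basis_proportional_def
proof
  fix as :: "'a list"
  show "\<exists>s. \<forall>f :: (real, 'a) vec list \<Rightarrow> real. alternating_form (length as + length (x # xs)) f \<longrightarrow>
      coefficient f (as @ x # xs) = s * coefficient f (as @ x # ys)"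
    using assms[unfolded basis_proportional_def, rule_format, of "as @ [x]"] by simp
qed

lemma basis_proportional_swap: "basis_proportional (x # y # zs) (y # x # zs)"
  unfolding basis_proportional_def
proof
  fix as :: "'a list"
  show "\<exists>s. \<forall>f :: (real, 'a) vec list \<Rightarrow> real. alternating_form (length as + length (x # y # zs)) f \<longrightarrow>
      coefficient f (as @ x # y # zs) = s * coefficient f (as @ y # x # zs)"
    by (intro exI[of _ "- 1"]) (auto simp: coefficient_def intro!: alternating_form_swap)
qed

text \<open>Insertion moves \<open>x\<close> to its place by swaps of adjacent entries; iterating
  this is insertion sort, so no theory of permutations and their signs is required.\<close>

lemma basis_proportional_insort: "basis_proportional (x # xs) (insort x xs)"
proof (induction xs)
  case (Cons y ys)
  have "basis_proportional (x # y # ys) (y # insort x ys)"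
    by (rule basis_proportional_trans[OF basis_proportional_swap basis_proportional_Cons[OF Cons]]) simp
  then show ?case by (simp add: basis_proportional_refl)
qed (simp add: basis_proportional_refl)

lemma basis_proportional_sort: "basis_proportional xs (sort xs)"
proof (induction xs)
  case (Cons x xs)
  show ?case
    using basis_proportional_trans[OF basis_proportional_Cons[OF Cons, of x] basis_proportional_insort]
    by simp
qed (simp add: basis_proportional_refl)

lemma finite_multi_indices: "finite (multi_indices k :: 'n::{finite,linorder} list set)"
  by (rule finite_subset[OF _ finite_lists_length_eq[OF finite_class.finite_UNIV, of k]]) (auto simp: multi_indices_def)

text \<open>An index list without repetitions is proportional to its sorted version, which is a
  multi-index; with a repetition the coefficient is 0. Quantifying \<open>c\<close> before
  \<open>f\<close> allows the same scalars at every point of a differential form.\<close>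

lemma coefficient_expansion:
  fixes \<beta> :: "'n::{finite,linorder} list"
  assumes "length \<beta> = k"
  shows "\<exists>c. \<forall>f :: (real, 'n) vec list \<Rightarrow> real. alternating_form k f \<longrightarrow>
    coefficient f \<beta> = (\<Sum>\<alpha>\<in>multi_indices k. c \<alpha> * coefficient f \<alpha>)"
proof (cases "distinct \<beta>")
  case True
  have sort: "sort \<beta> \<in> multi_indices k"
    using True assms by (simp add: multi_indices_def strict_sorted_iff)
  obtain s :: real where s: "\<And>f :: (real, 'n) vec list \<Rightarrow> real. alternating_form k f \<Longrightarrow>
      coefficient f \<beta> = s * coefficient f (sort \<beta>)"
    using basis_proportional_sort[of \<beta>, unfolded basis_proportional_def, rule_format, of "[]"] assms by auto
  show ?thesis
    using sort
    by (intro exI[of _ "\<lambda>\<alpha>. if \<alpha> = sort \<beta> then s else 0"])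
      (auto simp: s finite_multi_indices if_distrib[of "\<lambda>c. c * _"] cong: if_cong)
next
  case False
  then have "\<not> distinct (map (\<lambda>i. axis i (1::real)) \<beta> :: (real, 'n) vec list)"
    by (simp add: distinct_map)
  then show ?thesis
    using assms by (intro exI[of _ "\<lambda>_. 0"]) (auto simp: alternating_form_def coefficient_def)
qed

lemma alternating_form_axis_expansion:
  fixes f :: "(real ^ 'n) list \<Rightarrow> real"
  assumes "alternating_form k f" "length as + Suc (length bs) = k"
  shows "f (as @ v # bs) = (\<Sum>i\<in>UNIV. v $ i * f (as @ axis i 1 # bs))"
proof -
  note lin = alternating_form_linear[OF assms]
  have "f (as @ v # bs) = f (as @ (\<Sum>i\<in>UNIV. (v $ i) *\<^sub>R axis i 1) # bs)"
    using basis_expansion[of v] by (simp add: scalar_mult_eq_scaleR)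
  also have "\<dots> = (\<Sum>i\<in>UNIV. v $ i * f (as @ axis i 1 # bs))"
    by (simp add: linear_sum[OF lin] linear_scale[OF lin])
  finally show ?thesis .
qed

text \<open>Induction on the arguments not yet expanded: each is written in the standard basis by
  linearity, and the resulting basis vector joins the prefix \<beta>.\<close>

lemma alternating_form_expansion_aux:
  fixes \<xi> :: "(real, 'n::{finite,linorder}) vec list" and \<beta> :: "'n list"
  assumes "length \<beta> + length \<xi> = k"
  shows "\<exists>c. \<forall>f :: (real, 'n) vec list \<Rightarrow> real. alternating_form k f \<longrightarrow>
    f (map (\<lambda>i. axis i 1) \<beta> @ \<xi>) = (\<Sum>\<alpha>\<in>multi_indices k. c \<alpha> * coefficient f \<alpha>)"
  using assms
proof (induction \<xi> arbitrary: \<beta>)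
  case Nil
  then show ?case using coefficient_expansion[of \<beta> k] by (simp add: coefficient_def)
next
  case (Cons v \<xi>)
  have "\<forall>i. \<exists>c. \<forall>f :: (real, 'n) vec list \<Rightarrow> real. alternating_form k f \<longrightarrow>
    f (map (\<lambda>i. axis i 1) \<beta> @ axis i 1 # \<xi>) = (\<Sum>\<alpha>\<in>multi_indices k. c \<alpha> * coefficient f \<alpha>)"
  proof
    fix i
    show "\<exists>c. \<forall>f :: (real, 'n) vec list \<Rightarrow> real. alternating_form k f \<longrightarrow>
      f (map (\<lambda>i. axis i 1) \<beta> @ axis i 1 # \<xi>) = (\<Sum>\<alpha>\<in>multi_indices k. c \<alpha> * coefficient f \<alpha>)"
      using Cons.IH[of "\<beta> @ [i]"] Cons.prems by simp
  qed
  then obtain c where c: "\<And>i (f :: (real, 'n) vec list \<Rightarrow> real). alternating_form k f \<Longrightarrow>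
    f (map (\<lambda>i. axis i 1) \<beta> @ axis i 1 # \<xi>) = (\<Sum>\<alpha>\<in>multi_indices k. c i \<alpha> * coefficient f \<alpha>)"
    by metis
  have "f (map (\<lambda>i. axis i 1) \<beta> @ v # \<xi>) = (\<Sum>\<alpha>\<in>multi_indices k. (\<Sum>i\<in>UNIV. v $ i * c i \<alpha>) * coefficient f \<alpha>)"
    if f: "alternating_form k f" for f :: "(real, 'n) vec list \<Rightarrow> real"
  proof -
    have "f (map (\<lambda>i. axis i 1) \<beta> @ v # \<xi>) = (\<Sum>i\<in>UNIV. v $ i * (\<Sum>\<alpha>\<in>multi_indices k. c i \<alpha> * coefficient f \<alpha>))"
      using Cons.prems by (subst alternating_form_axis_expansion[OF f]) (auto simp: c[OF f])
    also have "\<dots> = (\<Sum>i\<in>UNIV. \<Sum>\<alpha>\<in>multi_indices k. (v $ i * c i \<alpha>) * coefficient f \<alpha>)"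
      by (simp add: sum_distrib_left mult.assoc)
    also have "\<dots> = (\<Sum>\<alpha>\<in>multi_indices k. \<Sum>i\<in>UNIV. (v $ i * c i \<alpha>) * coefficient f \<alpha>)"
      by (rule sum.swap)
    finally show ?thesis by (simp add: sum_distrib_right)
  qed
  then show ?case by (intro exI allI impI)
qed

text \<open>For \<open>length \<xi> = k\<close> and increasing \<alpha> these are the minors
  dx^\<alpha>(\<xi>). Only their independence of \<open>f\<close> matters, so a choice suffices in
  place of determinants.\<close>

definition expansion_coefficient :: "nat \<Rightarrow> (real, 'n::{finite,linorder}) vec list \<Rightarrow> 'n list \<Rightarrow> real" where
  "expansion_coefficient k \<xi> = (SOME c. \<forall>f. alternating_form k f \<longrightarrow>
     f \<xi> = (\<Sum>\<alpha>\<in>multi_indices k. c \<alpha> * coefficient f \<alpha>))"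

lemma alternating_form_expansion:
  assumes "alternating_form k f" "length \<xi> = k"
  shows "f \<xi> = (\<Sum>\<alpha>\<in>multi_indices k. expansion_coefficient k \<xi> \<alpha> * coefficient f \<alpha>)"
proof -
  have "\<exists>c. \<forall>f. alternating_form k f \<longrightarrow> f \<xi> = (\<Sum>\<alpha>\<in>multi_indices k. c \<alpha> * coefficient f \<alpha>)"
    using alternating_form_expansion_aux[of "[]" \<xi> k] assms(2) by simp
  from someI_ex[OF this] assms(1) show ?thesis
    unfolding expansion_coefficient_def by blast
qed

subsection \<open>The metric spaces of differential forms\<close>

lemma powr_convex_nonneg:
  fixes s t \<theta> p :: real
  assumes "p \<ge> 1" "0 \<le> \<theta>" "\<theta> \<le> 1" "s \<ge> 0" "t \<ge> 0"
  shows "(\<theta> * s + (1 - \<theta>) * t) powr p \<le> \<theta> * s powr p + (1 - \<theta>) * t powr p"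
proof -
  have scale: "(c * u) powr p \<le> c * u powr p" if "0 \<le> c" "c \<le> 1" "u \<ge> 0" for c u :: real
  proof -
    have "c powr p \<le> c powr 1" using powr_mono'[of 1 p c] that assms(1) by simp
    then have "c powr p * u powr p \<le> c * u powr p" using that by (intro mult_right_mono) auto
    then show ?thesis using that by (simp add: powr_mult)
  qed
  show ?thesis
  proof (cases "s = 0 \<or> t = 0")
    case True
    then show ?thesis using scale[of \<theta> s] scale[of "1 - \<theta>" t] assms by auto
  next
    case False
    then show ?thesis
      using convex_onD[OF powr_convex[OF assms(1)], of "1 - \<theta>" s t] assms by (simp add: algebra_simps)
  qed
qed

text \<open>Stated for u \<le> v + w, because the modulus is only subadditive at each point. With
  norms a and b of v and w, u/(a + b) is at most the convex combination of v/a and w/b with weight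
  \<theta> = a/(a + b), and convexity of the power is integrated.\<close>

lemma Minkowski_inequality_powr:
  fixes u v w :: "'a \<Rightarrow> real"
  assumes p: "p \<ge> 1"
    and u: "integrable M (\<lambda>x. u x powr p)" and v: "integrable M (\<lambda>x. v x powr p)" and w: "integrable M (\<lambda>x. w x powr p)"
    and nn: "\<And>x. u x \<ge> 0" "\<And>x. v x \<ge> 0" "\<And>x. w x \<ge> 0"
    and le: "\<And>x. u x \<le> v x + w x"
  shows "(\<integral>x. u x powr p \<partial>M) powr (1 / p) \<le> (\<integral>x. v x powr p \<partial>M) powr (1 / p) + (\<integral>x. w x powr p \<partial>M) powr (1 / p)"
proof -
  define a where "a = (\<integral>x. v x powr p \<partial>M) powr (1 / p)"
  define b where "b = (\<integral>x. w x powr p \<partial>M) powr (1 / p)"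
  have ap: "a powr p = (\<integral>x. v x powr p \<partial>M)" "b powr p = (\<integral>x. w x powr p \<partial>M)"
    using p by (auto simp: a_def b_def powr_powr)
  \<comment> \<open>The normalization fails if one of the norms is 0; then that function vanishes
    almost everywhere and \<open>u\<close> lies below the other one.\<close>
  have zero: "(\<integral>x. u x powr p \<partial>M) \<le> (\<integral>x. g x powr p \<partial>M)"
    if f: "(\<integral>x. f x powr p \<partial>M) = 0" and fi: "integrable M (\<lambda>x. f x powr p)"
      and gi: "integrable M (\<lambda>x. g x powr p)" and ug: "\<And>x. u x \<le> f x + g x" for f g
  proof -
    have "AE x in M. f x powr p = 0"
      using f fi by (subst (asm) integral_nonneg_eq_0_iff_AE) auto
    then have "AE x in M. u x powr p \<le> g x powr p"
      by eventually_elim (use ug nn p in \<open>auto intro!: powr_mono2 simp: powr_eq_0_iff dest: spec\<close>, metis add_0)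
    then show ?thesis using u gi by (rule integral_mono_AE[rotated 2])
  qed
  have "(\<integral>x. u x powr p \<partial>M) powr (1 / p) \<le> a + b"
  proof (cases "a = 0 \<or> b = 0")
    case True
    then have "(\<integral>x. u x powr p \<partial>M) powr (1 / p) \<le> b \<or> (\<integral>x. u x powr p \<partial>M) powr (1 / p) \<le> a"
    proof
      assume "a = 0"
      then have "(\<integral>x. u x powr p \<partial>M) \<le> (\<integral>x. w x powr p \<partial>M)"
        using zero[of v w] v w le ap p by simp
      then show ?thesis using p unfolding b_def by (intro disjI1 powr_mono2) auto
    next
      assume "b = 0"
      then have "(\<integral>x. u x powr p \<partial>M) \<le> (\<integral>x. v x powr p \<partial>M)"
        using zero[of w v] v w le ap p by (simp add: add.commute)
      then show ?thesis using p unfolding a_def by (intro disjI2 powr_mono2) auto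
    qed
    moreover have "a \<ge> 0" "b \<ge> 0" by (auto simp: a_def b_def)
    ultimately show ?thesis by linarith
  next
    case False
    then have pos: "a > 0" "b > 0" using powr_ge_zero unfolding a_def b_def by (auto simp: less_le)
    define \<theta> where "\<theta> = a / (a + b)"
    have \<theta>: "0 \<le> \<theta>" "\<theta> \<le> 1" "1 - \<theta> = b / (a + b)" using pos by (auto simp: \<theta>_def field_simps)
    have pt: "u x powr p \<le> (a + b) powr p * (\<theta> / a powr p * v x powr p + (1 - \<theta>) / b powr p * w x powr p)" for x
    proof -
      have "\<theta> * (v x / a) = v x / (a + b)" "(1 - \<theta>) * (w x / b) = w x / (a + b)"
        using pos unfolding \<theta>(3) by (auto simp: \<theta>_def)
      then have "v x + w x = (a + b) * (\<theta> * (v x / a) + (1 - \<theta>) * (w x / b))"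
        using pos by (simp flip: add_divide_distrib)
      then have "u x powr p \<le> ((a + b) * (\<theta> * (v x / a) + (1 - \<theta>) * (w x / b))) powr p"
        using nn le[of x] p by (intro powr_mono2) auto
      also have "\<dots> = (a + b) powr p * (\<theta> * (v x / a) + (1 - \<theta>) * (w x / b)) powr p"
        using pos nn \<theta> by (intro powr_mult)
      also have "\<dots> \<le> (a + b) powr p * (\<theta> * (v x / a) powr p + (1 - \<theta>) * (w x / b) powr p)"
        using pos nn \<theta> p by (intro mult_left_mono powr_convex_nonneg) auto
      also have "\<dots> = (a + b) powr p * (\<theta> / a powr p * v x powr p + (1 - \<theta>) / b powr p * w x powr p)"
        using pos nn by (simp add: powr_divide)
      finally show ?thesis .
    qed
    have "(\<integral>x. u x powr p \<partial>M) \<le>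
        (\<integral>x. (a + b) powr p * (\<theta> / a powr p * v x powr p + (1 - \<theta>) / b powr p * w x powr p) \<partial>M)"
      using u v w pt by (intro integral_mono) auto
    also have "\<dots> = (a + b) powr p * (\<theta> / a powr p * a powr p + (1 - \<theta>) / b powr p * b powr p)"
      using v w by (simp add: ap)
    also have "\<dots> = (a + b) powr p" using pos by simp
    finally have "(\<integral>x. u x powr p \<partial>M) powr (1 / p) \<le> ((a + b) powr p) powr (1 / p)"
      using p by (intro powr_mono2) auto
    then show ?thesis using p pos by (simp add: powr_powr)
  qed
  then show ?thesis by (simp add: a_def b_def)
qed

section \<open>The modulus as a norm on coefficients\<close>

lemma coefficient_linear:
  "coefficient (\<lambda>\<xi>. a * f \<xi> + b * g \<xi>) \<alpha> = a * coefficient f \<alpha> + b * coefficient g \<alpha>"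
  "coefficient (\<lambda>\<xi>. f \<xi> - g \<xi>) \<alpha> = coefficient f \<alpha> - coefficient g \<alpha>"
  by (simp_all add: coefficient_def)

lemma modulus_eq_L2_set: "modulus k f = L2_set (coefficient f) (multi_indices k)"
  by (simp add: modulus_def L2_set_def)

lemma modulus_nonneg: "modulus k f \<ge> 0"
  by (simp add: modulus_eq_L2_set)

lemma coefficient_le_modulus:
  "\<alpha> \<in> multi_indices k \<Longrightarrow> \<bar>coefficient f \<alpha>\<bar> \<le> modulus k f"
proof -
  assume \<alpha>: "\<alpha> \<in> multi_indices k"
  have "sqrt ((coefficient f \<alpha>)\<^sup>2) \<le> modulus k f"
    unfolding modulus_def
    by (intro real_sqrt_le_mono member_le_sum \<alpha> finite_multi_indices) auto
  then show ?thesis by simp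
qed

lemma modulus_le_sum: "modulus k f \<le> (\<Sum>\<alpha>\<in>multi_indices k. \<bar>coefficient f \<alpha>\<bar>)"
  unfolding modulus_eq_L2_set by (rule L2_set_le_sum_abs)

lemma modulus_eq_0_iff: "modulus k f = 0 \<longleftrightarrow> (\<forall>\<alpha>\<in>multi_indices k. coefficient f \<alpha> = 0)"
  unfolding modulus_eq_L2_set by (rule L2_set_eq_0_iff[OF finite_multi_indices])

lemma modulus_lincomb:
  "modulus k (\<lambda>\<xi>. a * f \<xi> + b * g \<xi>) \<le> \<bar>a\<bar> * modulus k f + \<bar>b\<bar> * modulus k g"
proof -
  have scale: "L2_set (\<lambda>\<alpha>. c * coefficient h \<alpha>) (multi_indices k) = \<bar>c\<bar> * modulus k h"
    for c and h :: "(real, 'a) vec list \<Rightarrow> real"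
    by (simp add: L2_set_def modulus_def power_mult_distrib real_sqrt_mult flip: sum_distrib_left)
  have "modulus k (\<lambda>\<xi>. a * f \<xi> + b * g \<xi>)
      = L2_set (\<lambda>\<alpha>. a * coefficient f \<alpha> + b * coefficient g \<alpha>) (multi_indices k)"
    unfolding modulus_eq_L2_set by (intro L2_set_cong refl coefficient_linear)
  also have "\<dots> \<le> L2_set (\<lambda>\<alpha>. a * coefficient f \<alpha>) (multi_indices k)
      + L2_set (\<lambda>\<alpha>. b * coefficient g \<alpha>) (multi_indices k)"
    by (rule L2_set_triangle_ineq)
  finally show ?thesis by (simp add: scale)
qed

lemma modulus_minus_commute: "modulus k (\<lambda>\<xi>. f \<xi> - g \<xi>) = modulus k (\<lambda>\<xi>. g \<xi> - f \<xi>)"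
  by (simp add: modulus_def coefficient_linear power2_commute)

lemma modulus_diff_triangle:
  "modulus k (\<lambda>\<xi>. f \<xi> - h \<xi>) \<le> modulus k (\<lambda>\<xi>. f \<xi> - g \<xi>) + modulus k (\<lambda>\<xi>. g \<xi> - h \<xi>)"
  using modulus_lincomb[of k 1 "\<lambda>\<xi>. f \<xi> - g \<xi>" 1 "\<lambda>\<xi>. g \<xi> - h \<xi>"] by simp

lemma alternating_form_lincomb:
  assumes "alternating_form k f" "alternating_form k g"
  shows "alternating_form k (\<lambda>\<xi>. a * f \<xi> + b * g \<xi>)"
proof -
  have "linear (\<lambda>v. a * f (\<xi>[i := v]) + b * g (\<xi>[i := v]))" if "length \<xi> = k" "i < k" for \<xi> i
  proof -
    have "linear (\<lambda>v. f (\<xi>[i := v]))" "linear (\<lambda>v. g (\<xi>[i := v]))"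
      using assms that unfolding alternating_form_def by auto
    then show ?thesis
      using linear_compose_add[OF linear_compose_scale_right linear_compose_scale_right,
          of "\<lambda>v. f (\<xi>[i := v])" "\<lambda>v. g (\<xi>[i := v])" a b] by simp
  qed
  then show ?thesis using assms unfolding alternating_form_def by auto
qed

lemma modulus_measurable:
  assumes "\<And>\<alpha>. \<alpha> \<in> multi_indices k \<Longrightarrow> (\<lambda>x. coefficient (\<omega> x) \<alpha>) \<in> borel_measurable M"
  shows "(\<lambda>x. modulus k (\<omega> x)) \<in> borel_measurable M"
proof -
  have "(\<lambda>x. \<Sum>\<alpha>\<in>multi_indices k. (coefficient (\<omega> x) \<alpha>)\<^sup>2) \<in> borel_measurable M"
    by (intro borel_measurable_sum borel_measurable_power assms)
  then show ?thesis
    unfolding modulus_def by measurable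
qed

lemma formsD:
  assumes "\<omega> \<in> forms k p D"
  shows "AE x in lebesgue_on D. alternating_form k (\<omega> x)"
    and "\<And>\<alpha>. \<alpha> \<in> multi_indices k \<Longrightarrow> (\<lambda>x. coefficient (\<omega> x) \<alpha>) \<in> borel_measurable (lebesgue_on D)"
    and "integrable (lebesgue_on D) (\<lambda>x. modulus k (\<omega> x) powr p)"
    and "(\<lambda>x. modulus k (\<omega> x)) \<in> borel_measurable (lebesgue_on D)"
  using assms modulus_measurable[of k \<omega> "lebesgue_on D"] by (auto simp: forms_def)

lemma forms_lincomb:
  assumes \<omega>: "\<omega> \<in> forms k p D" and \<eta>: "\<eta> \<in> forms k p D" and p: "p \<ge> 0"
  shows "(\<lambda>x \<xi>. a * \<omega> x \<xi> + b * \<eta> x \<xi>) \<in> forms k p D"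
proof -
  have alt: "AE x in lebesgue_on D. alternating_form k (\<lambda>\<xi>. a * \<omega> x \<xi> + b * \<eta> x \<xi>)"
    using formsD(1)[OF \<omega>] formsD(1)[OF \<eta>] by eventually_elim (rule alternating_form_lincomb)
  have meas: "(\<lambda>x. coefficient (\<lambda>\<xi>. a * \<omega> x \<xi> + b * \<eta> x \<xi>) \<alpha>) \<in> borel_measurable (lebesgue_on D)"
    if "\<alpha> \<in> multi_indices k" for \<alpha>
    unfolding coefficient_linear using formsD(2)[OF \<omega> that] formsD(2)[OF \<eta> that] by measurable
  have le: "modulus k (\<lambda>\<xi>. a * \<omega> x \<xi> + b * \<eta> x \<xi>) powr p
      \<le> 2 powr p * (\<bar>a\<bar> powr p * modulus k (\<omega> x) powr p + \<bar>b\<bar> powr p * modulus k (\<eta> x) powr p)" for x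
  proof -
    have "modulus k (\<lambda>\<xi>. a * \<omega> x \<xi> + b * \<eta> x \<xi>) powr p
        \<le> (\<bar>a\<bar> * modulus k (\<omega> x) + \<bar>b\<bar> * modulus k (\<eta> x)) powr p"
      using p modulus_nonneg modulus_lincomb by (intro powr_mono2) auto
    also have "\<dots> \<le> 2 powr p * ((\<bar>a\<bar> * modulus k (\<omega> x)) powr p + (\<bar>b\<bar> * modulus k (\<eta> x)) powr p)"
      using p by (intro powr_add_le) (auto simp: modulus_nonneg)
    finally show ?thesis by (simp add: powr_mult modulus_nonneg)
  qed
  have "integrable (lebesgue_on D) (\<lambda>x. modulus k (\<lambda>\<xi>. a * \<omega> x \<xi> + b * \<eta> x \<xi>) powr p)"
  proof (rule Bochner_Integration.integrable_bound)
    show "integrable (lebesgue_on D) (\<lambda>x. 2 powr p * (\<bar>a\<bar> powr p * modulus k (\<omega> x) powr p + \<bar>b\<bar> powr p * modulus k (\<eta> x) powr p))"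
      using formsD(3)[OF \<omega>] formsD(3)[OF \<eta>] by auto
    show "(\<lambda>x. modulus k (\<lambda>\<xi>. a * \<omega> x \<xi> + b * \<eta> x \<xi>) powr p) \<in> borel_measurable (lebesgue_on D)"
      using modulus_measurable[OF meas] by measurable
    show "AE x in lebesgue_on D. norm (modulus k (\<lambda>\<xi>. a * \<omega> x \<xi> + b * \<eta> x \<xi>) powr p)
        \<le> norm (2 powr p * (\<bar>a\<bar> powr p * modulus k (\<omega> x) powr p + \<bar>b\<bar> powr p * modulus k (\<eta> x) powr p))"
      unfolding real_norm_def abs_of_nonneg[OF powr_ge_zero] by (intro AE_I2 order_trans[OF le abs_ge_self])
  qed
  then show ?thesis using alt meas by (auto simp: forms_def)
qed

lemma forms_diff:
  assumes "\<omega> \<in> forms k p D" "\<eta> \<in> forms k p D" "p \<ge> 0"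
  shows "(\<lambda>x \<xi>. \<omega> x \<xi> - \<eta> x \<xi>) \<in> forms k p D"
  using forms_lincomb[OF assms, of 1 "- 1"] by simp

section \<open>Equality almost everywhere and the metric on classes\<close>

lemma form_eq_refl: "form_eq k D \<omega> \<omega>"
  by (simp add: form_eq_def)

lemma form_eq_sym: "form_eq k D \<omega> \<eta> \<Longrightarrow> form_eq k D \<eta> \<omega>"
  unfolding form_eq_def by (erule eventually_mono) simp

lemma form_eq_trans: "form_eq k D \<omega> \<eta> \<Longrightarrow> form_eq k D \<eta> \<zeta> \<Longrightarrow> form_eq k D \<omega> \<zeta>"
  unfolding form_eq_def by (erule (1) eventually_elim2) simp

lemma form_class_eq_iff:
  assumes "\<omega> \<in> forms k p D" "\<eta> \<in> forms k p D"
  shows "form_class k p D \<omega> = form_class k p D \<eta> \<longleftrightarrow> form_eq k D \<omega> \<eta>"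
  using assms form_eq_refl form_eq_sym form_eq_trans unfolding form_class_def by blast

text \<open>The choice made inside \<open>Omega_dist\<close>, given a name so that it can be
  reasoned about.\<close>

definition rep :: "'a set \<Rightarrow> 'a" where
  "rep X = (SOME \<omega>. \<omega> \<in> X)"

lemma rep_form_class:
  assumes "\<omega> \<in> forms k p D"
  shows "rep (form_class k p D \<omega>) \<in> forms k p D" "form_eq k D \<omega> (rep (form_class k p D \<omega>))"
proof -
  have "\<omega> \<in> form_class k p D \<omega>" using assms form_eq_refl by (auto simp: form_class_def)
  then have "rep (form_class k p D \<omega>) \<in> form_class k p D \<omega>" 
    unfolding rep_def using someI[of "\<lambda>\<eta>. \<eta> \<in> form_class k p D \<omega>" \<omega>] by simp
  then show "rep (form_class k p D \<omega>) \<in> forms k p D" "form_eq k D \<omega> (rep (form_class k p D \<omega>))"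
    by (auto simp: form_class_def)
qed

lemma Omega_rep:
  assumes "X \<in> Omega k p D"
  shows "rep X \<in> forms k p D" "X = form_class k p D (rep X)"
proof -
  obtain \<omega> where \<omega>: "\<omega> \<in> forms k p D" "X = form_class k p D \<omega>" using assms by (auto simp: Omega_def)
  show "rep X \<in> forms k p D" using rep_form_class \<omega> by simp
  then show "X = form_class k p D (rep X)"
    using rep_form_class[OF \<omega>(1)] \<omega> form_class_eq_iff by metis
qed

lemma Omega_dist_rep:
  "Omega_dist k p D X Y = form_norm k p D (\<lambda>x \<xi>. rep X x \<xi> - rep Y x \<xi>)"
  by (simp add: Omega_dist_def rep_def)

lemma form_norm_cong:
  assumes "\<omega> \<in> forms k p D" "\<eta> \<in> forms k p D" "form_eq k D \<omega> \<eta>"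
  shows "form_norm k p D \<omega> = form_norm k p D \<eta>"
proof -
  have "AE x in lebesgue_on D. modulus k (\<omega> x) powr p = modulus k (\<eta> x) powr p"
    using assms(3) unfolding form_eq_def
    by eventually_elim (auto simp: modulus_def coefficient_def multi_indices_def intro!: sum.cong arg_cong[of _ _ "\<lambda>t. sqrt t powr p"])
  then have "(LINT x|lebesgue_on D. modulus k (\<omega> x) powr p) = (LINT x|lebesgue_on D. modulus k (\<eta> x) powr p)"
    using formsD(3)[OF assms(1)] formsD(3)[OF assms(2)]
    by (intro integral_cong_AE) (auto dest: borel_measurable_integrable)
  then show ?thesis by (simp add: form_norm_def)
qed

lemma form_norm_nonneg: "form_norm k p D \<omega> \<ge> 0"
  by (simp add: form_norm_def)

lemma form_norm_powr:
  assumes "p > 0"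
  shows "form_norm k p D \<omega> powr p = (LINT x|lebesgue_on D. modulus k (\<omega> x) powr p)"
  using assms by (simp add: form_norm_def powr_powr)

lemma form_norm_minus_commute:
  "form_norm k p D (\<lambda>x \<xi>. \<omega> x \<xi> - \<eta> x \<xi>) = form_norm k p D (\<lambda>x \<xi>. \<eta> x \<xi> - \<omega> x \<xi>)"
  unfolding form_norm_def by (subst modulus_minus_commute) simp

lemma form_norm_diff_triangle:
  assumes "\<omega> \<in> forms k p D" "\<eta> \<in> forms k p D" "\<zeta> \<in> forms k p D" and p: "p \<ge> 1"
  shows "form_norm k p D (\<lambda>x \<xi>. \<omega> x \<xi> - \<zeta> x \<xi>)
    \<le> form_norm k p D (\<lambda>x \<xi>. \<omega> x \<xi> - \<eta> x \<xi>) + form_norm k p D (\<lambda>x \<xi>. \<eta> x \<xi> - \<zeta> x \<xi>)"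
  unfolding form_norm_def
  using p by (intro Minkowski_inequality_powr modulus_nonneg modulus_diff_triangle
      formsD(3)[OF forms_diff] assms) auto

text \<open>The norm sees only coefficients at increasing multi-indices. Almost everywhere both
  forms are alternating, and there these coefficients determine the values on all lists of length
  \<open>k\<close>.\<close>

lemma form_norm_eq_0_imp:
  assumes \<omega>: "\<omega> \<in> forms k p D" and \<eta>: "\<eta> \<in> forms k p D" and p: "p > 0"
    and 0: "form_norm k p D (\<lambda>x \<xi>. \<omega> x \<xi> - \<eta> x \<xi>) = 0"
  shows "form_eq k D \<omega> \<eta>"
proof -
  have "(LINT x|lebesgue_on D. modulus k (\<lambda>\<xi>. \<omega> x \<xi> - \<eta> x \<xi>) powr p) = 0"
    using 0 form_norm_powr[OF p, of k D "\<lambda>x \<xi>. \<omega> x \<xi> - \<eta> x \<xi>"] p by simp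
  then have "AE x in lebesgue_on D. modulus k (\<lambda>\<xi>. \<omega> x \<xi> - \<eta> x \<xi>) powr p = 0"
    using formsD(3)[OF forms_diff[OF \<omega> \<eta>]] p by (subst (asm) integral_nonneg_eq_0_iff_AE) auto
  with formsD(1)[OF \<omega>] formsD(1)[OF \<eta>] show ?thesis
    unfolding form_eq_def
  proof eventually_elim
    case (elim x)
    then have "coefficient (\<omega> x) \<alpha> = coefficient (\<eta> x) \<alpha>" if "\<alpha> \<in> multi_indices k" for \<alpha>
      using that by (simp add: modulus_eq_0_iff coefficient_linear)
    then show ?case
      using elim by (simp add: alternating_form_expansion[of k "\<omega> x"] alternating_form_expansion[of k "\<eta> x"])
  qed
qed

lemma Omega_dist_form_class:
  assumes "\<omega> \<in> forms k p D" "\<eta> \<in> forms k p D" and p: "p \<ge> 0"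
  shows "Omega_dist k p D (form_class k p D \<omega>) (form_class k p D \<eta>) = form_norm k p D (\<lambda>x \<xi>. \<omega> x \<xi> - \<eta> x \<xi>)"
proof -
  note r = rep_form_class[OF assms(1)] rep_form_class[OF assms(2)]
  have "form_eq k D (\<lambda>x \<xi>. rep (form_class k p D \<omega>) x \<xi> - rep (form_class k p D \<eta>) x \<xi>)
      (\<lambda>x \<xi>. \<omega> x \<xi> - \<eta> x \<xi>)"
    using r(2,4) unfolding form_eq_def by eventually_elim simp
  then show ?thesis
    unfolding Omega_dist_rep using r assms by (intro form_norm_cong forms_diff) auto
qed

lemma Metric_space_Omega:
  assumes p: "p \<ge> 1"
  shows "Metric_space (Omega k p D) (Omega_dist k p D)"
proof
  show "0 \<le> Omega_dist k p D X Y" for X Y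
    by (simp add: Omega_dist_rep form_norm_nonneg)
  show "Omega_dist k p D X Y = Omega_dist k p D Y X" for X Y
    unfolding Omega_dist_rep by (rule form_norm_minus_commute)
next
  fix X Y assume X: "X \<in> Omega k p D" and Y: "Y \<in> Omega k p D"
  show "Omega_dist k p D X Y = 0 \<longleftrightarrow> X = Y"
  proof
    assume "Omega_dist k p D X Y = 0"
    then have "form_eq k D (rep X) (rep Y)"
      using form_norm_eq_0_imp[OF Omega_rep(1)[OF X] Omega_rep(1)[OF Y]] p by (simp add: Omega_dist_rep)
    then show "X = Y" using Omega_rep[OF X] Omega_rep[OF Y] form_class_eq_iff by metis
  next
    assume "X = Y"
    then show "Omega_dist k p D X Y = 0"
      using p by (simp add: Omega_dist_rep form_norm_def modulus_def coefficient_def)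
  qed
  fix Z assume Z: "Z \<in> Omega k p D"
  show "Omega_dist k p D X Z \<le> Omega_dist k p D X Y + Omega_dist k p D Y Z"
    unfolding Omega_dist_rep by (intro form_norm_diff_triangle Omega_rep(1) X Y Z p)
qed


section \<open>Completeness\<close>

lemma modulus_tendsto:
  assumes "\<And>\<alpha>. \<alpha> \<in> multi_indices k \<Longrightarrow> (\<lambda>j. coefficient (f j) \<alpha>) \<longlonglongrightarrow> coefficient g \<alpha>"
  shows "(\<lambda>j. modulus k (f j)) \<longlonglongrightarrow> modulus k g"
  unfolding modulus_def by (intro tendsto_intros assms)

lemma alternating_form_limit:
  assumes f: "\<And>j. alternating_form k (f j)"
    and lim: "\<And>\<xi>. length \<xi> = k \<Longrightarrow> (\<lambda>j. f j \<xi>) \<longlonglongrightarrow> g \<xi>"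
  shows "alternating_form k g"
  unfolding alternating_form_def
proof (intro allI impI conjI)
  fix \<xi> :: "(real ^ 'a) list" and i assume \<xi>: "length \<xi> = k"
  have lim': "(\<lambda>j. f j (\<xi>[i := v])) \<longlonglongrightarrow> g (\<xi>[i := v])" for v
    using lim[of "\<xi>[i := v]"] \<xi> by simp
  {
    assume "i < k"
    then have lin: "linear (\<lambda>v. f j (\<xi>[i := v]))" for j
      using f[of j] \<xi> unfolding alternating_form_def by simp
    show "linear (\<lambda>v. g (\<xi>[i := v]))"
    proof (rule linearI)
      fix u v c
      have "(\<lambda>j. f j (\<xi>[i := u + v])) \<longlonglongrightarrow> g (\<xi>[i := u]) + g (\<xi>[i := v])"
        unfolding linear_add[OF lin] by (intro tendsto_add lim')
      then show "g (\<xi>[i := u + v]) = g (\<xi>[i := u]) + g (\<xi>[i := v])"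
        using lim' LIMSEQ_unique by blast
      have "(\<lambda>j. f j (\<xi>[i := c *\<^sub>R v])) \<longlonglongrightarrow> c *\<^sub>R g (\<xi>[i := v])"
        unfolding linear_scale[OF lin] by (intro tendsto_scaleR tendsto_const lim')
      then show "g (\<xi>[i := c *\<^sub>R v]) = c *\<^sub>R g (\<xi>[i := v])"
        using lim' LIMSEQ_unique by blast
    qed
  }
  assume "\<not> distinct \<xi>"
  then have "f j \<xi> = 0" for j using f[of j] \<xi> unfolding alternating_form_def by simp
  then show "g \<xi> = 0" using lim[OF \<xi>] LIMSEQ_unique[OF _ tendsto_const] by simp
qed

lemma convergent_if_summable_differences:
  fixes f :: "nat \<Rightarrow> real"
  assumes "summable m" "eventually (\<lambda>j. \<bar>f (Suc j) - f j\<bar> \<le> m j) sequentially"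
  shows "convergent f"
proof -
  have "summable (\<lambda>j. f (Suc j) - f j)"
    by (rule summable_comparison_test_ev[OF _ assms(1)]) (use assms(2) in simp)
  then have "(\<lambda>n. \<Sum>j<n. f (Suc j) - f j) \<longlonglongrightarrow> (\<Sum>j. f (Suc j) - f j)"
    by (rule summable_LIMSEQ)
  then have "(\<lambda>n. f n - f 0) \<longlonglongrightarrow> (\<Sum>j. f (Suc j) - f j)"
    by (simp add: sum_lessThan_telescope)
  then have "(\<lambda>n. f n - f 0 + f 0) \<longlonglongrightarrow> (\<Sum>j. f (Suc j) - f j) + f 0"
    by (intro tendsto_add tendsto_const)
  then show ?thesis by (auto simp: convergent_def)
qed

text \<open>
  The series of the integrals of \<open>(2^j m j)^p\<close> converges, so its terms tend to \<open>0\<close> almost everywhere.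
\<close>

lemma AE_summable_fast_Cauchy:
  fixes m :: "nat \<Rightarrow> 'a \<Rightarrow> real"
  assumes p: "p \<ge> 1" and nn: "\<And>j x. m j x \<ge> 0" and meas [measurable]: "\<And>j. m j \<in> borel_measurable M"
    and int: "\<And>j. integrable M (\<lambda>x. m j x powr p)"
    and le: "\<And>j. (\<integral>x. m j x powr p \<partial>M) \<le> ((1 / 4) ^ j) powr p"
  shows "AE x in M. eventually (\<lambda>j. m j x \<le> (1 / 2) ^ j) sequentially"
proof -
  \<comment> \<open>The factor 2^j uses up half of the decay 4^(-j); the integrals are then at most
    2^(-j) because p \<ge> 1, and still have a finite sum.\<close>
  define h where "h = (\<lambda>j x. ennreal ((2 ^ j * m j x) powr p))"
  have [measurable]: "h j \<in> borel_measurable M" for j unfolding h_def by measurable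
  have "(\<integral>\<^sup>+x. h j x \<partial>M) \<le> ennreal ((1 / 2) ^ j)" for j
  proof -
    have "(\<integral>\<^sup>+x. h j x \<partial>M) = (\<integral>\<^sup>+x. ennreal ((2 ^ j) powr p) * ennreal (m j x powr p) \<partial>M)"
      unfolding h_def by (simp add: powr_mult nn ennreal_mult)
    also have "\<dots> = ennreal ((2 ^ j) powr p) * ennreal (\<integral>x. m j x powr p \<partial>M)"
      by (simp add: nn_integral_cmult nn_integral_eq_integral[OF int])
    also have "\<dots> \<le> ennreal ((2 ^ j) powr p) * ennreal (((1 / 4) ^ j) powr p)"
      by (intro mult_left_mono ennreal_leI le) auto
    also have "\<dots> = ennreal ((2 ^ j * (1 / 4) ^ j) powr p)"
      by (simp add: powr_mult ennreal_mult)
    also have "(2 ^ j * (1 / 4) ^ j :: real) = (1 / 2) ^ j"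
      by (simp flip: power_mult_distrib)
    also have "((1 / 2) ^ j :: real) powr p \<le> ((1 / 2) ^ j) powr 1"
      using p by (intro powr_mono') (auto simp: power_le_one)
    finally show ?thesis by (simp add: ennreal_leI)
  qed
  then have "(\<integral>\<^sup>+x. (\<Sum>j. h j x) \<partial>M) \<le> (\<Sum>j. ennreal ((1 / 2) ^ j))"
    by (subst nn_integral_suminf) (auto intro!: suminf_le summableI)
  also have "\<dots> = ennreal (\<Sum>j. (1 / 2) ^ j)"
    by (intro suminf_ennreal2 summable_geometric) auto
  also have "\<dots> < \<infinity>" by simp
  finally have "AE x in M. (\<Sum>j. h j x) \<noteq> \<infinity>"
    by (intro nn_integral_PInf_AE) auto
  then show ?thesis
  proof eventually_elim
    case (elim x)
    then have "summable (\<lambda>j. (2 ^ j * m j x) powr p)"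
      unfolding h_def by (intro summable_suminf_not_top) (auto simp: nn)
    then have "(\<lambda>j. (2 ^ j * m j x) powr p) \<longlonglongrightarrow> 0" by (rule summable_LIMSEQ_zero)
    then have "eventually (\<lambda>j. (2 ^ j * m j x) powr p < 1) sequentially"
      by (rule order_tendstoD) simp
    then show ?case
    proof eventually_elim
      case (elim j)
      have "2 ^ j * m j x \<le> 1"
      proof (rule ccontr)
        assume "\<not> 2 ^ j * m j x \<le> 1"
        then have "1 \<le> (2 ^ j * m j x) powr p" using p by (intro ge_one_powr_ge_zero) auto
        then show False using elim by simp
      qed
      then show ?case by (simp add: power_divide field_simps)
    qed
  qed
qed

text \<open>The Riesz-Fischer argument: a rapidly Cauchy subsequence converges almost everywhere,
  and Fatou's lemma upgrades this to convergence in norm of the full sequence.\<close>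

lemma forms_complete:
  fixes \<omega> :: "nat \<Rightarrow> real ^ 'n::{finite,linorder} \<Rightarrow> (real, 'n) vec list \<Rightarrow> real"
  assumes p: "p \<ge> 1" and \<omega>: "\<And>n. \<omega> n \<in> forms k p D"
    and Cauchy: "\<And>\<epsilon>. \<epsilon> > 0 \<Longrightarrow> \<exists>N. \<forall>n\<ge>N. \<forall>n'\<ge>N. form_norm k p D (\<lambda>x \<xi>. \<omega> n x \<xi> - \<omega> n' x \<xi>) < \<epsilon>"
  shows "\<exists>\<eta>\<in>forms k p D. \<forall>\<epsilon>>0. \<exists>N. \<forall>n\<ge>N. form_norm k p D (\<lambda>x \<xi>. \<omega> n x \<xi> - \<eta> x \<xi>) \<le> \<epsilon>"
proof -
  let ?M = "lebesgue_on D"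
  have diff: "(\<lambda>x \<xi>. \<omega> n x \<xi> - \<omega> n' x \<xi>) \<in> forms k p D" for n n'
    using p by (intro forms_diff \<omega>) auto
  have "\<forall>j. \<exists>N. \<forall>n\<ge>N. \<forall>n'\<ge>N. form_norm k p D (\<lambda>x \<xi>. \<omega> n x \<xi> - \<omega> n' x \<xi>) < (1 / 4) ^ j"
    using Cauchy by simp
  from choice[OF this] obtain N
    where "\<forall>j. \<forall>n\<ge>N j. \<forall>n'\<ge>N j. form_norm k p D (\<lambda>x \<xi>. \<omega> n x \<xi> - \<omega> n' x \<xi>) < (1 / 4) ^ j"
    by (rule exE)
  then have N: "\<And>j n n'. n \<ge> N j \<Longrightarrow> n' \<ge> N j \<Longrightarrow>
      form_norm k p D (\<lambda>x \<xi>. \<omega> n x \<xi> - \<omega> n' x \<xi>) < (1 / 4) ^ j" by simp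
  \<comment> \<open>The partial sums dominate every \<open>N j\<close> and are monotone; the added
    \<open>j\<close> forces \<open>r j\<close> to tend to infinity.\<close>
  define r where "r j = (\<Sum>i\<le>j. N i) + j" for j
  have r: "r j \<ge> N j" "r j \<ge> j" "r (Suc j) \<ge> r j" for j
    using member_le_sum[of j "{..j}" N] by (auto simp: r_def)
  define m where "m j x = modulus k (\<lambda>\<xi>. \<omega> (r (Suc j)) x \<xi> - \<omega> (r j) x \<xi>)" for j x
  \<comment> \<open>\<open>lim\<close> is total, so each coefficient of \<eta> is a limit of
    measurable functions as it stands, with no correction on the set of divergence.\<close>
  define \<eta> where "\<eta> x \<xi> = lim (\<lambda>j. \<omega> (r j) x \<xi>)" for x \<xi>
  have "AE x in ?M. eventually (\<lambda>j. m j x \<le> (1 / 2) ^ j) sequentially"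
  proof (rule AE_summable_fast_Cauchy[OF p])
    show "m j \<in> borel_measurable ?M" "integrable ?M (\<lambda>x. m j x powr p)" for j
      unfolding m_def[abs_def] using formsD(3,4)[OF diff] by auto
    show "(LINT x|?M. m j x powr p) \<le> ((1 / 4) ^ j) powr p" for j
    proof -
      have "form_norm k p D (\<lambda>x \<xi>. \<omega> (r (Suc j)) x \<xi> - \<omega> (r j) x \<xi>) \<le> (1 / 4) ^ j"
        using N[of j "r (Suc j)" "r j"] r[of j] by simp
      then have "form_norm k p D (\<lambda>x \<xi>. \<omega> (r (Suc j)) x \<xi> - \<omega> (r j) x \<xi>) powr p \<le> ((1 / 4) ^ j) powr p"
        using p by (intro powr_mono2 form_norm_nonneg) auto
      then show ?thesis using p by (simp add: form_norm_powr m_def)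
    qed
  qed (simp add: m_def modulus_nonneg)
  moreover have "AE x in ?M. \<forall>n. alternating_form k (\<omega> n x)"
    using formsD(1)[OF \<omega>] by (simp add: AE_all_countable)
  ultimately have lim: "AE x in ?M. (\<forall>n. alternating_form k (\<omega> n x)) \<and>
      (\<forall>\<xi>. length \<xi> = k \<longrightarrow> (\<lambda>j. \<omega> (r j) x \<xi>) \<longlonglongrightarrow> \<eta> x \<xi>)"
  proof eventually_elim
    case (elim x)
    have "convergent (\<lambda>j. coefficient (\<omega> (r j) x) \<alpha>)" if \<alpha>: "\<alpha> \<in> multi_indices k" for \<alpha>
    proof (rule convergent_if_summable_differences)
      show "summable (\<lambda>j. (1 / 2 :: real) ^ j)" by (simp add: summable_geometric)
      show "eventually (\<lambda>j. \<bar>coefficient (\<omega> (r (Suc j)) x) \<alpha> - coefficient (\<omega> (r j) x) \<alpha>\<bar> \<le> (1 / 2) ^ j) sequentially"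
        using elim(1)
      proof eventually_elim
        case (elim j)
        then show ?case
          using coefficient_le_modulus[OF \<alpha>, of "\<lambda>\<xi>. \<omega> (r (Suc j)) x \<xi> - \<omega> (r j) x \<xi>"]
          by (simp add: m_def coefficient_linear)
      qed
    qed
    \<comment> \<open>Convergence of the finitely many coefficients at \<open>x\<close> passes to
      every list of arguments, as the expansion scalars do not depend on \<open>j\<close>.\<close>
    then have "convergent (\<lambda>j. \<Sum>\<alpha>\<in>multi_indices k. expansion_coefficient k \<xi> \<alpha> * coefficient (\<omega> (r j) x) \<alpha>)" for \<xi>
      by (intro convergent_sum convergent_mult convergent_const) auto
    then have "convergent (\<lambda>j. \<omega> (r j) x \<xi>)" if "length \<xi> = k" for \<xi>
      using that elim(2) by (simp add: alternating_form_expansion[where k = k])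
    then show ?case using elim(2) by (simp add: \<eta>_def convergent_LIMSEQ_iff)
  qed
  have coef_lim: "AE x in ?M. \<forall>\<alpha>\<in>multi_indices k. (\<lambda>j. coefficient (\<omega> (r j) x) \<alpha>) \<longlonglongrightarrow> coefficient (\<eta> x) \<alpha>"
    using lim by eventually_elim (simp add: coefficient_def multi_indices_def)
  have \<eta>_alt: "AE x in ?M. alternating_form k (\<eta> x)"
    using lim by eventually_elim (auto intro: alternating_form_limit)
  have \<eta>_meas: "(\<lambda>x. coefficient (\<eta> x) \<alpha>) \<in> borel_measurable ?M" if "\<alpha> \<in> multi_indices k" for \<alpha>
  proof -
    have "(\<lambda>x. coefficient (\<eta> x) \<alpha>) = (\<lambda>x. lim (\<lambda>j. coefficient (\<omega> (r j) x) \<alpha>))"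
      by (simp add: coefficient_def \<eta>_def)
    then show ?thesis using formsD(2)[OF \<omega> that] by simp
  qed
  \<comment> \<open>With \<open>n\<close> fixed, Fatou along the subsequence bounds the distance to
    the limit and shows that the difference is a form with integrable p-th power. Membership of
    \<eta> follows by subtracting such a difference from one \<omega> n.\<close>
  have Fatou: "(\<lambda>x \<xi>. \<omega> n x \<xi> - \<eta> x \<xi>) \<in> forms k p D \<and> form_norm k p D (\<lambda>x \<xi>. \<omega> n x \<xi> - \<eta> x \<xi>) \<le> \<epsilon>"
    if \<epsilon>: "\<epsilon> > 0" and n: "\<And>n'. n' \<ge> n0 \<Longrightarrow> form_norm k p D (\<lambda>x \<xi>. \<omega> n x \<xi> - \<omega> n' x \<xi>) < \<epsilon>" for n n0 \<epsilon>
  proof -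
    have meas: "(\<lambda>x. coefficient (\<lambda>\<xi>. \<omega> n x \<xi> - \<eta> x \<xi>) \<alpha>) \<in> borel_measurable ?M" if "\<alpha> \<in> multi_indices k" for \<alpha>
      unfolding coefficient_linear using \<eta>_meas[OF that] formsD(2)[OF \<omega> that] by measurable
    have [measurable]: "(\<lambda>x. modulus k (\<lambda>\<xi>. \<omega> n x \<xi> - \<eta> x \<xi>)) \<in> borel_measurable ?M"
      by (rule modulus_measurable[OF meas])
    have "(\<integral>\<^sup>+x. ennreal (modulus k (\<lambda>\<xi>. \<omega> n x \<xi> - \<eta> x \<xi>) powr p) \<partial>?M)
        = (\<integral>\<^sup>+x. liminf (\<lambda>j. ennreal (modulus k (\<lambda>\<xi>. \<omega> n x \<xi> - \<omega> (r j) x \<xi>) powr p)) \<partial>?M)"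
    proof (rule nn_integral_cong_AE, use coef_lim in eventually_elim)
      fix x assume "\<forall>\<alpha>\<in>multi_indices k. (\<lambda>j. coefficient (\<omega> (r j) x) \<alpha>) \<longlonglongrightarrow> coefficient (\<eta> x) \<alpha>"
      then have "(\<lambda>j. modulus k (\<lambda>\<xi>. \<omega> n x \<xi> - \<omega> (r j) x \<xi>)) \<longlonglongrightarrow> modulus k (\<lambda>\<xi>. \<omega> n x \<xi> - \<eta> x \<xi>)"
        by (intro modulus_tendsto) (auto simp: coefficient_linear intro!: tendsto_diff)
      then have "(\<lambda>j. ennreal (modulus k (\<lambda>\<xi>. \<omega> n x \<xi> - \<omega> (r j) x \<xi>) powr p))
          \<longlonglongrightarrow> ennreal (modulus k (\<lambda>\<xi>. \<omega> n x \<xi> - \<eta> x \<xi>) powr p)"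
        using p by (intro tendsto_ennrealI tendsto_powr' tendsto_const) (auto simp: modulus_nonneg)
      then show "ennreal (modulus k (\<lambda>\<xi>. \<omega> n x \<xi> - \<eta> x \<xi>) powr p)
          = liminf (\<lambda>j. ennreal (modulus k (\<lambda>\<xi>. \<omega> n x \<xi> - \<omega> (r j) x \<xi>) powr p))"
        by (intro lim_imp_Liminf[symmetric]) auto
    qed
    also have "\<dots> \<le> liminf (\<lambda>j. \<integral>\<^sup>+x. ennreal (modulus k (\<lambda>\<xi>. \<omega> n x \<xi> - \<omega> (r j) x \<xi>) powr p) \<partial>?M)"
      using formsD(4)[OF diff] by (intro nn_integral_liminf) measurable
    also have "\<dots> \<le> limsup (\<lambda>j. \<integral>\<^sup>+x. ennreal (modulus k (\<lambda>\<xi>. \<omega> n x \<xi> - \<omega> (r j) x \<xi>) powr p) \<partial>?M)"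
      by (intro Liminf_le_Limsup) auto
    also have "\<dots> \<le> ennreal (\<epsilon> powr p)"
    proof (rule Limsup_bounded, rule eventually_sequentiallyI)
      fix j assume "j \<ge> n0"
      then have "form_norm k p D (\<lambda>x \<xi>. \<omega> n x \<xi> - \<omega> (r j) x \<xi>) \<le> \<epsilon>"
        using n[of "r j"] r(2)[of j] by simp
      then have "form_norm k p D (\<lambda>x \<xi>. \<omega> n x \<xi> - \<omega> (r j) x \<xi>) powr p \<le> \<epsilon> powr p"
        using p by (intro powr_mono2 form_norm_nonneg) auto
      then show "(\<integral>\<^sup>+x. ennreal (modulus k (\<lambda>\<xi>. \<omega> n x \<xi> - \<omega> (r j) x \<xi>) powr p) \<partial>?M) \<le> ennreal (\<epsilon> powr p)"
        using p by (subst nn_integral_eq_integral[OF formsD(3)[OF diff]]) (auto simp: form_norm_powr intro!: ennreal_leI)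
    qed
    finally have le: "(\<integral>\<^sup>+x. ennreal (modulus k (\<lambda>\<xi>. \<omega> n x \<xi> - \<eta> x \<xi>) powr p) \<partial>?M) \<le> ennreal (\<epsilon> powr p)" .
    have int: "integrable ?M (\<lambda>x. modulus k (\<lambda>\<xi>. \<omega> n x \<xi> - \<eta> x \<xi>) powr p)"
      using le by (intro integrableI_bounded) (auto intro: le_less_trans)
    have alt: "AE x in ?M. alternating_form k (\<lambda>\<xi>. \<omega> n x \<xi> - \<eta> x \<xi>)"
      using formsD(1)[OF \<omega>[of n]] \<eta>_alt
    proof eventually_elim
      case (elim x)
      then show ?case using alternating_form_lincomb[of k "\<omega> n x" "\<eta> x" 1 "- 1"] by simp
    qed
    have "(LINT x|?M. modulus k (\<lambda>\<xi>. \<omega> n x \<xi> - \<eta> x \<xi>) powr p) \<le> \<epsilon> powr p"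
      using le by (subst (asm) nn_integral_eq_integral[OF int]) auto
    then have "form_norm k p D (\<lambda>x \<xi>. \<omega> n x \<xi> - \<eta> x \<xi>) \<le> (\<epsilon> powr p) powr (1 / p)"
      unfolding form_norm_def using p by (intro powr_mono2) auto
    then show ?thesis using int alt meas p \<epsilon> by (auto simp: forms_def powr_powr)
  qed
  obtain n0 where "\<And>n n'. n \<ge> n0 \<Longrightarrow> n' \<ge> n0 \<Longrightarrow> form_norm k p D (\<lambda>x \<xi>. \<omega> n x \<xi> - \<omega> n' x \<xi>) < 1"
    using Cauchy[of 1] by auto
  then have "(\<lambda>x \<xi>. \<omega> n0 x \<xi> - \<eta> x \<xi>) \<in> forms k p D" using Fatou[of 1 n0 n0] by auto
  from forms_diff[OF \<omega>[of n0] this] have "\<eta> \<in> forms k p D" using p by simp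
  moreover have "\<exists>N. \<forall>n\<ge>N. form_norm k p D (\<lambda>x \<xi>. \<omega> n x \<xi> - \<eta> x \<xi>) \<le> \<epsilon>" if "\<epsilon> > 0" for \<epsilon>
    using Cauchy[OF that] Fatou[OF that] by meson
  ultimately show ?thesis by blast
qed

lemma mcomplete_Omega:
  assumes p: "p \<ge> 1"
  shows "Metric_space.mcomplete (Omega k p D) (Omega_dist k p D)"
proof -
  interpret Metric_space "Omega k p D" "Omega_dist k p D" by (rule Metric_space_Omega[OF p])
  show ?thesis
    unfolding mcomplete_def
  proof (intro allI impI)
    fix \<sigma> assume \<sigma>: "MCauchy \<sigma>"
    then have \<sigma>M: "\<sigma> n \<in> Omega k p D" for n unfolding MCauchy_def by auto
    have "\<exists>\<eta>\<in>forms k p D. \<forall>\<epsilon>>0. \<exists>N. \<forall>n\<ge>N. form_norm k p D (\<lambda>x \<xi>. rep (\<sigma> n) x \<xi> - \<eta> x \<xi>) \<le> \<epsilon>"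
    proof (rule forms_complete[OF p])
      show "rep (\<sigma> n) \<in> forms k p D" for n by (rule Omega_rep[OF \<sigma>M])
      show "\<exists>N. \<forall>n\<ge>N. \<forall>n'\<ge>N. form_norm k p D (\<lambda>x \<xi>. rep (\<sigma> n) x \<xi> - rep (\<sigma> n') x \<xi>) < \<epsilon>" if "\<epsilon> > 0" for \<epsilon>
        using \<sigma>[unfolded MCauchy_def, THEN conjunct2, rule_format, OF that]
        unfolding Omega_dist_rep[symmetric] by auto
    qed
    then obtain \<eta> where \<eta>: "\<eta> \<in> forms k p D"
      and lim: "\<And>\<epsilon>. \<epsilon> > 0 \<Longrightarrow> \<exists>N. \<forall>n\<ge>N. form_norm k p D (\<lambda>x \<xi>. rep (\<sigma> n) x \<xi> - \<eta> x \<xi>) \<le> \<epsilon>" by blast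
    have dist: "Omega_dist k p D (\<sigma> n) (form_class k p D \<eta>) = form_norm k p D (\<lambda>x \<xi>. rep (\<sigma> n) x \<xi> - \<eta> x \<xi>)" for n
      using Omega_dist_form_class[OF Omega_rep(1)[OF \<sigma>M] \<eta>, of n] Omega_rep(2)[OF \<sigma>M, of n] p by simp
    have "limitin mtopology \<sigma> (form_class k p D \<eta>) sequentially"
      unfolding limitin_metric
    proof (intro conjI allI impI)
      show "form_class k p D \<eta> \<in> Omega k p D" using \<eta> by (simp add: Omega_def)
      fix \<epsilon> :: real assume "\<epsilon> > 0"
      then obtain N where "\<forall>n\<ge>N. form_norm k p D (\<lambda>x \<xi>. rep (\<sigma> n) x \<xi> - \<eta> x \<xi>) \<le> \<epsilon> / 2"
        using lim[of "\<epsilon> / 2"] by auto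
      then show "eventually (\<lambda>n. \<sigma> n \<in> Omega k p D \<and> Omega_dist k p D (\<sigma> n) (form_class k p D \<eta>) < \<epsilon>) sequentially"
        using \<sigma>M \<open>\<epsilon> > 0\<close> unfolding dist by (intro eventually_sequentiallyI[of N]) force
    qed
    then show "\<exists>x. limitin mtopology \<sigma> x sequentially" ..
  qed
qed

subsection \<open>The homotopy operator\<close>

text \<open>Completeness of Lebesgue measure. It is needed because the integrands and the
  coefficients of the operator agree with manifestly measurable functions only almost
  everywhere.\<close>

lemma lebesgue_on_measurable_cong_AE:
  fixes f g :: "'a::euclidean_space \<Rightarrow> real"
  assumes f: "f \<in> borel_measurable (lebesgue_on D)" and D: "D \<in> sets borel"
    and fg: "AE x in lebesgue_on D. f x = g x"
  shows "g \<in> borel_measurable (lebesgue_on D)"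
proof (rule measurableI)
  have D': "D \<in> sets lebesgue" using D by simp
  fix S :: "real set" assume S: "S \<in> sets borel"
  have "f -` S \<inter> space (lebesgue_on D) \<in> sets (lebesgue_on D)"
    using f S by (rule measurable_sets)
  then have A: "f -` S \<inter> D \<in> sets lebesgue"
    using D' by (simp add: sets_restrict_space_iff)
  have "AE x in lebesgue. x \<in> f -` S \<inter> D \<longleftrightarrow> x \<in> g -` S \<inter> D"
    using fg D' by (subst (asm) AE_restrict_space_iff) (auto elim!: eventually_mono)
  then have "g -` S \<inter> D \<in> sets lebesgue"
    using A by (rule completion.in_sets_AE) simp
  then show "g -` S \<inter> space (lebesgue_on D) \<in> sets (lebesgue_on D)"
    using D' by (simp add: sets_restrict_space_iff)
qed simp

lemma sum_powr_le:
  fixes a :: "'a \<Rightarrow> real"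
  assumes "finite S" "\<And>s. s \<in> S \<Longrightarrow> a s \<ge> 0" "q \<ge> 0"
  shows "(\<Sum>s\<in>S. a s) powr q \<le> real (card S) powr q * (\<Sum>s\<in>S. a s powr q)"
proof (cases "S = {}")
  case False
  have "Max (a ` S) \<in> a ` S" using assms(1) False by (intro Max_in) auto
  then obtain t where t: "t \<in> S" "Max (a ` S) = a t" by auto
  have "(\<Sum>s\<in>S. a s) \<le> real (card S) * a t"
    using assms(1) by (intro sum_bounded_above) (auto simp flip: t(2))
  then have "(\<Sum>s\<in>S. a s) powr q \<le> (real (card S) * a t) powr q"
    using assms by (intro powr_mono2 sum_nonneg) auto
  also have "\<dots> = real (card S) powr q * a t powr q"
    using assms(2)[OF t(1)] by (simp add: powr_mult)
  also have "\<dots> \<le> real (card S) powr q * (\<Sum>s\<in>S. a s powr q)"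
    using assms(1) t(1) by (intro mult_left_mono member_le_sum) auto
  finally show ?thesis .
qed simp

text \<open>Pigeonhole: rounding each \<Lambda> i X / \<rho> i down to an integer produces finitely
  many integer vectors. One member of \<open>B\<close> is kept for each vector that occurs; equal
  floors mean values at distance at most \<rho> i.\<close>

lemma finite_cells:
  fixes \<Lambda> :: "'i \<Rightarrow> 'x \<Rightarrow> real"
  assumes I: "finite I" and \<rho>: "\<And>i. i \<in> I \<Longrightarrow> \<rho> i > 0"
    and bdd: "\<And>i. i \<in> I \<Longrightarrow> \<exists>M. \<forall>X\<in>B. \<bar>\<Lambda> i X\<bar> \<le> M"
  shows "\<exists>B'\<subseteq>B. finite B' \<and> (\<forall>X\<in>B. \<exists>Y\<in>B'. \<forall>i\<in>I. \<bar>\<Lambda> i X - \<Lambda> i Y\<bar> \<le> \<rho> i)"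
proof -
  define c where "c X = (\<lambda>i\<in>I. \<lfloor>\<Lambda> i X / \<rho> i\<rfloor>)" for X
  obtain M where M: "\<And>i X. i \<in> I \<Longrightarrow> X \<in> B \<Longrightarrow> \<bar>\<Lambda> i X\<bar> \<le> M i" using bdd by metis
  have "c ` B \<subseteq> PiE I (\<lambda>i. {\<lfloor>- M i / \<rho> i\<rfloor>..\<lfloor>M i / \<rho> i\<rfloor>})"
  proof
    fix y assume "y \<in> c ` B"
    then obtain X where X: "X \<in> B" "y = c X" by auto
    have "\<lfloor>- M i / \<rho> i\<rfloor> \<le> \<lfloor>\<Lambda> i X / \<rho> i\<rfloor> \<and> \<lfloor>\<Lambda> i X / \<rho> i\<rfloor> \<le> \<lfloor>M i / \<rho> i\<rfloor>" if "i \<in> I" for i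
      using M[OF that X(1)] \<rho>[OF that] by (intro conjI floor_mono divide_right_mono) auto
    then show "y \<in> PiE I (\<lambda>i. {\<lfloor>- M i / \<rho> i\<rfloor>..\<lfloor>M i / \<rho> i\<rfloor>})" using X by (auto simp: c_def)
  qed
  then have "finite (c ` B)" by (rule finite_subset) (use I in \<open>auto intro: finite_PiE\<close>)
  then obtain B' where B': "B' \<subseteq> B" "finite B'" "c ` B = c ` B'"
    using finite_subset_image[of "c ` B" c B] by blast
  have "\<exists>Y\<in>B'. \<forall>i\<in>I. \<bar>\<Lambda> i X - \<Lambda> i Y\<bar> \<le> \<rho> i" if X: "X \<in> B" for X
  proof -
    have "c X \<in> c ` B'" using X B'(3) by blast
    then obtain Y where Y: "Y \<in> B'" "c X = c Y" by auto
    have "\<bar>\<Lambda> i X - \<Lambda> i Y\<bar> \<le> \<rho> i" if i: "i \<in> I" for i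
    proof -
      have "\<lfloor>\<Lambda> i X / \<rho> i\<rfloor> = \<lfloor>\<Lambda> i Y / \<rho> i\<rfloor>" using fun_cong[OF Y(2), of i] i by (simp add: c_def)
      then have "\<bar>\<Lambda> i X / \<rho> i - \<Lambda> i Y / \<rho> i\<bar> \<le> 1" by linarith
      then have "\<bar>(\<Lambda> i X - \<Lambda> i Y) / \<rho> i\<bar> \<le> 1" by (simp add: diff_divide_distrib)
      then show ?thesis using \<rho>[OF i] by (simp add: abs_divide)
    qed
    then show ?thesis using Y(1) by blast
  qed
  then show ?thesis using B' by blast
qed

lemma coefficient_powr_integrable:
  assumes \<omega>: "\<omega> \<in> forms k p D" and \<beta>: "\<beta> \<in> multi_indices k" and p: "p \<ge> 0"
  shows "integrable (lebesgue_on D) (\<lambda>z. \<bar>coefficient (\<omega> z) \<beta>\<bar> powr p)"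
    and "(LINT z|lebesgue_on D. \<bar>coefficient (\<omega> z) \<beta>\<bar> powr p) \<le> (LINT z|lebesgue_on D. modulus k (\<omega> z) powr p)"
proof -
  note [measurable] = formsD(2)[OF \<omega> \<beta>]
  have le: "\<bar>coefficient (\<omega> z) \<beta>\<bar> powr p \<le> modulus k (\<omega> z) powr p" for z
    using p coefficient_le_modulus[OF \<beta>] by (intro powr_mono2) auto
  show i: "integrable (lebesgue_on D) (\<lambda>z. \<bar>coefficient (\<omega> z) \<beta>\<bar> powr p)"
    by (rule Bochner_Integration.integrable_bound[OF formsD(3)[OF \<omega>]]) (use le in auto)
  show "(LINT z|lebesgue_on D. \<bar>coefficient (\<omega> z) \<beta>\<bar> powr p) \<le> (LINT z|lebesgue_on D. modulus k (\<omega> z) powr p)"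
    using le by (intro integral_mono i formsD(3)[OF \<omega>]) auto
qed

section \<open>The operator in coordinates\<close>

locale homotopy_setting =
  fixes D :: "(real, 'n::{finite,linorder}) vec set" and \<phi> :: "(real, 'n) vec \<Rightarrow> real" and k :: nat
  assumes open_D: "open D" and bounded_D: "bounded D" and \<phi>: "test_function D \<phi>" and k: "1 \<le> k"
begin

abbreviation "M \<equiv> lebesgue_on D"

abbreviation "H \<equiv> homotopy_operator k D \<phi>"

abbreviation "S \<equiv> (UNIV :: 'n set) \<times> (multi_indices k :: 'n list set)"

definition potential :: "'n \<Rightarrow> ((real, 'n) vec \<Rightarrow> real) \<Rightarrow> (real, 'n) vec \<Rightarrow> real" where
  "potential i f x = (LINT z|M. zeta_kernel k \<phi> z (x - z) $ i * f z)"

lemma D_borel: "D \<in> sets borel"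
  using open_D by simp

text \<open>Fixing one constant for all components makes every scalar result available without
  carrying an existential.\<close>

definition kernel_constant :: real where
  "kernel_constant = (SOME C. \<forall>i. weakly_singular_kernel (\<lambda>z x. zeta_kernel k \<phi> z (x - z) $ i) D C)"

lemma kernel_weakly_singular:
  "weakly_singular_kernel (\<lambda>z x. zeta_kernel k \<phi> z (x - z) $ i) D kernel_constant"
  using someI_ex[OF zeta_kernel_weakly_singular[OF open_D bounded_D \<phi> k]]
  unfolding kernel_constant_def by (rule spec)

lemma potential_eq_T:
  "weakly_singular_kernel.T (\<lambda>z x. zeta_kernel k \<phi> z (x - z) $ i) D f = potential i f"
  by (simp add: fun_eq_iff weakly_singular_kernel.T_def[OF kernel_weakly_singular] potential_def)

lemmas finite_measure_M = weakly_singular_kernel.finite_measure_D[OF kernel_weakly_singular]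

text \<open>Points at which all the finitely many scalar integrals converge. Elsewhere the default
  value 0 of a divergent integral could destroy linearity in the arguments. The condition mentions
  no vector arguments, so one null set is excluded for all of them.\<close>

definition regular_point :: "((real, 'n) vec \<Rightarrow> (real, 'n) vec list \<Rightarrow> real) \<Rightarrow> (real, 'n) vec \<Rightarrow> bool" where
  "regular_point \<omega> x \<longleftrightarrow> (\<forall>(i, \<beta>)\<in>S. integrable M (\<lambda>z. zeta_kernel k \<phi> z (x - z) $ i * coefficient (\<omega> z) \<beta>))"

lemma AE_regular_point:
  assumes \<omega>: "\<omega> \<in> forms k p D" and p: "p \<ge> 1"
  shows "AE x in M. regular_point \<omega> x"
proof -
  have fin: "finite S" by (simp add: finite_multi_indices)
  have "AE x in M. integrable M (\<lambda>z. zeta_kernel k \<phi> z (x - z) $ fst s * coefficient (\<omega> z) (snd s))" if "s \<in> S" for s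
    using that p by (intro weakly_singular_kernel.T_AE_integrable[OF kernel_weakly_singular p] formsD(2)[OF \<omega>] coefficient_powr_integrable[OF \<omega>]) auto
  with fin have "AE x in M. \<forall>s\<in>S. integrable M (\<lambda>z. zeta_kernel k \<phi> z (x - z) $ fst s * coefficient (\<omega> z) (snd s))"
    by (rule AE_finite_allI)
  then show ?thesis by eventually_elim (auto simp: regular_point_def)
qed

text \<open>For almost every \<open>z\<close> the first argument is expanded in the standard basis
  and the form in its coefficients. The scalars depend on \<open>i\<close>, \<beta> and \<xi> but
  not on \<open>z\<close>, hence they leave the integral, and scalar potentials remain.\<close>

lemma homotopy_operator_expansion:
  assumes \<omega>: "\<omega> \<in> forms k p D" and x: "regular_point \<omega> x" and \<xi>: "length \<xi> = k - 1"
  shows "integrable M (\<lambda>z. \<omega> z (zeta_kernel k \<phi> z (x - z) # \<xi>))"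
    and "H \<omega> x \<xi> = (\<Sum>(i, \<beta>)\<in>S. expansion_coefficient k (axis i 1 # \<xi>) \<beta> * potential i (\<lambda>z. coefficient (\<omega> z) \<beta>) x)"
proof -
  let ?g = "\<lambda>z. \<Sum>(i, \<beta>)\<in>S. expansion_coefficient k (axis i 1 # \<xi>) \<beta> * (zeta_kernel k \<phi> z (x - z) $ i * coefficient (\<omega> z) \<beta>)"
  have len: "length (v # \<xi>) = k" for v :: "(real, 'n) vec" using \<xi> k by simp
  have g: "integrable M ?g"
    using x unfolding regular_point_def
    by (intro Bochner_Integration.integrable_sum) (auto intro!: integrable_mult_right)
  have ae: "AE z in M. ?g z = \<omega> z (zeta_kernel k \<phi> z (x - z) # \<xi>)"
    using formsD(1)[OF \<omega>]
  proof eventually_elim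
    case (elim z)
    have "\<omega> z (zeta_kernel k \<phi> z (x - z) # \<xi>)
        = (\<Sum>i\<in>UNIV. zeta_kernel k \<phi> z (x - z) $ i * \<omega> z (axis i 1 # \<xi>))"
      using alternating_form_axis_expansion[OF elim, of "[]" \<xi> "zeta_kernel k \<phi> z (x - z)"] \<xi> k by simp
    also have "\<dots> = (\<Sum>i\<in>UNIV. \<Sum>\<beta>\<in>multi_indices k.
        expansion_coefficient k (axis i 1 # \<xi>) \<beta> * (zeta_kernel k \<phi> z (x - z) $ i * coefficient (\<omega> z) \<beta>))"
      by (simp add: alternating_form_expansion[OF elim len] sum_distrib_left mult_ac)
    also have "\<dots> = ?g z" by (simp add: sum.cartesian_product)
    finally show ?case ..
  qed
  have meas: "(\<lambda>z. \<omega> z (zeta_kernel k \<phi> z (x - z) # \<xi>)) \<in> borel_measurable M"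
    using borel_measurable_integrable[OF g] D_borel ae by (rule lebesgue_on_measurable_cong_AE)
  show "integrable M (\<lambda>z. \<omega> z (zeta_kernel k \<phi> z (x - z) # \<xi>))"
    using integrable_cong_AE[OF borel_measurable_integrable[OF g] meas ae] g by simp
  have "H \<omega> x \<xi> = (LINT z|M. ?g z)"
    unfolding homotopy_operator_def
    by (rule integral_cong_AE[OF borel_measurable_integrable[OF g] meas ae, symmetric])
  also have "\<dots> = (\<Sum>s\<in>S. LINT z|M. (case s of (i, \<beta>) \<Rightarrow>
      expansion_coefficient k (axis i 1 # \<xi>) \<beta> * (zeta_kernel k \<phi> z (x - z) $ i * coefficient (\<omega> z) \<beta>)))"
    using x unfolding regular_point_def
    by (intro Bochner_Integration.integral_sum) (auto intro!: integrable_mult_right)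
  also have "\<dots> = (\<Sum>(i, \<beta>)\<in>S. expansion_coefficient k (axis i 1 # \<xi>) \<beta> * potential i (\<lambda>z. coefficient (\<omega> z) \<beta>) x)"
    by (intro sum.cong) (auto simp: potential_def)
  finally show "H \<omega> x \<xi> = \<dots>" .
qed

lemma homotopy_operator_alternating:
  assumes \<omega>: "\<omega> \<in> forms k p D" and x: "regular_point \<omega> x"
  shows "alternating_form (k - 1) (H \<omega> x)"
  unfolding alternating_form_def
proof (intro allI impI conjI)
  fix \<xi> :: "(real, 'n) vec list" and j assume \<xi>: "length \<xi> = k - 1"
  let ?Z = "\<lambda>z. zeta_kernel k \<phi> z (x - z)"
  have int: "integrable M (\<lambda>z. \<omega> z (?Z z # \<xi>[j := v]))" for v
    using \<xi> by (intro homotopy_operator_expansion(1)[OF \<omega> x]) simp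
  {
    assume j: "j < k - 1"
    have lin: "AE z in M. linear (\<lambda>v. \<omega> z (?Z z # \<xi>[j := v]))"
      using formsD(1)[OF \<omega>]
    proof eventually_elim
      case (elim z)
      \<comment> \<open>The kernel vector occupies slot 0, so slot \<open>j\<close> of \<xi> is slot
        \<open>Suc j\<close> of \<omega> z.\<close>
      have "length (?Z z # \<xi>) = k" "Suc j < k" using \<xi> j k by auto
      then have "linear (\<lambda>v. \<omega> z ((?Z z # \<xi>)[Suc j := v]))"
        using elim unfolding alternating_form_def by blast
      then show ?case by simp
    qed
    show "linear (\<lambda>v. H \<omega> x (\<xi>[j := v]))"
    proof (rule linearI)
      fix u v :: "(real, 'n) vec" and c :: real
      have add: "AE z in M. \<omega> z (?Z z # \<xi>[j := u + v]) = \<omega> z (?Z z # \<xi>[j := u]) + \<omega> z (?Z z # \<xi>[j := v])"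
        using lin
      proof eventually_elim
        case (elim z)
        from linear_add[OF this, of u v] show ?case .
      qed
      have scale: "AE z in M. \<omega> z (?Z z # \<xi>[j := c *\<^sub>R v]) = c * \<omega> z (?Z z # \<xi>[j := v])"
        using lin
      proof eventually_elim
        case (elim z)
        from linear_scale[OF this, of c v] show ?case by simp
      qed
      have "H \<omega> x (\<xi>[j := u + v]) = (LINT z|M. \<omega> z (?Z z # \<xi>[j := u]) + \<omega> z (?Z z # \<xi>[j := v]))"
        unfolding homotopy_operator_def
        using int add by (intro integral_cong_AE borel_measurable_integrable Bochner_Integration.integrable_add)
      then show "H \<omega> x (\<xi>[j := u + v]) = H \<omega> x (\<xi>[j := u]) + H \<omega> x (\<xi>[j := v])"
        using int by (simp add: homotopy_operator_def)
      have "H \<omega> x (\<xi>[j := c *\<^sub>R v]) = (LINT z|M. c * \<omega> z (?Z z # \<xi>[j := v]))"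
        unfolding homotopy_operator_def
        using int scale by (intro integral_cong_AE borel_measurable_integrable integrable_mult_right)
      then show "H \<omega> x (\<xi>[j := c *\<^sub>R v]) = c *\<^sub>R H \<omega> x (\<xi>[j := v])"
        by (simp add: homotopy_operator_def)
    qed
  }
  assume nd: "\<not> distinct \<xi>"
  have "AE z in M. \<omega> z (?Z z # \<xi>) = 0"
    using formsD(1)[OF \<omega>]
  proof eventually_elim
    case (elim z)
    have "length (?Z z # \<xi>) = k" "\<not> distinct (?Z z # \<xi>)" using \<xi> k nd by auto
    then show ?case using elim unfolding alternating_form_def by blast
  qed
  then show "H \<omega> x \<xi> = 0"
    unfolding homotopy_operator_def by (rule integral_eq_zero_AE)
qed


lemma homotopy_operator_form_eq:
  assumes \<omega>: "\<omega> \<in> forms k p D" and \<eta>: "\<eta> \<in> forms k p D" and p: "p \<ge> 1" and eq: "form_eq k D \<omega> \<eta>"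
  shows "form_eq (k - 1) D (H \<omega>) (H \<eta>)"
  unfolding form_eq_def
  using AE_regular_point[OF \<omega> p] AE_regular_point[OF \<eta> p]
proof eventually_elim
  case (elim x)
  show ?case
  proof (intro allI impI)
    fix \<xi> :: "(real, 'n) vec list" assume \<xi>: "length \<xi> = k - 1"
    then have len: "length (v # \<xi>) = k" for v :: "(real, 'n) vec" using k by simp
    have "AE z in M. \<omega> z (zeta_kernel k \<phi> z (x - z) # \<xi>) = \<eta> z (zeta_kernel k \<phi> z (x - z) # \<xi>)"
      using eq unfolding form_eq_def by eventually_elim (use len in blast)
    then show "H \<omega> x \<xi> = H \<eta> x \<xi>"
      unfolding homotopy_operator_def
      by (intro integral_cong_AE borel_measurable_integrable
          homotopy_operator_expansion(1)[OF \<omega> elim(1) \<xi>] homotopy_operator_expansion(1)[OF \<eta> elim(2) \<xi>])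
  qed
qed

lemma homotopy_operator_linear:
  assumes \<omega>: "\<omega> \<in> forms k p D" and \<eta>: "\<eta> \<in> forms k p D" and p: "p \<ge> 1"
  shows "form_eq (k - 1) D (H (\<lambda>x \<xi>. a * \<omega> x \<xi> + b * \<eta> x \<xi>)) (\<lambda>x \<xi>. a * H \<omega> x \<xi> + b * H \<eta> x \<xi>)"
  unfolding form_eq_def
  using AE_regular_point[OF \<omega> p] AE_regular_point[OF \<eta> p]
proof eventually_elim
  case (elim x)
  show ?case
  proof (intro allI impI)
    fix \<xi> :: "(real, 'n) vec list" assume \<xi>: "length \<xi> = k - 1"
    show "H (\<lambda>x \<xi>. a * \<omega> x \<xi> + b * \<eta> x \<xi>) x \<xi> = a * H \<omega> x \<xi> + b * H \<eta> x \<xi>"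
      using homotopy_operator_expansion(1)[OF \<omega> elim(1) \<xi>] homotopy_operator_expansion(1)[OF \<eta> elim(2) \<xi>]
      by (simp add: homotopy_operator_def)
  qed
qed

lemma potential_coefficient:
  assumes \<omega>: "\<omega> \<in> forms k p D" and pq: "1 \<le> p" "1 \<le> q" "1 / p - 1 / q < 1 / real CARD('n)"
    and \<beta>: "\<beta> \<in> multi_indices k"
  shows "potential i (\<lambda>z. coefficient (\<omega> z) \<beta>) \<in> borel_measurable M"
    and "integrable M (\<lambda>x. \<bar>potential i (\<lambda>z. coefficient (\<omega> z) \<beta>) x\<bar> powr q)"
proof -
  have p0: "p \<ge> 0" using pq by simp
  note coef = formsD(2)[OF \<omega> \<beta>] coefficient_powr_integrable(1)[OF \<omega> \<beta> p0]
  show "potential i (\<lambda>z. coefficient (\<omega> z) \<beta>) \<in> borel_measurable M"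
    using weakly_singular_kernel.T_measurable[OF kernel_weakly_singular coef] unfolding potential_eq_T .
  show "integrable M (\<lambda>x. \<bar>potential i (\<lambda>z. coefficient (\<omega> z) \<beta>) x\<bar> powr q)"
    using weakly_singular_kernel.T_powr_integrable[OF kernel_weakly_singular pq(1,2) _ coef] pq(3) unfolding potential_eq_T by simp
qed

text \<open>One constant for all \<omega>: smallness of every scalar potential of a form will imply
  smallness of its image, which is how the scalar compactness statement reaches forms.\<close>

lemma homotopy_operator_bound:
  assumes pq: "1 \<le> p" "1 \<le> q" "1 / p - 1 / q < 1 / real CARD('n)"
  shows "\<exists>C\<ge>0. \<forall>\<omega>\<in>forms k p D. H \<omega> \<in> forms (k - 1) q D \<and>
    (LINT x|M. modulus (k - 1) (H \<omega> x) powr q)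
      \<le> C * (\<Sum>(i, \<beta>)\<in>S. LINT x|M. \<bar>potential i (\<lambda>z. coefficient (\<omega> z) \<beta>) x\<bar> powr q)"
proof -
  define c where "c \<alpha> s = expansion_coefficient k (axis (fst s) 1 # map (\<lambda>i. axis i 1) \<alpha>) (snd s)"
    for \<alpha> :: "'n list" and s :: "'n \<times> 'n list"
  define C0 where "C0 = (\<Sum>\<alpha>\<in>multi_indices (k - 1). \<Sum>s\<in>S. \<bar>c \<alpha> s\<bar>)"
  have C0: "C0 \<ge> 0" by (auto simp: C0_def intro!: sum_nonneg)
  \<comment> \<open>\<open>C0\<close> collects all expansion scalars in absolute value; the power of
    \<open>card S\<close> is the price of exchanging a sum with a q-th power.\<close>
  define C where "C = C0 powr q * real (card S) powr q"
  have fin: "finite S" by (simp add: finite_multi_indices)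
  have "H \<omega> \<in> forms (k - 1) q D \<and>
    (LINT x|M. modulus (k - 1) (H \<omega> x) powr q)
      \<le> C * (\<Sum>(i, \<beta>)\<in>S. LINT x|M. \<bar>potential i (\<lambda>z. coefficient (\<omega> z) \<beta>) x\<bar> powr q)"
    if \<omega>: "\<omega> \<in> forms k p D" for \<omega>
  proof -
    define F where "F s = potential (fst s) (\<lambda>z. coefficient (\<omega> z) (snd s))" for s
    have F [measurable]: "F s \<in> borel_measurable M" and Fq: "integrable M (\<lambda>x. \<bar>F s x\<bar> powr q)" if "s \<in> S" for s
      using that potential_coefficient[OF \<omega> pq] by (auto simp: F_def)
    have coef: "AE x in M. (\<Sum>s\<in>S. c \<alpha> s * F s x) = coefficient (H \<omega> x) \<alpha>" if "\<alpha> \<in> multi_indices (k - 1)" for \<alpha>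
      using AE_regular_point[OF \<omega> pq(1)]
    proof eventually_elim
      case (elim x)
      have "length (map (\<lambda>i. axis i (1::real)) \<alpha> :: (real, 'n) vec list) = k - 1"
        using that by (simp add: multi_indices_def)
      from homotopy_operator_expansion(2)[OF \<omega> elim this] show ?case
        by (simp add: coefficient_def c_def F_def case_prod_unfold)
    qed
    have meas: "(\<lambda>x. coefficient (H \<omega> x) \<alpha>) \<in> borel_measurable M" if "\<alpha> \<in> multi_indices (k - 1)" for \<alpha>
    proof (rule lebesgue_on_measurable_cong_AE[OF _ D_borel coef[OF that]])
      show "(\<lambda>x. \<Sum>s\<in>S. c \<alpha> s * F s x) \<in> borel_measurable M"
        by (intro borel_measurable_sum borel_measurable_times borel_measurable_const F)
    qed
    have "AE x in M. \<forall>\<alpha>\<in>multi_indices (k - 1). (\<Sum>s\<in>S. c \<alpha> s * F s x) = coefficient (H \<omega> x) \<alpha>"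
      using finite_multi_indices coef by (rule AE_finite_allI)
    then have le: "AE x in M. modulus (k - 1) (H \<omega> x) powr q \<le> C * (\<Sum>s\<in>S. \<bar>F s x\<bar> powr q)"
    proof eventually_elim
      case (elim x)
      have "modulus (k - 1) (H \<omega> x) \<le> (\<Sum>\<alpha>\<in>multi_indices (k - 1). \<bar>\<Sum>s\<in>S. c \<alpha> s * F s x\<bar>)"
        using modulus_le_sum[of "k - 1" "H \<omega> x"] elim by simp
      also have "\<dots> \<le> (\<Sum>\<alpha>\<in>multi_indices (k - 1). \<Sum>s\<in>S. \<bar>c \<alpha> s\<bar> * (\<Sum>s\<in>S. \<bar>F s x\<bar>))"
      proof (rule sum_mono)
        fix \<alpha> :: "'n list"
        have "\<bar>\<Sum>s\<in>S. c \<alpha> s * F s x\<bar> \<le> (\<Sum>s\<in>S. \<bar>c \<alpha> s\<bar> * \<bar>F s x\<bar>)"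
          using sum_abs[of "\<lambda>s. c \<alpha> s * F s x" S] by (simp add: abs_mult)
        also have "\<dots> \<le> (\<Sum>s\<in>S. \<bar>c \<alpha> s\<bar> * (\<Sum>s\<in>S. \<bar>F s x\<bar>))"
          using fin by (intro sum_mono mult_left_mono member_le_sum[of _ S "\<lambda>s. \<bar>F s x\<bar>"]) auto
        finally show "\<bar>\<Sum>s\<in>S. c \<alpha> s * F s x\<bar> \<le> (\<Sum>s\<in>S. \<bar>c \<alpha> s\<bar> * (\<Sum>s\<in>S. \<bar>F s x\<bar>))" .
      qed
      also have "\<dots> = C0 * (\<Sum>s\<in>S. \<bar>F s x\<bar>)"
        by (simp only: C0_def sum_distrib_right)
      finally have "modulus (k - 1) (H \<omega> x) powr q \<le> (C0 * (\<Sum>s\<in>S. \<bar>F s x\<bar>)) powr q"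
        using pq modulus_nonneg by (intro powr_mono2) auto
      also have "\<dots> = C0 powr q * (\<Sum>s\<in>S. \<bar>F s x\<bar>) powr q"
        by (rule powr_mult)
      also have "\<dots> \<le> C0 powr q * (real (card S) powr q * (\<Sum>s\<in>S. \<bar>F s x\<bar> powr q))"
        using fin pq by (intro mult_left_mono sum_powr_le) auto
      finally show ?case by (simp only: C_def mult.assoc)
    qed
    have bound: "integrable M (\<lambda>x. C * (\<Sum>s\<in>S. \<bar>F s x\<bar> powr q))"
      by (intro integrable_mult_right Bochner_Integration.integrable_sum Fq)
    have Cn: "C \<ge> 0" by (simp add: C_def)
    have int: "integrable M (\<lambda>x. modulus (k - 1) (H \<omega> x) powr q)"
    proof (rule Bochner_Integration.integrable_bound[OF bound])
      show "(\<lambda>x. modulus (k - 1) (H \<omega> x) powr q) \<in> borel_measurable M"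
        using modulus_measurable[OF meas] by measurable
      show "AE x in M. norm (modulus (k - 1) (H \<omega> x) powr q) \<le> norm (C * (\<Sum>s\<in>S. \<bar>F s x\<bar> powr q))"
        using le unfolding real_norm_def abs_of_nonneg[OF powr_ge_zero]
        by eventually_elim (rule order_trans[OF _ abs_ge_self])
    qed
    have "(LINT x|M. modulus (k - 1) (H \<omega> x) powr q) \<le> (LINT x|M. C * (\<Sum>s\<in>S. \<bar>F s x\<bar> powr q))"
      by (rule integral_mono_AE[OF int bound le])
    also have "\<dots> = C * (\<Sum>s\<in>S. LINT x|M. \<bar>F s x\<bar> powr q)"
      using Fq by (simp add: Bochner_Integration.integral_sum)
    also have "\<dots> = C * (\<Sum>(i, \<beta>)\<in>S. LINT x|M. \<bar>potential i (\<lambda>z. coefficient (\<omega> z) \<beta>) x\<bar> powr q)"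
      by (simp add: F_def case_prod_unfold)
    finally have 1: "(LINT x|M. modulus (k - 1) (H \<omega> x) powr q)
      \<le> C * (\<Sum>(i, \<beta>)\<in>S. LINT x|M. \<bar>potential i (\<lambda>z. coefficient (\<omega> z) \<beta>) x\<bar> powr q)" .
    have "AE x in M. alternating_form (k - 1) (H \<omega> x)"
      using AE_regular_point[OF \<omega> pq(1)] by eventually_elim (rule homotopy_operator_alternating[OF \<omega>])
    then show ?thesis using meas int 1 by (auto simp: forms_def)
  qed
  moreover have "C \<ge> 0" by (simp add: C_def)
  ultimately show ?thesis by blast
qed

section \<open>Passage to classes and total boundedness\<close>

lemma induced_map_eq:
  assumes pq: "1 \<le> p" "1 \<le> q" "1 / p - 1 / q < 1 / real CARD('n)" and X: "X \<in> Omega k p D"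
  shows "induced_map (k - 1) q D H X = form_class (k - 1) q D (H (rep X))"
proof -
  have H: "H \<omega> \<in> forms (k - 1) q D" if "\<omega> \<in> forms k p D" for \<omega>
    using homotopy_operator_bound[OF pq] that by blast
  have "form_class (k - 1) q D (H \<omega>) = form_class (k - 1) q D (H (rep X))" if "\<omega> \<in> X" for \<omega>
  proof -
    have \<omega>: "\<omega> \<in> forms k p D" "form_eq k D (rep X) \<omega>"
      using that Omega_rep(2)[OF X] unfolding form_class_def by blast+
    show ?thesis
      using form_class_eq_iff[OF H[OF \<omega>(1)] H[OF Omega_rep(1)[OF X]]]
        form_eq_sym[OF homotopy_operator_form_eq[OF Omega_rep(1)[OF X] \<omega>(1) pq(1) \<omega>(2)]]
      by blast
  qed
  moreover have "rep X \<in> X" using Omega_rep[OF X] form_eq_refl by (auto simp: form_class_def)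
  ultimately show ?thesis unfolding induced_map_def by blast
qed

text \<open>A bounded kernel pairs with every form, since |t| \<le> 1 + |t|^p on a set of finite
  measure. The estimate keeps the functionals of \<open>T_compact\<close> bounded on bounded sets,
  as the rounding into cells requires.\<close>

lemma coefficient_functional:
  assumes \<omega>: "\<omega> \<in> forms k p D" and \<beta>: "\<beta> \<in> multi_indices k" and p: "1 \<le> p"
    and \<kappa>: "\<kappa> \<in> borel_measurable borel" "\<And>z. \<bar>\<kappa> z\<bar> \<le> B"
  shows "integrable M (\<lambda>z. \<kappa> z * coefficient (\<omega> z) \<beta>)"
    and "\<bar>LINT z|M. \<kappa> z * coefficient (\<omega> z) \<beta>\<bar> \<le> B * (measure M D + (LINT z|M. modulus k (\<omega> z) powr p))"
proof -
  interpret finite_measure M by (rule finite_measure_M)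
  note [measurable] = formsD(2)[OF \<omega> \<beta>]
  have [measurable]: "\<kappa> \<in> borel_measurable M"
    using \<kappa>(1) by (intro measurable_restrict_space1 measurable_completion) simp
  \<comment> \<open>Any single point shows that a bound of absolute values is nonnegative.\<close>
  have B: "B \<ge> 0" using \<kappa>(2)[of undefined] by linarith
  have le: "\<bar>\<kappa> z * coefficient (\<omega> z) \<beta>\<bar> \<le> B * (1 + modulus k (\<omega> z) powr p)" for z
  proof -
    have "\<bar>coefficient (\<omega> z) \<beta>\<bar> \<le> 1 + modulus k (\<omega> z) powr p"
      using coefficient_le_modulus[OF \<beta>, of "\<omega> z"] powr_le_one_plus_powr[of "modulus k (\<omega> z)" 1 p] p modulus_nonneg[of k "\<omega> z"]
      by simp
    then show ?thesis unfolding abs_mult using \<kappa>(2) B by (intro mult_mono) auto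
  qed
  have b: "integrable M (\<lambda>z. B * (1 + modulus k (\<omega> z) powr p))"
    using formsD(3)[OF \<omega>] by auto
  show i: "integrable M (\<lambda>z. \<kappa> z * coefficient (\<omega> z) \<beta>)"
  proof (rule Bochner_Integration.integrable_bound[OF b])
    show "AE z in M. norm (\<kappa> z * coefficient (\<omega> z) \<beta>) \<le> norm (B * (1 + modulus k (\<omega> z) powr p))"
      unfolding real_norm_def by (intro AE_I2 order_trans[OF le abs_ge_self])
  qed measurable
  have "\<bar>LINT z|M. \<kappa> z * coefficient (\<omega> z) \<beta>\<bar> \<le> (LINT z|M. \<bar>\<kappa> z * coefficient (\<omega> z) \<beta>\<bar>)"
    by (rule integral_abs_bound)
  also have "\<dots> \<le> (LINT z|M. B * (1 + modulus k (\<omega> z) powr p))"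
    by (intro integral_mono integrable_abs i b le)
  also have "\<dots> = B * (measure M D + (LINT z|M. modulus k (\<omega> z) powr p))"
    using formsD(3)[OF \<omega>] by simp
  finally show "\<bar>LINT z|M. \<kappa> z * coefficient (\<omega> z) \<beta>\<bar> \<le> B * (measure M D + (LINT z|M. modulus k (\<omega> z) powr p))" .
qed

text \<open>The scalar statement is applied to differences of representatives. Their p-norms are
  bounded by twice the radius of a ball containing \<open>B\<close>, which supplies the
  \<open>R\<close>; the net consists of the images of one member per cell.\<close>

lemma homotopy_operator_totally_bounded:
  assumes pq: "1 \<le> p" "1 \<le> q" "1 / p - 1 / q < 1 / real CARD('n)"
    and B: "B \<subseteq> Omega k p D" and bdd: "Metric_space.mbounded (Omega k p D) (Omega_dist k p D) B"
  shows "Metric_space.mtotally_bounded (Omega (k - 1) q D) (Omega_dist (k - 1) q D) (induced_map (k - 1) q D H ` B)"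
proof -
  interpret P: Metric_space "Omega k p D" "Omega_dist k p D" by (rule Metric_space_Omega[OF pq(1)])
  interpret Q: Metric_space "Omega (k - 1) q D" "Omega_dist (k - 1) q D" by (rule Metric_space_Omega[OF pq(2)])
  obtain C where C: "C \<ge> 0" and HF: "\<And>\<omega>. \<omega> \<in> forms k p D \<Longrightarrow> H \<omega> \<in> forms (k - 1) q D"
    and HC: "\<And>\<omega>. \<omega> \<in> forms k p D \<Longrightarrow> (LINT x|M. modulus (k - 1) (H \<omega> x) powr q)
      \<le> C * (\<Sum>(i, \<beta>)\<in>S. LINT x|M. \<bar>potential i (\<lambda>z. coefficient (\<omega> z) \<beta>) x\<bar> powr q)"
    using homotopy_operator_bound[OF pq] by blast
  have rep: "rep X \<in> forms k p D" if "X \<in> B" for X using Omega_rep(1) B that by blast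
  obtain X0 b where X0: "B \<subseteq> P.mcball X0 b" using bdd unfolding P.mbounded_def by blast
  have diam: "form_norm k p D (\<lambda>x \<xi>. rep X x \<xi> - rep Y x \<xi>) \<le> 2 * \<bar>b\<bar>" if "X \<in> B" "Y \<in> B" for X Y
  proof -
    have "X0 \<in> Omega k p D" "Omega_dist k p D X0 X \<le> b" "Omega_dist k p D X0 Y \<le> b"
      using X0 that by (auto simp: P.mcball_def)
    then have "Omega_dist k p D X Y \<le> 2 * \<bar>b\<bar>"
      using P.triangle[of X X0 Y] P.commute[of X X0] B that by force
    then show ?thesis by (simp add: Omega_dist_rep)
  qed
  define R where "R = (2 * \<bar>b\<bar>) powr p"
  have p0: "p > 0" "p \<ge> 0" using pq by auto
  have diff: "(\<lambda>x \<xi>. rep X x \<xi> - rep Y x \<xi>) \<in> forms k p D" if "X \<in> B" "Y \<in> B" for X Y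
    using that p0 by (intro forms_diff rep) auto
  have R: "(LINT z|M. modulus k (\<lambda>\<xi>. rep X z \<xi> - rep Y z \<xi>) powr p) \<le> R" if "X \<in> B" "Y \<in> B" for X Y
    unfolding R_def form_norm_powr[OF p0(1), symmetric]
    using p0 by (intro powr_mono2 form_norm_nonneg diam that) auto
  have fin: "finite S" by (simp add: finite_multi_indices)
  show ?thesis
    unfolding Q.mtotally_bounded_def
  proof (intro allI impI)
    fix \<epsilon> :: real assume \<epsilon>: "\<epsilon> > 0"
    \<comment> \<open>Summed over \<open>S\<close> and multiplied by \<open>C\<close>, errors
      \<open>e\<close> stay below (\<epsilon>/2)^q. The 1 avoids division by 0, and \<epsilon>/2 in
      place of \<epsilon> gives the strict inequality of an open ball.\<close>
    define e where "e = (\<epsilon> / 2) powr q / (C * card S + 1)"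
    have denom: "C * card S + 1 > 0" using C by (intro add_nonneg_pos) auto
    then have e: "e > 0" using \<epsilon> by (simp add: e_def)
    \<comment> \<open>The conclusion of \<open>T_compact\<close> for component \<open>i\<close>,
      named so that a finite set and a threshold can be chosen for all \<open>i\<close> at
      once.\<close>
    define separating where "separating i L \<rho> \<longleftrightarrow> finite L \<and> \<rho> > 0 \<and>
      (\<forall>\<kappa>\<in>L. \<kappa> \<in> borel_measurable borel \<and> (\<exists>B. \<forall>z. \<bar>\<kappa> z\<bar> \<le> B)) \<and>
      (\<forall>f\<in>borel_measurable M. integrable M (\<lambda>z. \<bar>f z\<bar> powr p) \<longrightarrow>
        (LINT z|M. \<bar>f z\<bar> powr p) \<le> R \<longrightarrow>
        (\<forall>\<kappa>\<in>L. \<bar>LINT z|M. \<kappa> z * f z\<bar> \<le> \<rho>) \<longrightarrow> (LINT x|M. \<bar>potential i f x\<bar> powr q) \<le> e)"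
      for i and L :: "((real, 'n) vec \<Rightarrow> real) set" and \<rho> :: real
    have "\<exists>L \<rho>. separating i L \<rho>" for i
      using weakly_singular_kernel.T_compact[OF kernel_weakly_singular pq(1,2) _ _ e, of R i] pq(3)
      unfolding potential_eq_T separating_def by (simp add: R_def)
    then obtain L \<rho> where sep: "\<And>i. separating i (L i) (\<rho> i)"
      by metis
    have L: "finite (L i)" "\<rho> i > 0" for i
      using sep[of i] unfolding separating_def by blast+
    have L_bounded: "\<kappa> \<in> borel_measurable borel \<and> (\<exists>B. \<forall>z. \<bar>\<kappa> z\<bar> \<le> B)" if "\<kappa> \<in> L i" for i \<kappa>
      using sep[of i] that unfolding separating_def by blast
    have small: "(LINT x|M. \<bar>potential i f x\<bar> powr q) \<le> e"
      if "f \<in> borel_measurable M" "integrable M (\<lambda>z. \<bar>f z\<bar> powr p)"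
        "(LINT z|M. \<bar>f z\<bar> powr p) \<le> R" "\<And>\<kappa>. \<kappa> \<in> L i \<Longrightarrow> \<bar>LINT z|M. \<kappa> z * f z\<bar> \<le> \<rho> i" for i f
      using sep[of i] that unfolding separating_def by blast
    \<comment> \<open>One functional for each component, each multi-index and each kernel belonging
      to that component.\<close>
    define I where "I = (SIGMA s:S. L (fst s))"
    define \<Lambda> where "\<Lambda> t X = (LINT z|M. snd t z * coefficient (rep X z) (snd (fst t)))"
      for t :: "('n \<times> 'n list) \<times> ((real, 'n) vec \<Rightarrow> real)" and X
    have \<Lambda>_diff: "\<Lambda> t X - \<Lambda> t Y = (LINT z|M. snd t z * coefficient (\<lambda>\<xi>. rep X z \<xi> - rep Y z \<xi>) (snd (fst t)))"
      if t: "t \<in> I" and XY: "X \<in> B" "Y \<in> B" for t X Y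
    proof -
      obtain i \<beta> \<kappa> where t': "t = ((i, \<beta>), \<kappa>)" "\<beta> \<in> multi_indices k" "\<kappa> \<in> L i"
        using t unfolding I_def by auto
      obtain B0 where "\<kappa> \<in> borel_measurable borel" "\<And>z. \<bar>\<kappa> z\<bar> \<le> B0" using L_bounded[OF t'(3)] by blast
      then have "integrable M (\<lambda>z. \<kappa> z * coefficient (rep X z) \<beta>)" "integrable M (\<lambda>z. \<kappa> z * coefficient (rep Y z) \<beta>)"
        using coefficient_functional(1)[OF rep t'(2) pq(1)] XY by blast+
      then show ?thesis by (simp add: \<Lambda>_def t' coefficient_linear right_diff_distrib)
    qed
    have "\<exists>B'\<subseteq>B. finite B' \<and> (\<forall>X\<in>B. \<exists>Y\<in>B'. \<forall>t\<in>I. \<bar>\<Lambda> t X - \<Lambda> t Y\<bar> \<le> \<rho> (fst (fst t)))"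
    proof (rule finite_cells)
      show "finite I" using fin L(1) unfolding I_def by auto
      show "\<rho> (fst (fst t)) > 0" for t :: "('n \<times> 'n list) \<times> ((real, 'n) vec \<Rightarrow> real)" by (rule L(2))
      fix t assume t: "t \<in> I"
      obtain i \<beta> \<kappa> where t': "t = ((i, \<beta>), \<kappa>)" "\<beta> \<in> multi_indices k" "\<kappa> \<in> L i"
        using t unfolding I_def by auto
      obtain B0 where B0: "\<kappa> \<in> borel_measurable borel" "\<And>z. \<bar>\<kappa> z\<bar> \<le> B0" using L_bounded[OF t'(3)] by blast
      have B0n: "B0 \<ge> 0" using B0(2)[of undefined] by linarith
      \<comment> \<open>Norm bounds are at hand for differences only, so values are compared with
        the value at one fixed member of \<open>B\<close>.\<close>
      show "\<exists>M. \<forall>X\<in>B. \<bar>\<Lambda> t X\<bar> \<le> M"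
      proof (cases "B = {}")
        case False
        then obtain Y where Y: "Y \<in> B" by blast
        have "\<bar>\<Lambda> t X\<bar> \<le> \<bar>\<Lambda> t Y\<bar> + B0 * (measure M D + R)" if X: "X \<in> B" for X
        proof -
          have "\<bar>\<Lambda> t X - \<Lambda> t Y\<bar> \<le> B0 * (measure M D + (LINT z|M. modulus k (\<lambda>\<xi>. rep X z \<xi> - rep Y z \<xi>) powr p))"
            using coefficient_functional(2)[OF diff[OF X Y] t'(2) pq(1) B0] \<Lambda>_diff[OF t X Y]
            unfolding t'(1) by simp
          also have "\<dots> \<le> B0 * (measure M D + R)"
            using R[OF X Y] B0n by (intro mult_left_mono) auto
          finally show ?thesis by linarith
        qed
        then show ?thesis by blast
      qed simp
    qed
    then obtain B' where B': "B' \<subseteq> B" "finite B'"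
      and net: "\<And>X. X \<in> B \<Longrightarrow> \<exists>Y\<in>B'. \<forall>t\<in>I. \<bar>\<Lambda> t X - \<Lambda> t Y\<bar> \<le> \<rho> (fst (fst t))" by blast
    have ind: "induced_map (k - 1) q D H X = form_class (k - 1) q D (H (rep X))" if "X \<in> B" for X
      using induced_map_eq[OF pq] B that by blast
    have "\<exists>Y\<in>B'. induced_map (k - 1) q D H X \<in> Q.mball (induced_map (k - 1) q D H Y) \<epsilon>" if X: "X \<in> B" for X
    proof -
      obtain Y where Y: "Y \<in> B'" "\<And>t. t \<in> I \<Longrightarrow> \<bar>\<Lambda> t X - \<Lambda> t Y\<bar> \<le> \<rho> (fst (fst t))" using net[OF X] by blast
      have YB: "Y \<in> B" using Y(1) B'(1) by blast
      let ?\<delta> = "\<lambda>x \<xi>. rep X x \<xi> - rep Y x \<xi>"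
      have pot: "(LINT x|M. \<bar>potential i (\<lambda>z. coefficient (?\<delta> z) \<beta>) x\<bar> powr q) \<le> e"
        if "\<beta> \<in> multi_indices k" for i \<beta>
      proof (rule small)
        show "(\<lambda>z. coefficient (?\<delta> z) \<beta>) \<in> borel_measurable M"
          by (rule formsD(2)[OF diff[OF X YB] that])
        show "integrable M (\<lambda>z. \<bar>coefficient (?\<delta> z) \<beta>\<bar> powr p)"
          by (rule coefficient_powr_integrable(1)[OF diff[OF X YB] that p0(2)])
        show "(LINT z|M. \<bar>coefficient (?\<delta> z) \<beta>\<bar> powr p) \<le> R"
          by (rule order_trans[OF coefficient_powr_integrable(2)[OF diff[OF X YB] that p0(2)] R[OF X YB]])
        fix \<kappa> assume "\<kappa> \<in> L i"
        then have t: "((i, \<beta>), \<kappa>) \<in> I" using that by (simp add: I_def)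
        from Y(2)[OF t] show "\<bar>LINT z|M. \<kappa> z * coefficient (?\<delta> z) \<beta>\<bar> \<le> \<rho> i"
          unfolding \<Lambda>_diff[OF t X YB] by simp
      qed
      have "form_norm (k - 1) q D (H ?\<delta>) powr q = (LINT x|M. modulus (k - 1) (H ?\<delta> x) powr q)"
        using pq by (intro form_norm_powr) auto
      also have "\<dots> \<le> C * (\<Sum>(i, \<beta>)\<in>S. LINT x|M. \<bar>potential i (\<lambda>z. coefficient (?\<delta> z) \<beta>) x\<bar> powr q)"
        by (rule HC[OF diff[OF X YB]])
      also have "\<dots> \<le> C * (\<Sum>(i, \<beta>)\<in>S. e)"
        using pot C by (intro mult_left_mono sum_mono) auto
      also have "\<dots> = (C * card S) * e" by simp
      also have "\<dots> \<le> (C * card S + 1) * e"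
        using e by simp
      also have "\<dots> = (\<epsilon> / 2) powr q"
        using denom by (simp add: e_def)
      finally have le: "form_norm (k - 1) q D (H ?\<delta>) powr q \<le> (\<epsilon> / 2) powr q" .
      have "(form_norm (k - 1) q D (H ?\<delta>) powr q) powr (1 / q) \<le> ((\<epsilon> / 2) powr q) powr (1 / q)"
        by (rule powr_mono2[OF _ powr_ge_zero le]) (use pq in simp)
      then have 1: "form_norm (k - 1) q D (H ?\<delta>) < \<epsilon>"
        using pq \<epsilon> form_norm_nonneg[of "k - 1" q D "H ?\<delta>"] by (simp add: powr_powr)
      \<comment> \<open>The scalar estimates concern the image of the difference, the metric the
        difference of the images; linearity holds up to a null set, which the norm does not
        see.\<close>
      have "form_eq (k - 1) D (H ?\<delta>) (\<lambda>x \<xi>. H (rep X) x \<xi> - H (rep Y) x \<xi>)"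
        using homotopy_operator_linear[OF rep[OF X] rep[OF YB] pq(1), of 1 "- 1"] by simp
      then have "form_norm (k - 1) q D (H ?\<delta>) = form_norm (k - 1) q D (\<lambda>x \<xi>. H (rep X) x \<xi> - H (rep Y) x \<xi>)"
        using pq by (intro form_norm_cong forms_diff HF diff[OF X YB] rep X YB) auto
      also have "\<dots> = Omega_dist (k - 1) q D (induced_map (k - 1) q D H X) (induced_map (k - 1) q D H Y)"
        unfolding ind[OF X] ind[OF YB] using pq
        by (intro Omega_dist_form_class[symmetric] HF rep X YB) auto
      finally have "Omega_dist (k - 1) q D (induced_map (k - 1) q D H Y) (induced_map (k - 1) q D H X) < \<epsilon>"
        using 1 Q.commute by simp
      moreover have "induced_map (k - 1) q D H X \<in> Omega (k - 1) q D" "induced_map (k - 1) q D H Y \<in> Omega (k - 1) q D"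
        unfolding ind[OF X] ind[OF YB] Omega_def using HF rep X YB by blast+
      ultimately have "induced_map (k - 1) q D H X \<in> Q.mball (induced_map (k - 1) q D H Y) \<epsilon>"
        by (simp only: Q.in_mball simp_thms)
      then show ?thesis using Y(1) by blast
    qed
    then have "induced_map (k - 1) q D H ` B
        \<subseteq> (\<Union>x\<in>induced_map (k - 1) q D H ` B'. Q.mball x \<epsilon>)" by blast
    then show "\<exists>K. finite K \<and> K \<subseteq> induced_map (k - 1) q D H ` B \<and>
        induced_map (k - 1) q D H ` B \<subseteq> (\<Union>x\<in>K. Q.mball x \<epsilon>)"
      using B' by (intro exI[of _ "induced_map (k - 1) q D H ` B'"]) auto
  qed
qed

lemma homotopy_operator_compact:
  assumes pq: "1 \<le> p" "1 \<le> q" "1 / p - 1 / q < 1 / real CARD('n)"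
  shows "compact_operator_on_forms k p (k - 1) q D H"
  unfolding compact_operator_on_forms_def
proof (intro conjI ballI allI impI)
  show "H \<omega> \<in> forms (k - 1) q D" if "\<omega> \<in> forms k p D" for \<omega>
    using homotopy_operator_bound[OF pq] that by blast
  show "form_eq (k - 1) D (H \<omega>) (H \<eta>)"
    if "\<omega> \<in> forms k p D" "\<eta> \<in> forms k p D" "form_eq k D \<omega> \<eta>" for \<omega> \<eta>
    by (rule homotopy_operator_form_eq[OF that(1,2) pq(1) that(3)])
  show "form_eq (k - 1) D (H (\<lambda>x \<xi>. a * \<omega> x \<xi> + b * \<eta> x \<xi>)) (\<lambda>x \<xi>. a * H \<omega> x \<xi> + b * H \<eta> x \<xi>)"
    if "\<omega> \<in> forms k p D" "\<eta> \<in> forms k p D" for \<omega> \<eta> a b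
    by (rule homotopy_operator_linear[OF that pq(1)])
  fix B assume "B \<subseteq> Omega k p D \<and> Metric_space.mbounded (Omega k p D) (Omega_dist k p D) B"
  then have "Metric_space.mtotally_bounded (Omega (k - 1) q D) (Omega_dist (k - 1) q D) (induced_map (k - 1) q D H ` B)"
    by (intro homotopy_operator_totally_bounded[OF pq]) auto
  then show "compactin (Metric_space.mtopology (Omega (k - 1) q D) (Omega_dist (k - 1) q D))
      (Metric_space.mtopology (Omega (k - 1) q D) (Omega_dist (k - 1) q D) closure_of induced_map (k - 1) q D H ` B)"
    using Metric_space.mtotally_bounded_eq_compact_closure_of[OF Metric_space_Omega[OF pq(2)] mcomplete_Omega[OF pq(2)]]
    by blast
qed

end

theorem theorem1p1:
  fixes D :: "(real ^ 'n::{finite,linorder}) set"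
    and \<phi> :: "real ^ 'n::{finite,linorder} \<Rightarrow> real"
    and \<mu> :: "(real ^ 'n::{finite,linorder}) set \<Rightarrow> real"
    and k :: nat and p q :: real
  assumes "open D" and "connected D" and "D \<noteq> {}" and "bounded D" and "convex D"
    and "1 \<le> k" and "k \<le> CARD('n)"
    and "1 \<le> p" and "1 \<le> q"
    and "test_function D \<phi>"
    and "(LINT y|lebesgue. \<phi> y) = 1"
    and "\<mu> D > 0"
    and "\<And>y. norm (gradient \<phi> y) \<le> 2 * \<mu> D * diameter D powi (- int CARD('n) - 1)"
    and "1 / p - 1 / q < 1 / real CARD('n)"
  shows "compact_operator_on_forms k p (k - 1) q D (homotopy_operator k D \<phi>)"
proof -
  interpret homotopy_setting D \<phi> k
    by unfold_locales fact+
  show ?thesis by (rule homotopy_operator_compact) fact+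
qed

end
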